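(* Let $N$ be a smooth connected manifold of dimension $n$ (Hausdorff, second countable, without boundary), let $m\ge 1$, and fix base points $*\in S^m$ and $*_1\neq *_2$ in $N$. For $i=1,2$ let $i'$ denote the other index ($\{i,i'\}=\{1,2\}$) and define $$\pi^c_m(N,*_i):=\{[f]\in\pi_m(N,*_i)\mid (f,*_{i'}) \text{ is loose}\},$$ $$\pi^{(2)}_m(N,*_i):=\{[f]\in\pi_m(N,*_i)\mid \exists\,[\overline f]\in\pi_m(N,*_{i'}) \text{ such that } (f,\overline f)\text{ is loose}\},$$ where $*_{i'}$ also denotes the constant map $S^m\to N$ with value $*_{i'}$. Then $\pi^c_m(N,*_i)\subset\pi^{(2)}_m(N,*_i)$ are subgroups of $\pi_m(N,*_i)$, and there is a well-defined group isomorphism $$c:\ \pi^{(2)}_m(N,*_1)/\pi^c_m(N,*_1)\longrightarrow \pi^{(2)}_m(N,*_2)/\pi^c_m(N,*_2)$$ which takes the coset of $[f]\in\pi^{(2)}_m(N,*_1)$ to the coset of any element $[\overline f]\in\pi^{(2)}_m(N,*_2)$ such that $(f,\overline f)$ is loose. A pair $([f_1],[f_2])\in\pi_m(N,*_1)\times\pi_m(N,*_2)$ is loose if and only if $[f_i]\in\pi^{(2)}_m(N,*_i)$ for $i=1,2$ and $c$ maps the coset of $[f_1]$ to the coset of $[f_2]$. In particular, if $\pi^c_m(N,*_i)=\pi_m(N,*_i)$ (for $i=1,2$), then all pairs of maps $f_1,f_2:S^m\to N$ (base point preserving or not) are loose; this is the case e.g. when $N$ is not compact or when $m<n$.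
   Context: For maps $f_1,f_2:M\to N$, the coincidence set is $C(f_1,f_2)=\{x\in M\mid f_1(x)=f_2(x)\}$. A pair $(f_1,f_2)$ of maps $S^m\to N$ is called loose if there are maps $f_1'\simeq f_1$, $f_2'\simeq f_2$ with $C(f_1',f_2')=\emptyset$. For based maps ($f_1( * )=*_1$, $f_2( * )=*_2$) it makes no difference whether the homotopies are required to be base point preserving or not. Looseness of a pair of based homotopy classes means looseness of a (any) pair of representatives. *)

theory Defs
  imports "HOL-Analysis.Analysis" "HOL-Algebra.Coset" "HOL-Algebra.Generated_Groups"
begin

fun iter_partial ::
  "'a::real_normed_vector list \<Rightarrow> ('a \<Rightarrow> 'b::real_normed_vector) \<Rightarrow> 'a \<Rightarrow> 'b" where
  "iter_partial [] f = f"
| "iter_partial (v # vs) f = (\<lambda>x. frechet_derivative (iter_partial vs f) (at x) v)"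

definition smooth_on :: "'a::euclidean_space set \<Rightarrow> ('a \<Rightarrow> 'b::real_normed_vector) \<Rightarrow> bool" where
  "smooth_on S f \<longleftrightarrow>
     (\<forall>vs. set vs \<subseteq> Basis \<longrightarrow> (\<forall>x\<in>S. iter_partial vs f differentiable (at x)))"

definition smooth_atlas :: "'a topology \<Rightarrow> ('a set \<times> ('a \<Rightarrow> real^'n)) set \<Rightarrow> bool" where
  "smooth_atlas N A \<longleftrightarrow>
     (\<forall>(U,\<phi>)\<in>A. openin N U \<and> open (\<phi> ` U) \<and>
                 homeomorphic_map (subtopology N U) (top_of_set (\<phi> ` U)) \<phi>) \<and>
     (\<Union>(fst ` A) = topspace N) \<and>
     (\<forall>(U,\<phi>)\<in>A. \<forall>(V,\<psi>)\<in>A. smooth_on (\<phi> ` (U \<inter> V)) (\<psi> \<circ> inv_into U \<phi>))"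

definition smooth_manifold :: "'a topology \<Rightarrow> 'n::finite itself \<Rightarrow> bool" where
  "smooth_manifold N _ \<longleftrightarrow> Hausdorff_space N \<and> second_countable N \<and>
     (\<exists>A :: ('a set \<times> ('a \<Rightarrow> real^'n)) set. smooth_atlas N A)"

text \<open>The cube I^m, with points represented as functions nat => real vanishing
  from coordinate m on, and its boundary. S^m is I^m / boundary, so maps
  S^m -> N are maps I^m -> N that are constant on the boundary.\<close>
definition cube :: "nat \<Rightarrow> (nat \<Rightarrow> real) set" where
  "cube m = {x. (\<forall>i<m. 0 \<le> x i \<and> x i \<le> 1) \<and> (\<forall>i\<ge>m. x i = 0)}"

definition cube_bd :: "nat \<Rightarrow> (nat \<Rightarrow> real) set" where
  "cube_bd m = {x \<in> cube m. \<exists>i<m. x i = 0 \<or> x i = 1}"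

definition sphere_maps :: "nat \<Rightarrow> 'a topology \<Rightarrow> ((nat \<Rightarrow> real) \<Rightarrow> 'a) set" where
  "sphere_maps m N = {g \<in> extensional (cube m).
      continuous_map (top_of_set (cube m)) N g \<and> (\<exists>c. \<forall>x\<in>cube_bd m. g x = c)}"

definition based_maps :: "nat \<Rightarrow> 'a topology \<Rightarrow> 'a \<Rightarrow> ((nat \<Rightarrow> real) \<Rightarrow> 'a) set" where
  "based_maps m N b = {g \<in> extensional (cube m).
      continuous_map (top_of_set (cube m)) N g \<and> (\<forall>x\<in>cube_bd m. g x = b)}"

definition free_htpc :: "nat \<Rightarrow> 'a topology \<Rightarrow> ((nat \<Rightarrow> real) \<Rightarrow> 'a) \<Rightarrow> ((nat \<Rightarrow> real) \<Rightarrow> 'a) \<Rightarrow> bool" where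
  "free_htpc m N f g \<longleftrightarrow>
     homotopic_with (\<lambda>k. \<exists>c. \<forall>x\<in>cube_bd m. k x = c) (top_of_set (cube m)) N f g"

definition htp_class :: "nat \<Rightarrow> 'a topology \<Rightarrow> 'a \<Rightarrow> ((nat \<Rightarrow> real) \<Rightarrow> 'a) \<Rightarrow> ((nat \<Rightarrow> real) \<Rightarrow> 'a) set" where
  "htp_class m N b f = {g \<in> based_maps m N b.
     homotopic_with (\<lambda>k. \<forall>x\<in>cube_bd m. k x = b) (top_of_set (cube m)) N f g}"

definition concat_cube :: "nat \<Rightarrow> ((nat \<Rightarrow> real) \<Rightarrow> 'a) \<Rightarrow> ((nat \<Rightarrow> real) \<Rightarrow> 'a) \<Rightarrow> (nat \<Rightarrow> real) \<Rightarrow> 'a" where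
  "concat_cube m f g = (\<lambda>x\<in>cube m. if x 0 \<le> 1/2 then f (x(0 := 2 * x 0))
                                      else g (x(0 := 2 * x 0 - 1)))"

definition homotopy_group :: "nat \<Rightarrow> 'a topology \<Rightarrow> 'a \<Rightarrow> ((nat \<Rightarrow> real) \<Rightarrow> 'a) set monoid" where
  "homotopy_group m N b =
     \<lparr>carrier = htp_class m N b ` based_maps m N b,
      mult = (\<lambda>A B. htp_class m N b (concat_cube m (SOME f. f \<in> A) (SOME g. g \<in> B))),
      one = htp_class m N b (\<lambda>x\<in>cube m. b)\<rparr>"

definition loose :: "nat \<Rightarrow> 'a topology \<Rightarrow> ((nat \<Rightarrow> real) \<Rightarrow> 'a) \<Rightarrow> ((nat \<Rightarrow> real) \<Rightarrow> 'a) \<Rightarrow> bool" where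
  "loose m N f1 f2 \<longleftrightarrow>
     (\<exists>f1' f2'. f1' \<in> sphere_maps m N \<and> f2' \<in> sphere_maps m N \<and>
        free_htpc m N f1 f1' \<and> free_htpc m N f2 f2' \<and>
        (\<forall>x\<in>cube m. f1' x \<noteq> f2' x))"

text \<open>Looseness of a pair of based homotopy classes: of a (any) pair of representatives.\<close>
definition loose_cls :: "nat \<Rightarrow> 'a topology \<Rightarrow> ((nat \<Rightarrow> real) \<Rightarrow> 'a) set \<Rightarrow> ((nat \<Rightarrow> real) \<Rightarrow> 'a) set \<Rightarrow> bool" where
  "loose_cls m N A B \<longleftrightarrow> (\<exists>f\<in>A. \<exists>g\<in>B. loose m N f g)"

definition pi_c :: "nat \<Rightarrow> 'a topology \<Rightarrow> 'a \<Rightarrow> 'a \<Rightarrow> ((nat \<Rightarrow> real) \<Rightarrow> 'a) set set" where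
  "pi_c m N b b' = {A \<in> carrier (homotopy_group m N b).
      loose_cls m N A {\<lambda>x\<in>cube m. b'}}"

definition pi_2 :: "nat \<Rightarrow> 'a topology \<Rightarrow> 'a \<Rightarrow> 'a \<Rightarrow> ((nat \<Rightarrow> real) \<Rightarrow> 'a) set set" where
  "pi_2 m N b b' = {A \<in> carrier (homotopy_group m N b).
      \<exists>B\<in>carrier (homotopy_group m N b'). loose_cls m N A B}"

end

theory Submission
  imports Defs
begin

text \<open>The pairs of classes that have pointwise disjoint \<^emph>\<open>based\<close> representatives visibly form
  a subgroup of \<open>\<pi>\<^sub>m(N,b1) \<times> \<pi>\<^sub>m(N,b2)\<close>, because concatenation and reversal preserve disjointness. For such a
  subgroup all claims about \<open>\<pi>\<^sup>c\<close>, \<open>\<pi>\<^sup>(\<^sup>2\<^sup>)\<close> and \<open>c\<close> are Goursat's lemma, so the point is to make a disjoint pair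
  \<open>(f', g')\<close> obtained by free homotopies based again. One transports \<open>f'\<close> and \<open>g'\<close> back along the tracks of their
  base points, inserted in a collar of the cube. In dimension at least 2 the tracks can be made disjoint,
  one at a time, since a path can be pushed off a point. In dimension 1 this is impossible, but then either every
  compact subset lies in an open set homeomorphic to the line, and all based maps are null homotopic, or \<open>N\<close> is a
  circle, where multiplication turns free homotopies into based ones and disjoint tracks are given explicitly.

  The map \<open>f\<close> lies in \<open>\<pi>\<^sup>c\<close> as soon as it is homotopic to a map missing a point: this holds for compactness reasons
  if \<open>N\<close> is not compact, and by polynomial approximation in a chart if \<open>m < n\<close>.\<close>

section \<open>The homotopy groups\<close>

text \<open>Transport along a path may change the based class, depending on the homotopy class of
  the path. Joining the base points by disjoint paths is therefore not enough: to return to the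
  class of \<open>f\<close>, the path must be the reversed track of the free homotopy, up to
  homotopy with fixed ends. This is why pushing a path off a point has to deliver a homotopy of
  paths. Moving one base point while the other rests at \<open>p2\<close> requires a target
  different from \<open>p2\<close>; a collision is removed by first sending the resting point to a
  third point. On the circle tracks may wind differently and no such push exists, but there the free
  class determines the based one, so any disjoint paths serve. The dichotomy in dimension one is
  decided by charts onto the whole line: two of them that overlap in a disconnected set already
  close up to a circle, and if no such pair exists, overlapping ones merge into a single
  chart.\<close>

lemma continuous_map_paste_closed:
  assumes "closedin X A" "closedin X B" "topspace X \<subseteq> A \<union> B"
    and f: "continuous_map (subtopology X A) Y f" and g: "continuous_map (subtopology X B) Y g"
    and fg: "\<And>x. x \<in> A \<Longrightarrow> x \<in> B \<Longrightarrow> f x = g x"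
    and h: "\<And>x. x \<in> A \<Longrightarrow> h x = f x" "\<And>x. x \<in> B \<Longrightarrow> h x = g x"
  shows "continuous_map X Y h"
proof (rule pasting_lemma_closed[where I = "{True,False}" and f = "\<lambda>b. if b then f else g"
      and T = "\<lambda>b. if b then A else B"])
  fix x assume "x \<in> topspace X"
  then show "\<exists>j. j \<in> {True,False} \<and> x \<in> (if j then A else B) \<and> h x = (if j then f else g) x"
    using assms(3) h by auto
qed (use assms in auto)

lemma continuous_map_compose_set:
  assumes "continuous_map (top_of_set T) N f" "continuous_on S p" "\<And>x. x \<in> S \<Longrightarrow> p x \<in> T"
  shows "continuous_map (top_of_set S) N (\<lambda>x. f (p x))"
proof -
  have "continuous_map (top_of_set S) (top_of_set T) p"
    using assms by auto
  from continuous_map_compose[OF this assms(1)] show ?thesis by (simp add: o_def)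
qed

lemma continuous_on_coord [continuous_intros]: "continuous_on S (\<lambda>x. x (i::nat) :: real)"
  by (rule continuous_on_subset[OF continuous_on_product_coordinates]) simp

lemma continuous_on_snd_coord [continuous_intros]: "continuous_on S (\<lambda>x. snd x (i::nat) :: real)"
  by (rule continuous_on_product_then_coordinatewise) (intro continuous_on_snd continuous_on_id)

lemma continuous_on_upd:
  assumes "continuous_on S f" "continuous_on S g"
  shows "continuous_on S (\<lambda>x. (f x)((i::nat) := (g x :: real)))"
proof (rule continuous_on_coordinatewise_then_product)
  fix j show "continuous_on S (\<lambda>x. ((f x)(i := g x)) j)"
    using assms by (cases "j = i") (auto intro: continuous_on_product_then_coordinatewise)
qed

section \<open>The cube and its boundary\<close>

lemma cube_bd_subset: "x \<in> cube_bd m \<Longrightarrow> x \<in> cube m"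
  by (simp add: cube_bd_def)

lemma zero_in_cube_bd: "m \<ge> 1 \<Longrightarrow> (\<lambda>_. 0) \<in> cube_bd m"
  by (auto simp: cube_bd_def cube_def intro!: exI[of _ 0])

lemma cube_upd: "m \<ge> 1 \<Longrightarrow> x \<in> cube m \<Longrightarrow> 0 \<le> s \<Longrightarrow> s \<le> 1 \<Longrightarrow> x(0 := s) \<in> cube m"
  by (auto simp: cube_def)

lemma cube_coord: "m \<ge> 1 \<Longrightarrow> x \<in> cube m \<Longrightarrow> 0 \<le> x 0 \<and> x 0 \<le> 1"
  by (auto simp: cube_def)

text \<open>From coordinate \<open>m\<close> on the factor is the single point 0, so the cube is a
  full product of compact sets inside the infinite product.\<close>

lemma compact_cube: "compact (cube m)"
proof -
  have eq: "cube m = PiE UNIV (\<lambda>i. if i < m then {0..1} else {0})"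
  proof (intro equalityI subsetI)
    fix x :: "nat \<Rightarrow> real" assume "x \<in> cube m"
    then show "x \<in> PiE UNIV (\<lambda>i. if i < m then {0..1} else {0})"
      by (simp add: cube_def PiE_iff not_less)
  next
    fix x :: "nat \<Rightarrow> real" assume "x \<in> PiE UNIV (\<lambda>i. if i < m then {0..1} else {0})"
    then have "x i \<in> (if i < m then {0..1} else {0})" for i by blast
    then have "i < m \<Longrightarrow> x i \<in> {0..1}" "\<not> i < m \<Longrightarrow> x i = 0" for i
      by (metis, metis singletonD)
    then show "x \<in> cube m"
      by (simp add: cube_def not_less)
  qed
  have "compactin (product_topology (\<lambda>i. euclideanreal) UNIV) (cube m)"
    unfolding eq compactin_PiE by auto
  then show ?thesis by (simp add: euclidean_product_topology)
qed

text \<open>The relation used inside \<open>htp_class\<close>, separated from membership in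
  \<open>based_maps\<close>: values outside the cube do not matter for it, so maps that are not
  extensional can be compared as well.\<close>

definition based_htpc ::
  "nat \<Rightarrow> 'a topology \<Rightarrow> 'a \<Rightarrow> ((nat \<Rightarrow> real) \<Rightarrow> 'a) \<Rightarrow> ((nat \<Rightarrow> real) \<Rightarrow> 'a) \<Rightarrow> bool" where
  "based_htpc m N b f g \<longleftrightarrow>
     homotopic_with (\<lambda>k. \<forall>x\<in>cube_bd m. k x = b) (top_of_set (cube m)) N f g"

lemma based_htpc_iff:
  "based_htpc m N b f g \<longleftrightarrow>
     (\<exists>h. continuous_map (top_of_set ({0..1::real} \<times> cube m)) N h \<and>
        (\<forall>x\<in>cube m. h (0,x) = f x) \<and> (\<forall>x\<in>cube m. h (1,x) = g x) \<and>
        (\<forall>t\<in>{0..1}. \<forall>x\<in>cube_bd m. h (t,x) = b))"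
proof -
  have *: "(\<forall>x\<in>cube_bd m. h x = b) \<longleftrightarrow> (\<forall>x\<in>cube_bd m. k x = b)"
    if "\<And>x. x \<in> topspace (top_of_set (cube m)) \<Longrightarrow> h x = k x" for h k
    using that by (simp add: cube_bd_subset)
  show ?thesis unfolding based_htpc_def by (subst homotopic_with[OF *]) simp_all
qed

lemma free_htpc_iff:
  "free_htpc m N f g \<longleftrightarrow>
     (\<exists>h. continuous_map (top_of_set ({0..1::real} \<times> cube m)) N h \<and>
        (\<forall>x\<in>cube m. h (0,x) = f x) \<and> (\<forall>x\<in>cube m. h (1,x) = g x) \<and>
        (\<forall>t\<in>{0..1}. \<exists>c. \<forall>x\<in>cube_bd m. h (t,x) = c))"
proof -
  have *: "(\<exists>c. \<forall>x\<in>cube_bd m. h x = c) \<longleftrightarrow> (\<exists>c. \<forall>x\<in>cube_bd m. k x = c)"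
    if "\<And>x. x \<in> topspace (top_of_set (cube m)) \<Longrightarrow> h x = k x" for h k
    using that by (simp add: cube_bd_subset)
  show ?thesis unfolding free_htpc_def by (subst homotopic_with[OF *]) simp_all
qed

lemma based_imp_free_htpc: "based_htpc m N b f g \<Longrightarrow> free_htpc m N f g"
  unfolding based_htpc_def free_htpc_def by (erule homotopic_with_mono) blast

lemma free_htpc_trans: "free_htpc m N f g \<Longrightarrow> free_htpc m N g h \<Longrightarrow> free_htpc m N f h"
  unfolding free_htpc_def by (rule homotopic_with_trans)

lemma based_htpc_sym: "based_htpc m N b f g \<Longrightarrow> based_htpc m N b g f"
  unfolding based_htpc_def by (rule homotopic_with_symD)

lemma based_htpc_trans [trans]: "based_htpc m N b f g \<Longrightarrow> based_htpc m N b g h \<Longrightarrow> based_htpc m N b f h"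
  unfolding based_htpc_def by (rule homotopic_with_trans)

lemma based_htpc_refl: "f \<in> based_maps m N b \<Longrightarrow> based_htpc m N b f f"
  unfolding based_htpc_def by (simp add: based_maps_def)

lemma based_htpc_cong:
  "(\<And>x. x \<in> cube m \<Longrightarrow> f x = f' x) \<Longrightarrow> (\<And>x. x \<in> cube m \<Longrightarrow> g x = g' x) \<Longrightarrow>
    based_htpc m N b f g \<longleftrightarrow> based_htpc m N b f' g'"
  unfolding based_htpc_iff by (simp cong: conj_cong)

lemma based_maps_continuous:
  "f \<in> based_maps m N b \<Longrightarrow> continuous_map (top_of_set (cube m)) N f"
  by (simp add: based_maps_def)

lemma based_maps_bd: "f \<in> based_maps m N b \<Longrightarrow> x \<in> cube_bd m \<Longrightarrow> f x = b"
  by (simp add: based_maps_def)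

lemma based_mapsI:
  "continuous_map (top_of_set (cube m)) N f \<Longrightarrow> (\<And>x. x \<in> cube_bd m \<Longrightarrow> f x = b) \<Longrightarrow>
    restrict f (cube m) \<in> based_maps m N b"
  by (auto simp: based_maps_def dest: cube_bd_subset intro: continuous_map_eq)

lemma based_imp_sphere_maps: "f \<in> based_maps m N b \<Longrightarrow> f \<in> sphere_maps m N"
  by (auto simp: based_maps_def sphere_maps_def)

lemma const_based: "b \<in> topspace N \<Longrightarrow> (\<lambda>x\<in>cube m. b) \<in> based_maps m N b"
  by (rule based_mapsI) auto

lemma htp_class_eq: "htp_class m N b f = {g \<in> based_maps m N b. based_htpc m N b f g}"
  by (simp add: htp_class_def based_htpc_def)

lemma htp_class_self: "f \<in> based_maps m N b \<Longrightarrow> f \<in> htp_class m N b f"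
  by (simp add: htp_class_eq based_htpc_refl)

lemma htp_class_eq_iff:
  assumes "f \<in> based_maps m N b" "g \<in> based_maps m N b"
  shows "htp_class m N b f = htp_class m N b g \<longleftrightarrow> based_htpc m N b f g"
proof
  assume "htp_class m N b f = htp_class m N b g"
  then have "g \<in> htp_class m N b f" using htp_class_self[OF assms(2)] by simp
  then show "based_htpc m N b f g" by (simp add: htp_class_eq)
next
  assume fg: "based_htpc m N b f g"
  have "based_htpc m N b f k \<longleftrightarrow> based_htpc m N b g k" for k
    using based_htpc_trans[OF fg] based_htpc_trans[OF based_htpc_sym[OF fg]] by blast
  then show "htp_class m N b f = htp_class m N b g" by (simp add: htp_class_eq)
qed

lemma homotopy_group_carrier:
  "carrier (homotopy_group m N b) = htp_class m N b ` based_maps m N b"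
  by (simp add: homotopy_group_def)

lemma homotopy_group_one:
  "\<one>\<^bsub>homotopy_group m N b\<^esub> = htp_class m N b (\<lambda>x\<in>cube m. b)"
  by (simp add: homotopy_group_def)

lemma carrier_memD:
  assumes "A \<in> carrier (homotopy_group m N b)" "f \<in> A"
  shows "f \<in> based_maps m N b" "A = htp_class m N b f"
proof -
  obtain g where g: "g \<in> based_maps m N b" "A = htp_class m N b g"
    using assms by (auto simp: homotopy_group_carrier)
  show f: "f \<in> based_maps m N b" using g assms(2) by (simp add: htp_class_eq)
  show "A = htp_class m N b f"
    using g f assms(2) htp_class_eq_iff[OF g(1) f] by (simp add: htp_class_eq)
qed

lemma carrier_ex_mem:
  "A \<in> carrier (homotopy_group m N b) \<Longrightarrow> \<exists>f. f \<in> A"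
  using htp_class_self by (fastforce simp: homotopy_group_carrier)

lemma htp_class_in_carrier:
  "f \<in> based_maps m N b \<Longrightarrow> htp_class m N b f \<in> carrier (homotopy_group m N b)"
  by (simp add: homotopy_group_carrier)

section \<open>Concatenation and the group laws\<close>

lemma concat_continuous:
  fixes S :: "'b::topological_space set"
  assumes m: "m \<ge> 1"
    and f: "continuous_map (top_of_set (S \<times> cube m)) N f"
    and g: "continuous_map (top_of_set (S \<times> cube m)) N g"
    and fb: "\<And>t x. t \<in> S \<Longrightarrow> x \<in> cube_bd m \<Longrightarrow> f (t,x) = b \<and> g (t,x) = b"
  shows "continuous_map (top_of_set (S \<times> cube m)) N
     (\<lambda>(t,x). if x 0 \<le> 1/2 then f (t, x(0 := 2 * x 0)) else g (t, x(0 := 2 * x 0 - 1)))"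
    (is "continuous_map ?X N ?h")
proof (rule continuous_map_paste_closed[where A = "(S \<times> cube m) \<inter> {p. snd p 0 \<le> 1/2}"
        and B = "(S \<times> cube m) \<inter> {p. snd p 0 \<ge> 1/2}" and
        f = "\<lambda>p. f (fst p, (snd p)(0 := 2 * snd p 0))" and g = "\<lambda>p. g (fst p, (snd p)(0 := 2 * snd p 0 - 1))"])
  let ?A = "(S \<times> cube m) \<inter> {p. snd p 0 \<le> 1/2}" and ?B = "(S \<times> cube m) \<inter> {p. snd p 0 \<ge> 1/2}"
  have c: "continuous_on UNIV (\<lambda>p::'b \<times> (nat \<Rightarrow> real). snd p 0)"
    by (rule continuous_on_snd_coord)
  show "closedin ?X ?A" "closedin ?X ?B"
    by (intro closed_Collect_le closedin_closed_Int c continuous_on_const)+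
  have "continuous_map (top_of_set ?A) N (\<lambda>p. f (fst p, (snd p)(0 := 2 * snd p 0)))"
  proof (rule continuous_map_compose_set[OF f])
    show "continuous_on ?A (\<lambda>p. (fst p, (snd p)(0 := 2 * snd p 0)))"
      by (intro continuous_on_Pair continuous_on_upd continuous_on_fst continuous_on_snd
          continuous_on_id continuous_on_diff continuous_on_mult continuous_on_const continuous_on_snd_coord)
  qed (use m cube_coord[OF m] in \<open>auto intro!: cube_upd\<close>)
  then show "continuous_map (subtopology ?X ?A) N (\<lambda>p. f (fst p, (snd p)(0 := 2 * snd p 0)))"
    by (simp add: subtopology_subtopology inf_absorb2)
  have "continuous_map (top_of_set ?B) N (\<lambda>p. g (fst p, (snd p)(0 := 2 * snd p 0 - 1)))"
  proof (rule continuous_map_compose_set[OF g])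
    show "continuous_on ?B (\<lambda>p. (fst p, (snd p)(0 := 2 * snd p 0 - 1)))"
      by (intro continuous_on_Pair continuous_on_upd continuous_on_fst continuous_on_snd
          continuous_on_id continuous_on_diff continuous_on_mult continuous_on_const continuous_on_snd_coord)
  qed (use m cube_coord[OF m] in \<open>auto intro!: cube_upd\<close>)
  then show "continuous_map (subtopology ?X ?B) N (\<lambda>p. g (fst p, (snd p)(0 := 2 * snd p 0 - 1)))"
    by (simp add: subtopology_subtopology inf_absorb2)
  \<comment> \<open>On the wall \<open>x 0 = 1/2\<close> the rescaled points lie on the faces
    \<open>x 0 = 1\<close> and \<open>x 0 = 0\<close>, where both maps take the value
    \<open>b\<close>.\<close>
  have half: "f (fst p, (snd p)(0 := 2 * snd p 0)) = g (fst p, (snd p)(0 := 2 * snd p 0 - 1))"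
    if "p \<in> S \<times> cube m" "snd p 0 = 1/2" for p
  proof -
    have "(snd p)(0 := 1) \<in> cube_bd m" "(snd p)(0 := 0) \<in> cube_bd m"
      using that m by (auto simp: cube_bd_def cube_def)
    moreover have "2 * snd p 0 = 1" "2 * snd p 0 - 1 = 0" "fst p \<in> S" using that by auto
    ultimately show ?thesis using fb by simp
  qed
  then show "\<And>p. p \<in> ?A \<Longrightarrow> p \<in> ?B \<Longrightarrow>
      f (fst p, (snd p)(0 := 2 * snd p 0)) = g (fst p, (snd p)(0 := 2 * snd p 0 - 1))"
    by auto
  show "?h p = g (fst p, (snd p)(0 := 2 * snd p 0 - 1))" if "p \<in> ?B" for p
    using half[of p] that by (cases p) auto
qed auto

lemma concat_bd:
  assumes "m \<ge> 1" "\<And>x. x \<in> cube_bd m \<Longrightarrow> f x = b \<and> g x = b" "x \<in> cube_bd m"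
  shows "(if x 0 \<le> 1/2 then f (x(0 := 2 * x 0)) else g (x(0 := 2 * x 0 - 1))) = b"
proof -
  obtain i where i: "i < m" "x i = 0 \<or> x i = 1" and x: "x \<in> cube m"
    using assms(3) by (auto simp: cube_bd_def)
  have "x 0 \<le> 1/2 \<Longrightarrow> x(0 := 2 * x 0) \<in> cube_bd m"
    using assms(1) i x cube_coord[OF assms(1) x] unfolding cube_bd_def
    by (auto intro!: cube_upd exI[of _ i])
  moreover have "\<not> x 0 \<le> 1/2 \<Longrightarrow> x(0 := 2 * x 0 - 1) \<in> cube_bd m"
    using assms(1) i x cube_coord[OF assms(1) x] unfolding cube_bd_def
    by (auto intro!: cube_upd exI[of _ i])
  ultimately show ?thesis using assms(2) by auto
qed


lemma concat_cube_eq: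
  "x \<in> cube m \<Longrightarrow> concat_cube m f g x = (if x 0 \<le> 1/2 then f (x(0 := 2 * x 0)) else g (x(0 := 2 * x 0 - 1)))"
  by (simp add: concat_cube_def)

lemma based_htpc_concat:
  assumes m: "m \<ge> 1" and "based_htpc m N b f f'" "based_htpc m N b g g'"
  shows "based_htpc m N b (concat_cube m f g) (concat_cube m f' g')"
proof -
  obtain h where h: "continuous_map (top_of_set ({0..1::real} \<times> cube m)) N h"
     "\<And>x. x\<in>cube m \<Longrightarrow> h (0,x) = f x" "\<And>x. x\<in>cube m \<Longrightarrow> h (1,x) = f' x"
     "\<And>t x. t\<in>{0..1} \<Longrightarrow> x\<in>cube_bd m \<Longrightarrow> h (t,x) = b"
    using assms(2) unfolding based_htpc_iff by blast
  obtain k where k: "continuous_map (top_of_set ({0..1::real} \<times> cube m)) N k"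
     "\<And>x. x\<in>cube m \<Longrightarrow> k (0,x) = g x" "\<And>x. x\<in>cube m \<Longrightarrow> k (1,x) = g' x"
     "\<And>t x. t\<in>{0..1} \<Longrightarrow> x\<in>cube_bd m \<Longrightarrow> k (t,x) = b"
    using assms(3) unfolding based_htpc_iff by blast
  let ?H = "\<lambda>(t,x). if x 0 \<le> 1/2 then h (t, x(0 := 2 * x 0)) else k (t, x(0 := 2 * x 0 - 1))"
  show ?thesis unfolding based_htpc_iff
  proof (intro exI[of _ ?H] conjI ballI)
    show "continuous_map (top_of_set ({0..1::real} \<times> cube m)) N ?H"
      by (rule concat_continuous[OF m h(1) k(1), of b]) (use h k in auto)
  next
    fix x assume x: "x \<in> cube m"
    then have "x 0 \<le> 1/2 \<Longrightarrow> x(0 := 2 * x 0) \<in> cube m" "\<not> x 0 \<le> 1/2 \<Longrightarrow> x(0 := 2 * x 0 - 1) \<in> cube m"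
      using cube_coord[OF m x] by (auto intro!: cube_upd[OF m])
    then show "?H (0,x) = concat_cube m f g x" "?H (1,x) = concat_cube m f' g' x"
      using h k by (auto simp: concat_cube_eq[OF x])
  next
    fix t :: real and x assume t: "t \<in> {0..1}" and x: "x \<in> cube_bd m"
    then show "?H (t,x) = b"
      using concat_bd[OF m, of "\<lambda>x. h (t,x)" b "\<lambda>x. k (t,x)" x] h(4) k(4) by simp
  qed
qed

lemma concat_based:
  assumes m: "m \<ge> 1" and f: "f \<in> based_maps m N b" and g: "g \<in> based_maps m N b"
  shows "concat_cube m f g \<in> based_maps m N b"
proof -
  \<comment> \<open>Continuity is read off from the concatenation of two constant
    homotopies.\<close>
  have "continuous_map (top_of_set (cube m)) N (concat_cube m f g)"
    using based_htpc_concat[OF m based_htpc_refl[OF f] based_htpc_refl[OF g]]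
      homotopic_with_imp_continuous_maps unfolding based_htpc_def by blast
  moreover have "concat_cube m f g x = b" if "x \<in> cube_bd m" for x
    using concat_bd[OF m, of f b g x] based_maps_bd[OF f] based_maps_bd[OF g] that
    by (simp add: concat_cube_eq cube_bd_subset)
  ultimately show ?thesis by (auto simp: based_maps_def concat_cube_def)
qed

text \<open>All group laws of the homotopy group are instances of the next lemma: both sides are
  reparametrisations of one map in the first coordinate.\<close>

lemma based_htpc_reparam:
  assumes m: "m \<ge> 1" and f: "f \<in> based_maps m N b"
    and p: "continuous_on {0..1} p" "\<And>s. s \<in> {0..1} \<Longrightarrow> p s \<in> {0..1::real}"
    and q: "continuous_on {0..1} q" "\<And>s. s \<in> {0..1} \<Longrightarrow> q s \<in> {0..1::real}"
    and ends: "p 0 = q 0" "p 1 = q 1" "p 0 \<in> {0,1}" "p 1 \<in> {0,1}"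
  shows "based_htpc m N b (\<lambda>x. f (x(0 := p (x 0)))) (\<lambda>x. f (x(0 := q (x 0))))"
proof -
  let ?r = "\<lambda>t s. (1 - t) * p s + t * q s"
  have r: "?r t s \<in> {0..1}" if "t \<in> {0..1}" "s \<in> {0..1}" for t s
  proof -
    have "?r t s \<in> closed_segment (p s) (q s)"
      using that by (auto simp: closed_segment_def)
    also have "\<dots> \<subseteq> {0..1}"
      using p(2)[of s] q(2)[of s] that by (intro closed_segment_subset) auto
    finally show ?thesis .
  qed
  have x0: "snd x 0 \<in> {0..1}" if "x \<in> {0..1::real} \<times> cube m" for x
    using that cube_coord[OF m, of "snd x"] by auto
  show ?thesis unfolding based_htpc_iff
  proof (intro exI[of _ "\<lambda>x. f ((snd x)(0 := ?r (fst x) (snd x 0)))"] conjI ballI)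
    show "continuous_map (top_of_set ({0..1::real} \<times> cube m)) N (\<lambda>x. f ((snd x)(0 := ?r (fst x) (snd x 0))))"
    proof (rule continuous_map_compose_set[OF based_maps_continuous[OF f]])
      show "continuous_on ({0..1} \<times> cube m) (\<lambda>x. (snd x)(0 := ?r (fst x) (snd x 0)))"
        by (intro continuous_on_upd continuous_on_add continuous_on_mult continuous_on_diff continuous_on_const
            continuous_on_fst continuous_on_snd continuous_on_id
            continuous_on_compose2[OF p(1) continuous_on_snd_coord] continuous_on_compose2[OF q(1) continuous_on_snd_coord])
          (use x0 in auto)
      fix x assume "x \<in> {0..1::real} \<times> cube m"
      then show "(snd x)(0 := ?r (fst x) (snd x 0)) \<in> cube m"
        using r[of "fst x" "snd x 0"] x0[of x] by (intro cube_upd[OF m]) auto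
    qed
  next
    fix t :: real and x assume t: "t \<in> {0..1}" and x: "x \<in> cube_bd m"
    then obtain i where i: "i < m" "x i = 0 \<or> x i = 1" and xc: "x \<in> cube m"
      by (auto simp: cube_bd_def)
    \<comment> \<open>Only the faces in coordinate 0 are affected; there \<open>p\<close> and
      \<open>q\<close> agree and take the value 0 or 1, so boundary points stay on the
      boundary.\<close>
    have "?r t (x 0) = x 0 \<or> ?r t (x 0) = 0 \<or> ?r t (x 0) = 1" if "i = 0"
      using i that ends by (auto simp: algebra_simps)
    then have "x(0 := ?r t (x 0)) \<in> cube_bd m"
      using r[OF t, of "x 0"] cube_coord[OF m xc] i xc
      unfolding cube_bd_def by (auto intro!: cube_upd[OF m] exI[of _ i])
    then show "f ((snd (t,x))(0 := ?r (fst (t,x)) (snd (t,x) 0))) = b"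
      using based_maps_bd[OF f] by simp
  qed auto
qed

definition rev_cube :: "nat \<Rightarrow> ((nat \<Rightarrow> real) \<Rightarrow> 'a) \<Rightarrow> (nat \<Rightarrow> real) \<Rightarrow> 'a" where
  "rev_cube m f = (\<lambda>x\<in>cube m. f (x(0 := 1 - x 0)))"

lemma rev_cube_based:
  assumes m: "m \<ge> 1" and f: "f \<in> based_maps m N b"
  shows "rev_cube m f \<in> based_maps m N b"
  unfolding rev_cube_def
proof (rule based_mapsI)
  show "continuous_map (top_of_set (cube m)) N (\<lambda>x. f (x(0 := 1 - x 0)))"
    by (rule continuous_map_compose_set[OF based_maps_continuous[OF f]])
       (use cube_coord[OF m] in \<open>auto intro!: cube_upd[OF m] continuous_on_upd continuous_on_diff
          continuous_on_coord continuous_on_id\<close>)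
  fix x assume x: "x \<in> cube_bd m"
  then obtain i where i: "i < m" "x i = 0 \<or> x i = 1" and xc: "x \<in> cube m"
    by (auto simp: cube_bd_def)
  then have "x(0 := 1 - x 0) \<in> cube_bd m"
    using cube_coord[OF m xc] unfolding cube_bd_def by (auto intro!: cube_upd[OF m] exI[of _ i])
  then show "f (x(0 := 1 - x 0)) = b" by (rule based_maps_bd[OF f])
qed

text \<open>The product in \<open>homotopy_group\<close> uses chosen representatives; since
  concatenation respects homotopy, any other representatives serve as well.\<close>

lemma htp_class_mult:
  assumes m: "m \<ge> 1" and f: "f \<in> based_maps m N b" and g: "g \<in> based_maps m N b"
  shows "htp_class m N b f \<otimes>\<^bsub>homotopy_group m N b\<^esub> htp_class m N b g = htp_class m N b (concat_cube m f g)"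
proof -
  let ?f = "SOME k. k \<in> htp_class m N b f" and ?g = "SOME k. k \<in> htp_class m N b g"
  have "?f \<in> htp_class m N b f" "?g \<in> htp_class m N b g"
    using someI_ex[of "\<lambda>k. k \<in> htp_class m N b f"] someI_ex[of "\<lambda>k. k \<in> htp_class m N b g"]
      htp_class_self[OF f] htp_class_self[OF g] by blast+
  then have "?f \<in> based_maps m N b" "?g \<in> based_maps m N b" "based_htpc m N b f ?f" "based_htpc m N b g ?g"
    by (auto simp: htp_class_eq)
  then have "htp_class m N b (concat_cube m ?f ?g) = htp_class m N b (concat_cube m f g)"
    using htp_class_eq_iff concat_based[OF m] based_htpc_concat[OF m] f g based_htpc_sym by metis
  then show ?thesis by (simp add: homotopy_group_def)
qed

lemma continuous_on_if_le_half:
  fixes p q :: "real \<Rightarrow> real"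
  assumes "continuous_on UNIV p" "continuous_on UNIV q" "p a = q a"
  shows "continuous_on S (\<lambda>s. if s \<le> a then p s else q s)"
proof (rule continuous_on_subset[of UNIV])
  have "continuous_on ({..a} \<union> {a..}) (\<lambda>s. if s \<le> a then p s else q s)"
    by (rule continuous_on_If) (use assms continuous_on_subset in \<open>auto intro: continuous_on_subset\<close>)
  moreover have "{..a} \<union> {a..} = (UNIV :: real set)" by auto
  ultimately show "continuous_on UNIV (\<lambda>s. if s \<le> a then p s else q s)" by simp
qed simp

lemma concat_rev_null:
  assumes m: "m \<ge> 1" and f: "f \<in> based_maps m N b"
  shows "based_htpc m N b (concat_cube m (rev_cube m f) f) (\<lambda>x\<in>cube m. b)"
proof -
  \<comment> \<open>This runs from 1 down to 0 and back to 1, so it deforms with fixed ends to the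
    constant 1, where \<open>f\<close> has the value \<open>b\<close>.\<close>
  let ?p = "\<lambda>s::real. if s \<le> 1/2 then 1 - 2 * s else 2 * s - 1"
  have p: "continuous_on {0..1} ?p"
    by (rule continuous_on_if_le_half) (auto intro!: continuous_intros)
  have "based_htpc m N b (\<lambda>x. f (x(0 := ?p (x 0)))) (\<lambda>x. f (x(0 := 1)))"
    by (rule based_htpc_reparam[OF m f p, where q = "\<lambda>_. 1"]) (auto intro!: continuous_intros)
  moreover have "x(0 := 1) \<in> cube_bd m" if "x \<in> cube m" for x
    using m that by (auto simp: cube_bd_def cube_def)
  ultimately show ?thesis
    using m cube_coord[OF m] by (subst based_htpc_cong)
      (auto simp: concat_cube_eq rev_cube_def based_maps_bd[OF f] cube_upd)
qed

lemma concat_const_left: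
  assumes m: "m \<ge> 1" and f: "f \<in> based_maps m N b"
  shows "based_htpc m N b (concat_cube m (\<lambda>x\<in>cube m. b) f) f"
proof -
  let ?p = "\<lambda>s::real. if s \<le> 1/2 then 0 else 2 * s - 1"
  have p: "continuous_on {0..1} ?p"
    by (rule continuous_on_if_le_half) (auto intro!: continuous_intros)
  have "based_htpc m N b (\<lambda>x. f (x(0 := ?p (x 0)))) (\<lambda>x. f (x(0 := x 0)))"
    by (rule based_htpc_reparam[OF m f p, where q = "\<lambda>s. s"]) (auto intro!: continuous_intros)
  moreover have "x(0 := 0) \<in> cube_bd m" if "x \<in> cube m" for x
    using m that by (auto simp: cube_bd_def cube_def)
  ultimately show ?thesis
    using m cube_coord[OF m] by (subst based_htpc_cong)
      (auto simp: concat_cube_eq based_maps_bd[OF f] cube_upd)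
qed

lemma concat_assoc:
  assumes m: "m \<ge> 1" and f: "f \<in> based_maps m N b" and g: "g \<in> based_maps m N b" and h: "h \<in> based_maps m N b"
  shows "based_htpc m N b (concat_cube m (concat_cube m f g) h) (concat_cube m f (concat_cube m g h))"
proof -
  let ?k = "concat_cube m f (concat_cube m g h)"
  \<comment> \<open>The pieces \<open>[0,1/4]\<close>, \<open>[1/4,1/2]\<close>,
    \<open>[1/2,1]\<close> go onto \<open>[0,1/2]\<close>, \<open>[1/2,3/4]\<close>,
    \<open>[3/4,1]\<close>, which turns one bracketing into the other.\<close>
  let ?p = "\<lambda>s::real. if s \<le> 1/2 then (if s \<le> 1/4 then 2 * s else s + 1/4) else s/2 + 1/2"
  have k: "?k \<in> based_maps m N b" using assms by (intro concat_based)
  have c: "continuous_on UNIV (\<lambda>s::real. if s \<le> 1/4 then 2 * s else s + 1/4)"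
    by (rule continuous_on_if_le_half) (auto intro!: continuous_intros)
  have p: "continuous_on {0..1} ?p"
    by (rule continuous_on_if_le_half[OF c]) (auto intro!: continuous_intros)
  have "based_htpc m N b (\<lambda>x. ?k (x(0 := ?p (x 0)))) (\<lambda>x. ?k (x(0 := x 0)))"
    by (rule based_htpc_reparam[OF m k p, where q = "\<lambda>s. s"]) (auto intro!: continuous_intros split: if_splits)
  moreover have "concat_cube m (concat_cube m f g) h x = ?k (x(0 := ?p (x 0)))" if x: "x \<in> cube m" for x
  proof -
    have 0: "0 \<le> x 0" "x 0 \<le> 1" using cube_coord[OF m x] by auto
    consider "x 0 \<le> 1/4" | "1/4 < x 0" "x 0 \<le> 1/2" | "1/2 < x 0" by linarith
    then show ?thesis
    proof cases
      case 1
      then show ?thesis using 0 x m by (simp add: concat_cube_eq cube_upd)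
    next
      case 2
      then show ?thesis using 0 x m by (simp add: concat_cube_eq cube_upd)
    next
      case 3
      then show ?thesis using 0 x m by (simp add: concat_cube_eq cube_upd)
    qed
  qed
  ultimately show ?thesis by (subst based_htpc_cong) auto
qed

lemma homotopy_group_group:
  assumes m: "m \<ge> 1" and b: "b \<in> topspace N"
  shows "group (homotopy_group m N b)"
proof (rule groupI)
  let ?G = "homotopy_group m N b"
  note [simp] = homotopy_group_carrier homotopy_group_one
  show "\<one>\<^bsub>?G\<^esub> \<in> carrier ?G" using const_based[OF b] by simp
  show "x \<otimes>\<^bsub>?G\<^esub> y \<in> carrier ?G" if "x \<in> carrier ?G" "y \<in> carrier ?G" for x y
    using that by (auto simp: htp_class_mult[OF m] concat_based[OF m])
  show "x \<otimes>\<^bsub>?G\<^esub> y \<otimes>\<^bsub>?G\<^esub> z = x \<otimes>\<^bsub>?G\<^esub> (y \<otimes>\<^bsub>?G\<^esub> z)"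
    if "x \<in> carrier ?G" "y \<in> carrier ?G" "z \<in> carrier ?G" for x y z
    using that by (clarsimp simp: htp_class_mult[OF m] concat_based[OF m])
      (simp add: htp_class_eq_iff concat_based[OF m] concat_assoc[OF m])
  show "\<one>\<^bsub>?G\<^esub> \<otimes>\<^bsub>?G\<^esub> x = x" if "x \<in> carrier ?G" for x
    using that by (clarsimp simp: htp_class_mult[OF m] concat_based[OF m] const_based[OF b])
      (simp add: htp_class_eq_iff concat_based[OF m] const_based[OF b] concat_const_left[OF m])
  show "\<exists>y\<in>carrier ?G. y \<otimes>\<^bsub>?G\<^esub> x = \<one>\<^bsub>?G\<^esub>" if x: "x \<in> carrier ?G" for x
  proof -
    obtain f where f: "f \<in> based_maps m N b" "x = htp_class m N b f" using x by auto
    show ?thesis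
      using f rev_cube_based[OF m f(1)] concat_rev_null[OF m f(1)]
      by (intro bexI[of _ "htp_class m N b (rev_cube m f)"])
         (auto simp: htp_class_mult[OF m] concat_based[OF m] htp_class_eq_iff const_based[OF b])
  qed
qed

lemma htp_class_inv:
  assumes m: "m \<ge> 1" and b: "b \<in> topspace N" and f: "f \<in> based_maps m N b"
  shows "inv\<^bsub>homotopy_group m N b\<^esub> (htp_class m N b f) = htp_class m N b (rev_cube m f)"
  using f rev_cube_based[OF m f] concat_rev_null[OF m f] concat_based[OF m _ f]
  by (intro group.inv_equality[OF homotopy_group_group[OF m b]])
     (auto simp: htp_class_mult[OF m] htp_class_in_carrier homotopy_group_one htp_class_eq_iff const_based[OF b])

section \<open>Transport of sphere maps along paths\<close>

text \<open>The truncation by \<open>s\<close> in \<open>excess\<close> makes it constant on the boundary of the cube, where the sum is not.\<close>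

definition stretch :: "nat \<Rightarrow> real \<Rightarrow> (nat \<Rightarrow> real) \<Rightarrow> nat \<Rightarrow> real" where
  "stretch m s x = (\<lambda>i. if i < m then max 0 (min 1 (1/2 + (1 + s) * (x i - 1/2))) else 0)"

definition excess :: "nat \<Rightarrow> real \<Rightarrow> (nat \<Rightarrow> real) \<Rightarrow> real" where
  "excess m s x = min s (\<Sum>i<m. max 0 (2 * (1 + s) * \<bar>x i - 1/2\<bar> - 1))"

lemma stretch_cube: "stretch m s x \<in> cube m"
  by (simp add: stretch_def cube_def)

lemma stretch_0: "x \<in> cube m \<Longrightarrow> stretch m 0 x = x"
  by (rule ext) (simp add: stretch_def cube_def not_less)

lemma excess_bounds: "0 \<le> s \<Longrightarrow> 0 \<le> excess m s x" "excess m s x \<le> s"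
  by (auto simp: excess_def intro: sum_nonneg)

text \<open>A nonzero summand places its coordinate outside the inner cube of side
  \<open>1/(1+s)\<close> about the centre, and there the clamping in \<open>stretch\<close> sends it
  to 0 or 1. So \<open>stretch\<close> collapses the collar onto the boundary.\<close>

lemma excess_pos:
  assumes "excess m s x \<noteq> 0" "0 \<le> s"
  shows "stretch m s x \<in> cube_bd m"
proof -
  have "(\<Sum>i<m. max 0 (2 * (1 + s) * \<bar>x i - 1/2\<bar> - 1)) \<noteq> 0"
    using assms by (auto simp: excess_def)
  then obtain i where "i \<in> {..<m}" "max 0 (2 * (1 + s) * \<bar>x i - 1/2\<bar> - 1) \<noteq> 0"
    by (rule sum.not_neutral_contains_not_neutral)
  then have i: "i < m" "2 * (1 + s) * \<bar>x i - 1/2\<bar> - 1 > 0" by auto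
  have "stretch m s x i = 0 \<or> stretch m s x i = 1"
  proof -
    define w where "w = (1 + s) * (x i - 1/2)"
    have "\<bar>w\<bar> = (1 + s) * \<bar>x i - 1/2\<bar>" using assms(2) by (simp add: w_def abs_mult)
    then have "w > 1/2 \<or> w < - 1/2" using i(2) by linarith
    then show ?thesis using i(1) by (auto simp: stretch_def w_def[symmetric] min_def max_def)
  qed
  then show ?thesis using i stretch_cube by (auto simp: cube_bd_def)
qed

text \<open>A coordinate equal to 0 or 1 contributes \<open>(1+s) - 1 = s\<close> on its own, so the
  truncation value is reached whatever the other coordinates are.\<close>

lemma excess_bd:
  assumes x: "x \<in> cube_bd m" and s: "0 \<le> s"
  shows "excess m s x = s" "stretch m s x \<in> cube_bd m"
proof -
  obtain i where i: "i < m" "x i = 0 \<or> x i = 1"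
    using x by (auto simp: cube_bd_def)
  have ab: "\<bar>x i - 1/2\<bar> = 1/2" using i by auto
  have "s \<le> max 0 (2 * (1 + s) * \<bar>x i - 1/2\<bar> - 1)" unfolding ab by (simp add: field_simps)
  also have "\<dots> \<le> (\<Sum>i<m. max 0 (2 * (1 + s) * \<bar>x i - 1/2\<bar> - 1))"
    using i by (intro member_le_sum) auto
  finally show "excess m s x = s" by (simp add: excess_def)
  have "stretch m s x i = 0 \<or> stretch m s x i = 1"
    using i s by (auto simp: stretch_def field_simps)
  then show "stretch m s x \<in> cube_bd m" using i stretch_cube by (auto simp: cube_bd_def)
qed

lemma continuous_on_excess:
  assumes "continuous_on S \<sigma>"
  shows "continuous_on (S \<times> T) (\<lambda>z. excess m (\<sigma> (fst z)) (snd z))"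
proof -
  have "continuous_on (S \<times> T) (\<lambda>z. \<sigma> (fst z))"
    by (rule continuous_on_compose2[OF assms]) (auto intro: continuous_on_fst continuous_on_id)
  then show ?thesis unfolding excess_def
    by (intro continuous_on_min continuous_on_sum continuous_on_max continuous_on_diff continuous_on_mult
        continuous_on_add continuous_on_const continuous_on_rabs continuous_on_snd_coord)
qed

lemma continuous_on_stretch:
  assumes "continuous_on S \<sigma>"
  shows "continuous_on (S \<times> T) (\<lambda>z. stretch m (\<sigma> (fst z)) (snd z))"
proof (rule continuous_on_coordinatewise_then_product)
  fix i
  have "continuous_on (S \<times> T) (\<lambda>z. \<sigma> (fst z))"
    by (rule continuous_on_compose2[OF assms]) (auto intro: continuous_on_fst continuous_on_id)
  then show "continuous_on (S \<times> T) (\<lambda>z. stretch m (\<sigma> (fst z)) (snd z) i)"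
    unfolding stretch_def
    by (cases "i < m") (simp_all, intro continuous_on_min continuous_on_max continuous_on_diff continuous_on_mult
        continuous_on_add continuous_on_const continuous_on_snd_coord)
qed

lemma closed_cube_bd: "closed (cube_bd m)"
proof -
  have "cube_bd m = cube m \<inter> (\<Union>i<m. {x. x i = 0} \<union> {x. x i = 1})"
    by (auto simp: cube_bd_def)
  moreover have "closed {x::nat\<Rightarrow>real. x i = c}" for i c
    by (intro closed_Collect_eq continuous_on_coord continuous_on_const)
  ultimately show ?thesis
    using compact_imp_closed[OF compact_cube] by (simp add: closed_Int closed_UN closed_Un)
qed

text \<open>The common shape of all transport homotopies: \<open>G\<close> on the inner cube and the
  path \<open>D (z, _)\<close>, followed by depth, in the collar. The parameter \<open>z\<close> is
  the homotopy time and \<open>\<sigma> z\<close> controls the width of the collar. Where both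
  formulas apply, the depth is 0 and the stretched point is on the boundary, so \<open>GD\<close>
  glues them.\<close>

lemma transport_continuous:
  fixes Z :: "'z::t2_space set"
  assumes G: "continuous_map (top_of_set (Z \<times> cube m)) N G"
    and D: "continuous_map (top_of_set (Z \<times> {0..1::real})) N D"
    and GD: "\<And>z y. z \<in> Z \<Longrightarrow> y \<in> cube_bd m \<Longrightarrow> G (z,y) = D (z,0)"
    and \<sigma>: "continuous_on Z \<sigma>" "\<And>z. z \<in> Z \<Longrightarrow> 0 \<le> \<sigma> z \<and> \<sigma> z \<le> 1"
  shows "continuous_map (top_of_set (Z \<times> cube m)) N
      (\<lambda>z. if excess m (\<sigma> (fst z)) (snd z) = 0 then G (fst z, stretch m (\<sigma> (fst z)) (snd z))
           else D (fst z, excess m (\<sigma> (fst z)) (snd z)))"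
    (is "continuous_map ?X N ?h")
proof -
  let ?e = "\<lambda>z. excess m (\<sigma> (fst z)) (snd z)" and ?y = "\<lambda>z. stretch m (\<sigma> (fst z)) (snd z)"
  let ?A = "{z \<in> Z \<times> cube m. ?e z = 0}" and ?B = "(Z \<times> cube m) \<inter> ?y -` cube_bd m"
  have ce: "continuous_on (Z \<times> cube m) ?e" and cy: "continuous_on (Z \<times> cube m) ?y"
    by (intro continuous_on_excess continuous_on_stretch \<sigma>)+
  have "closedin ?X ?A" by (rule continuous_closedin_preimage_constant[OF ce])
  moreover have "closedin ?X ?B" by (rule continuous_closedin_preimage[OF cy closed_cube_bd])
  moreover have "topspace ?X \<subseteq> ?A \<union> ?B" using excess_pos \<sigma>(2) by fastforce
  moreover have "continuous_map (subtopology ?X ?A) N (\<lambda>z. G (fst z, ?y z))"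
  proof -
    have "continuous_map (top_of_set ?A) N (\<lambda>z. G (fst z, ?y z))"
      by (rule continuous_map_compose_set[OF G])
         (auto simp: stretch_cube intro!: continuous_on_Pair continuous_on_fst continuous_on_id
           continuous_on_subset[OF cy])
    then show ?thesis by (simp add: subtopology_subtopology inf_absorb2)
  qed
  moreover have "continuous_map (subtopology ?X ?B) N (\<lambda>z. D (fst z, ?e z))"
  proof -
    have "continuous_map (top_of_set ?B) N (\<lambda>z. D (fst z, ?e z))"
    proof (rule continuous_map_compose_set[OF D])
      show "continuous_on ?B (\<lambda>z. (fst z, ?e z))"
        by (intro continuous_on_Pair continuous_on_fst continuous_on_id continuous_on_subset[OF ce]) auto
      fix z assume "z \<in> ?B"
      then show "(fst z, ?e z) \<in> Z \<times> {0..1}"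
        using \<sigma>(2)[of "fst z"] excess_bounds(1)[of "\<sigma> (fst z)" m "snd z"] excess_bounds(2)[of m "\<sigma> (fst z)" "snd z"] by auto
    qed
    then show ?thesis by (simp add: subtopology_subtopology inf_absorb2)
  qed
  ultimately show ?thesis
  proof (rule continuous_map_paste_closed)
    show "G (fst z, ?y z) = D (fst z, ?e z)" if "z \<in> ?A" "z \<in> ?B" for z
    proof -
      have "fst z \<in> Z" "?y z \<in> cube_bd m" "?e z = 0" using that by auto
      then show ?thesis using GD[of "fst z" "?y z"] by simp
    qed
    then show "?h z = D (fst z, ?e z)" if "z \<in> ?B" for z
      using that by simp
  qed simp
qed

text \<open>The usual action of paths on homotopy classes: the inner cube of side 1/2 carries
  \<open>f\<close>, and the collar runs along \<open>\<delta>\<close> outwards, so that the base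
  point moves from \<open>\<delta> 0\<close> to \<open>\<delta> 1\<close>.\<close>

definition transport :: "nat \<Rightarrow> ((nat \<Rightarrow> real) \<Rightarrow> 'a) \<Rightarrow> (real \<Rightarrow> 'a) \<Rightarrow> (nat \<Rightarrow> real) \<Rightarrow> 'a" where
  "transport m f \<delta> = (\<lambda>x\<in>cube m. if excess m 1 x = 0 then f (stretch m 1 x) else \<delta> (excess m 1 x))"

lemma transport_eq:
  "x \<in> cube m \<Longrightarrow> transport m f \<delta> x = (if excess m 1 x = 0 then f (stretch m 1 x) else \<delta> (excess m 1 x))"
  by (simp add: transport_def)

lemma continuous_map_snd_comp:
  assumes "continuous_map (top_of_set T) N f"
  shows "continuous_map (top_of_set (S \<times> T)) N (\<lambda>z. f (snd z))"
proof (rule continuous_map_compose_set[OF assms])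
  show "continuous_on (S \<times> T) snd" by (intro continuous_on_snd continuous_on_id)
qed auto

text \<open>The collar grows with time: at time \<open>t\<close> it uses only the part of
  \<open>\<delta>\<close> up to \<open>t\<close>. It is absent at time 0, and the boundary value is
  \<open>\<delta> t\<close> throughout.\<close>

lemma transport_track:
  assumes f: "f \<in> based_maps m N p" and d: "pathin N \<delta>" "\<delta> 0 = p"
  shows "\<exists>h. continuous_map (top_of_set ({0..1::real} \<times> cube m)) N h \<and>
        (\<forall>x\<in>cube m. h (0,x) = f x) \<and> (\<forall>x\<in>cube m. h (1,x) = transport m f \<delta> x) \<and>
        (\<forall>t\<in>{0..1}. \<forall>x\<in>cube_bd m. h (t,x) = \<delta> t)"
proof -
  let ?h = "\<lambda>z. if excess m (fst z) (snd z) = 0 then f (stretch m (fst z) (snd z))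
           else \<delta> (excess m (fst z) (snd z))"
  have "continuous_map (top_of_set ({0..1::real} \<times> cube m)) N ?h"
    by (rule transport_continuous[where \<sigma> = "\<lambda>s. s", unfolded snd_conv, OF
          continuous_map_snd_comp[OF based_maps_continuous[OF f]]
          continuous_map_snd_comp[OF d(1)[unfolded pathin_def]], unfolded snd_conv])
       (auto simp: based_maps_bd[OF f] d(2) continuous_on_id)
  moreover have "?h (t,x) = \<delta> t" if "t \<in> {0..1}" "x \<in> cube_bd m" for t x
    using that excess_bd[OF that(2), of t] based_maps_bd[OF f] d by auto
  moreover have "excess m 0 x = 0" for x using excess_bounds(1)[of 0 m x] excess_bounds(2)[of m 0 x] by simp
  ultimately show ?thesis
    by (intro exI[of _ ?h]) (auto simp: stretch_0 transport_eq)
qed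

lemma transport_based:
  assumes f: "f \<in> based_maps m N p" and d: "pathin N \<delta>" "\<delta> 0 = p"
  shows "transport m f \<delta> \<in> based_maps m N (\<delta> 1)"
proof -
  obtain h where h: "continuous_map (top_of_set ({0..1::real} \<times> cube m)) N h"
      "\<forall>x\<in>cube m. h (1,x) = transport m f \<delta> x" "\<forall>t\<in>{0..1}. \<forall>x\<in>cube_bd m. h (t,x) = \<delta> t"
    using transport_track[OF assms] by blast
  have "continuous_map (top_of_set (cube m)) N (\<lambda>x. h (1, x))"
    by (rule continuous_map_compose_set[OF h(1)]) (auto intro!: continuous_on_Pair continuous_on_const continuous_on_id)
  from based_mapsI[OF this, of "\<delta> 1"] h
  have "restrict (\<lambda>x. h (1, x)) (cube m) \<in> based_maps m N (\<delta> 1)" by auto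
  moreover have "restrict (\<lambda>x. h (1, x)) (cube m) = transport m f \<delta>"
    by (rule ext) (use h in \<open>auto simp: transport_def\<close>)
  ultimately show ?thesis by simp
qed

lemma transport_free_htpc:
  assumes "f \<in> based_maps m N p" "pathin N \<delta>" "\<delta> 0 = p"
  shows "free_htpc m N f (transport m f \<delta>)"
  using transport_track[OF assms] unfolding free_htpc_iff by blast

lemma transport_const:
  assumes f: "f \<in> based_maps m N p" and p: "p \<in> topspace N"
  shows "based_htpc m N p f (transport m f (\<lambda>_. p))"
proof -
  have "pathin N (\<lambda>_. p)" using p by (simp add: pathin_def)
  from transport_track[OF f this refl] show ?thesis unfolding based_htpc_iff by blast
qed

text \<open>Both transports share \<open>stretch\<close> and \<open>excess\<close>, so at each point
  either \<open>f\<close> and \<open>g\<close> are compared at one point of the cube or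
  \<open>\<delta>\<close> and \<open>\<epsilon>\<close> at one time.\<close>

lemma transport_disjoint:
  assumes "\<And>x. x \<in> cube m \<Longrightarrow> f x \<noteq> g x" "\<And>t. t \<in> {0..1} \<Longrightarrow> \<delta> t \<noteq> \<epsilon> t" "x \<in> cube m"
  shows "transport m f \<delta> x \<noteq> transport m g \<epsilon> x"
  using assms excess_bounds(1)[of 1 m x] excess_bounds(2)[of m 1 x] stretch_cube by (simp add: transport_eq)

text \<open>This is what permits replacing a track by one that avoids a given point without leaving
  the based class.\<close>

lemma transport_path_homotopy:
  assumes f: "f \<in> based_maps m N p"
    and K: "continuous_map (top_of_set ({0..1::real} \<times> {0..1::real})) N K"
      "\<And>t. t \<in> {0..1} \<Longrightarrow> K (t,0) = p" "\<And>t. t \<in> {0..1} \<Longrightarrow> K (t,1) = b"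
  shows "based_htpc m N b (transport m f (\<lambda>s. K (0,s))) (transport m f (\<lambda>s. K (1,s)))"
proof -
  let ?h = "\<lambda>z. if excess m 1 (snd z) = 0 then f (stretch m 1 (snd z)) else K (fst z, excess m 1 (snd z))"
  have "continuous_map (top_of_set ({0..1::real} \<times> cube m)) N ?h"
    by (rule transport_continuous[where \<sigma> = "\<lambda>s. 1", OF
          continuous_map_snd_comp[OF based_maps_continuous[OF f]] K(1), unfolded snd_conv])
       (auto simp: based_maps_bd[OF f] K(2))
  then show ?thesis unfolding based_htpc_iff
    by (intro exI[of _ ?h]) (auto simp: transport_eq excess_bd K)
qed

text \<open>At time \<open>t\<close> the inner cube carries \<open>H (t, _)\<close> and the collar
  follows the track backwards from \<open>\<gamma> t\<close> to \<open>\<gamma> 0 = b\<close>, so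
  the homotopy is based. At time 0 the collar is constant, which changes \<open>f\<close> only by a
  based homotopy.\<close>

lemma transport_back:
  assumes H: "continuous_map (top_of_set ({0..1::real} \<times> cube m)) N H"
    and f: "f \<in> based_maps m N b" "\<And>x. x \<in> cube m \<Longrightarrow> H (0,x) = f x"
    and bd: "\<And>t x. t \<in> {0..1} \<Longrightarrow> x \<in> cube_bd m \<Longrightarrow> H (t,x) = \<gamma> t"
    and \<gamma>: "pathin N \<gamma>" "\<gamma> 0 = b" and m: "m \<ge> 1" 
  shows "based_htpc m N b f (transport m (\<lambda>x. H (1,x)) (\<lambda>s. \<gamma> (1 - s)))"
proof -
  have bN: "b \<in> topspace N" using \<gamma> by (auto simp: pathin_def continuous_map_def)
  let ?D = "\<lambda>z::real \<times> real. \<gamma> (fst z * (1 - snd z))"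
  let ?h = "\<lambda>z. if excess m 1 (snd z) = 0 then H (fst z, stretch m 1 (snd z)) else ?D (fst z, excess m 1 (snd z))"
  have D: "continuous_map (top_of_set ({0..1} \<times> {0..1})) N ?D"
    by (rule continuous_map_compose_set[OF \<gamma>(1)[unfolded pathin_def]])
       (auto intro!: continuous_intros mult_nonneg_nonneg mult_le_one)
  have "continuous_map (top_of_set ({0..1::real} \<times> cube m)) N ?h"
    by (rule transport_continuous[where \<sigma> = "\<lambda>s. 1", OF H D]) (auto simp: bd)
  then have "based_htpc m N b (transport m f (\<lambda>_. b)) (transport m (\<lambda>x. H (1,x)) (\<lambda>s. \<gamma> (1 - s)))"
    unfolding based_htpc_iff
    by (intro exI[of _ ?h]) (auto simp: transport_eq excess_bd \<gamma> f stretch_cube)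
  with transport_const[OF f(1) bN] show ?thesis by (rule based_htpc_trans)
qed

text \<open>The track is read off at the origin, which is a boundary point because \<open>m\<close>
  is positive.\<close>

lemma free_htpc_track:
  assumes "free_htpc m N f g" and m: "m \<ge> 1"
  obtains H \<gamma> where "continuous_map (top_of_set ({0..1::real} \<times> cube m)) N H"
    "\<And>x. x \<in> cube m \<Longrightarrow> H (0,x) = f x" "\<And>x. x \<in> cube m \<Longrightarrow> H (1,x) = g x"
    "\<And>t x. t \<in> {0..1} \<Longrightarrow> x \<in> cube_bd m \<Longrightarrow> H (t,x) = \<gamma> t" "pathin N \<gamma>"
proof -
  obtain H where H: "continuous_map (top_of_set ({0..1::real} \<times> cube m)) N H"
    "\<forall>x \<in> cube m. H (0,x) = f x" "\<forall>x \<in> cube m. H (1,x) = g x"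
    "\<forall>t\<in>{0..1}. \<exists>c. \<forall>x\<in>cube_bd m. H (t,x) = c"
    using assms(1) unfolding free_htpc_iff by blast
  note z = zero_in_cube_bd[OF m]
  have "pathin N (\<lambda>t. H (t, \<lambda>_. 0))" unfolding pathin_def
    by (rule continuous_map_compose_set[OF H(1)])
       (use cube_bd_subset[OF z] in \<open>auto intro!: continuous_on_Pair continuous_on_const continuous_on_id\<close>)
  moreover have "H (t,x) = H (t, \<lambda>_. 0)" if "t \<in> {0..1}" "x \<in> cube_bd m" for t x
    using H(4) that z by metis
  ultimately show ?thesis using H(2,3) by (intro that[OF H(1)]) auto
qed

section \<open>Charts and general position\<close>

lemma manifold_chart:
  assumes "smooth_manifold N TYPE('n::finite)" "q \<in> topspace N"
  obtains U and \<phi> :: "'a \<Rightarrow> real^'n" where "openin N U" "q \<in> U" "open (\<phi> ` U)"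
    "homeomorphic_map (subtopology N U) (top_of_set (\<phi> ` U)) \<phi>"
proof -
  obtain A :: "('a set \<times> ('a \<Rightarrow> real^'n)) set" where A: "smooth_atlas N A"
    using assms(1) by (auto simp: smooth_manifold_def)
  then have "q \<in> \<Union>(fst ` A)" using assms(2) by (simp add: smooth_atlas_def)
  then obtain U \<phi> where "(U, \<phi>) \<in> A" "q \<in> U" by auto
  with A show ?thesis using that[of U \<phi>] unfolding smooth_atlas_def by blast
qed

text \<open>In a chart, the map is replaced near the preimage of \<open>q\<close> by a polynomial approximation,
  whose image is negligible and hence misses arbitrarily small translates of \<open>q\<close>.\<close>

lemma homotopy_avoiding_point:
  fixes \<phi> :: "'a \<Rightarrow> 'e::euclidean_space" and K :: "'e set"
  assumes haus: "Hausdorff_space N" and U: "openin N U" "q \<in> U" and oU: "open (\<phi> ` U)"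
    and hom: "homeomorphic_map (subtopology N U) (top_of_set (\<phi> ` U)) \<phi>"
    and K: "compact K" "negligible K" and f: "continuous_map (top_of_set K) N f"
    and A: "A \<subseteq> K" "compact A" and Aq: "\<And>x. x \<in> A \<Longrightarrow> f x \<noteq> q"
  shows "\<exists>h. continuous_map (top_of_set ({0..1::real} \<times> K)) N h \<and> (\<forall>x\<in>K. h (0,x) = f x) \<and>
      (\<forall>x\<in>K. h (1,x) \<noteq> q) \<and> (\<forall>t\<in>{0..1}. \<forall>x\<in>A. h (t,x) = f x)"
proof -
  obtain \<psi> where maps: "homeomorphic_maps (subtopology N U) (top_of_set (\<phi> ` U)) \<phi> \<psi>"
    using hom by (auto simp: homeomorphic_map_maps)
  have UN: "U \<subseteq> topspace N" using U openin_subset by blast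
  have \<psi>\<phi>: "\<psi> (\<phi> x) = x" if "x \<in> U" for x
    using maps that UN by (auto simp: homeomorphic_maps_def)
  have c\<phi>: "continuous_map (subtopology N U) euclidean \<phi>"
    using maps by (auto simp: homeomorphic_maps_def continuous_map_in_subtopology)
  have c\<psi>: "continuous_map (top_of_set (\<phi> ` U)) N \<psi>"
    using maps by (auto simp: homeomorphic_maps_def continuous_map_in_subtopology)
  have "compactin N (f ` A)"
    by (rule image_compactin[OF _ f]) (use A in \<open>auto simp: compactin_subtopology\<close>)
  then have clA: "closedin N (f ` A)" using haus by (rule compactin_imp_closedin[rotated])
  have openim: "open (\<phi> ` W)" if "openin N W" "W \<subseteq> U" for W
  proof -
    have "openin (subtopology N U) W" using that by (metis openin_subtopology_Int2 inf.absorb_iff2 U(1) openin_open_subtopology)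
    then have "openin (top_of_set (\<phi> ` U)) (\<phi> ` W)"
      using hom homeomorphic_imp_open_map open_map_def by blast
    then show ?thesis using oU openin_open_eq by blast
  qed
  have "open (\<phi> ` (U - f ` A))" using clA U by (intro openim openin_diff) auto
  moreover have "\<phi> q \<in> \<phi> ` (U - f ` A)" using U Aq by auto
  ultimately obtain r where r: "r > 0" "cball (\<phi> q) r \<subseteq> \<phi> ` (U - f ` A)"
    using open_contains_cball by blast
  define c where "c = \<phi> q"
  define B where "B = \<psi> ` cball c r"
  define B0 where "B0 = {x \<in> U. \<phi> x \<in> ball c r}"
  have cb: "cball c r \<subseteq> \<phi> ` U" using r by (auto simp: c_def)
  have BU: "B \<subseteq> U - f ` A" using r \<psi>\<phi> by (auto simp: B_def c_def)
  have inB: "x \<in> B \<longleftrightarrow> x \<in> U \<and> dist c (\<phi> x) \<le> r" for x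
    using BU cb \<psi>\<phi> by (force simp: B_def)
  have "compactin N B" unfolding B_def
    by (rule image_compactin[OF _ c\<psi>]) (use cb in \<open>auto simp: compactin_subtopology\<close>)
  then have clB: "closedin N B" using haus by (rule compactin_imp_closedin[rotated])
  have "openin (subtopology N U) {x \<in> topspace (subtopology N U). \<phi> x \<in> ball c r}"
    by (rule openin_continuous_map_preimage[OF c\<phi>]) auto
  moreover have "{x \<in> topspace (subtopology N U). \<phi> x \<in> ball c r} = B0" using UN by (auto simp: B0_def)
  ultimately have opB0: "openin N B0" using U by (simp add: openin_open_subtopology)
  \<comment> \<open>\<open>K2\<close> is the part that gets moved and \<open>K1\<close> the part
    that stays; both are closed, and their overlap is mapped to the sphere of radius
    \<open>r\<close> in the chart.\<close>
  define K2 where "K2 = {x \<in> K. f x \<in> B}"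
  define K1 where "K1 = {x \<in> K. f x \<notin> B0}"
  have "closedin (top_of_set K) {x \<in> topspace (top_of_set K). f x \<in> B}"
    by (rule closedin_continuous_map_preimage[OF f clB])
  then have clK2: "closedin (top_of_set K) K2" by (simp add: K2_def)
  have "closedin (top_of_set K) {x \<in> topspace (top_of_set K). f x \<in> topspace N - B0}"
    by (rule closedin_continuous_map_preimage[OF f]) (use opB0 in auto)
  moreover have "f x \<in> topspace N" if "x \<in> K" for x using f that by (auto simp: continuous_map_def)
  then have "{x \<in> topspace (top_of_set K). f x \<in> topspace N - B0} = K1" by (auto simp: K1_def)
  ultimately have clK1: "closedin (top_of_set K) K1" by simp
  have coK2: "compact K2" using clK2 K closedin_compact by blast
  have "continuous_map (top_of_set K2) (subtopology N U) f"
    using f BU by (auto simp: K2_def continuous_map_in_subtopology intro: continuous_map_from_subtopology_mono)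
  from continuous_map_compose[OF this c\<phi>] have g: "continuous_on K2 (\<lambda>x. \<phi> (f x))" by (simp add: o_def)
  \<comment> \<open>The error \<open>r/4\<close> and a translation by less than \<open>r/4\<close>
    add up to a displacement below \<open>r/2\<close>, which is the width of the zone in which the
    cut-off \<open>l\<close> fades.\<close>
  obtain P where P: "polynomial_function P" "\<And>x. x \<in> K2 \<Longrightarrow> norm (\<phi> (f x) - P x) < r/4"
    using Stone_Weierstrass_polynomial_function[OF coK2 g, of "r/4"] r by auto
  have "negligible ((\<lambda>x. P x - c) ` K2)"
  proof (rule negligible_differentiable_image_negligible)
    show "negligible K2" by (rule negligible_subset[OF K(2)]) (auto simp: K2_def)
    show "(\<lambda>x. P x - c) differentiable_on K2"
      using P(1) by (intro differentiable_on_diff differentiable_on_polynomial_function) auto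
  qed simp
  then have "\<not> ball 0 (r/4) \<subseteq> (\<lambda>x. P x - c) ` K2"
    using r negligible_subset open_not_negligible[of "ball (0::'e) (r/4)"] by auto
  then obtain w where w: "norm w < r/4" "\<And>x. x \<in> K2 \<Longrightarrow> P x - c \<noteq> w" by (auto simp: subset_iff)
  \<comment> \<open>Where \<open>l = 1\<close> the motion ends at \<open>P x - w\<close> in the
    chart, never at \<open>c\<close>. The cut-off is 1 up to distance \<open>r/2\<close> from
    \<open>c\<close> and 0 at distance \<open>r\<close>, so \<open>k\<close> agrees with
    \<open>f\<close> on the overlap and never leaves the closed ball.\<close>
  define D where "D x = P x - w - \<phi> (f x)" for x
  define l where "l x = max 0 (min 1 (2 - 2 * dist c (\<phi> (f x)) / r))" for x
  define k where "k z = \<psi> (\<phi> (f (snd z)) + (fst z * l (snd z)) *\<^sub>R D (snd z))" for z :: "real \<times> 'e"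
  have nD: "norm (D x) < r/2" if "x \<in> K2" for x
  proof -
    have "norm (D x) \<le> norm (P x - \<phi> (f x)) + norm w"
      unfolding D_def using norm_triangle_ineq4[of "P x - \<phi> (f x)" w] by (simp add: algebra_simps)
    then show ?thesis using P(2)[OF that] w(1) by (simp add: norm_minus_commute)
  qed
  have l01: "0 \<le> l x" "l x \<le> 1" for x by (auto simp: l_def)
  have stay: "\<phi> (f x) + (t * l x) *\<^sub>R D x \<in> cball c r" if "x \<in> K2" "t \<in> {0..1}" for x t
  proof -
    let ?\<rho> = "dist c (\<phi> (f x))"
    have \<rho>: "?\<rho> \<le> r" using that inB by (auto simp: K2_def)
    have "dist c (\<phi> (f x) + (t * l x) *\<^sub>R D x) \<le> ?\<rho> + norm ((t * l x) *\<^sub>R D x)"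
      by (metis add.commute dist_norm dist_triangle2 add_diff_cancel_left' dist_commute)
    also have "norm ((t * l x) *\<^sub>R D x) = t * (l x * norm (D x))"
      using that l01[of x] by (simp add: abs_mult)
    also have "\<dots> \<le> 1 * (l x * norm (D x))"
      using that l01[of x] by (intro mult_right_mono) auto
    also have "\<dots> \<le> l x * (r/2)" unfolding mult_1 using nD[OF that(1)] l01[of x] by (intro mult_left_mono) auto
    also have "?\<rho> + \<dots> \<le> r"
    proof (cases "?\<rho> \<le> r/2")
      case True
      have "l x * (r/2) \<le> 1 * (r/2)" using l01[of x] r by (intro mult_right_mono) auto
      then show ?thesis using True by simp
    next
      case False
      then have "2 * ?\<rho> / r \<ge> 1" "2 * ?\<rho> / r \<le> 2" using r \<rho> by (auto simp: field_simps)
      then have "l x = 2 - 2 * ?\<rho> / r" by (simp add: l_def)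
      then show ?thesis using r by (simp add: field_simps)
    qed
    finally show ?thesis by simp
  qed
  have ck: "continuous_map (top_of_set ({0..1} \<times> K2)) N k" unfolding k_def
  proof (rule continuous_map_compose_set[OF c\<psi>])
    have s: "continuous_on ({0..1::real} \<times> K2) (\<lambda>z. F (snd z))" if "continuous_on K2 F" for F :: "'e \<Rightarrow> 'z::topological_space"
      by (rule continuous_on_compose2[OF that continuous_on_snd[OF continuous_on_id]]) auto
    have "continuous_on K2 l" unfolding l_def using r
      by (intro continuous_on_max continuous_on_min continuous_on_diff continuous_on_divide continuous_on_mult
          continuous_on_const continuous_on_dist g) auto
    moreover have "continuous_on K2 D" unfolding D_def
      by (intro continuous_on_diff g continuous_on_const continuous_on_polymonial_function P)
    ultimately show "continuous_on ({0..1} \<times> K2) (\<lambda>z. \<phi> (f (snd z)) + (fst z * l (snd z)) *\<^sub>R D (snd z))"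
      by (intro continuous_on_add continuous_on_scaleR continuous_on_mult continuous_on_fst continuous_on_id s g)
    show "\<phi> (f (snd z)) + (fst z * l (snd z)) *\<^sub>R D (snd z) \<in> \<phi> ` U" if "z \<in> {0..1} \<times> K2" for z
      using stay[of "snd z" "fst z"] that cb by auto
  qed
  define h where "h z = (if snd z \<in> K2 then k z else f (snd z))" for z :: "real \<times> 'e"
  have edge: "k z = f (snd z)" if "snd z \<in> K2" "snd z \<in> K1" for z
  proof -
    have "dist c (\<phi> (f (snd z))) = r" "f (snd z) \<in> U" using that inB[of "f (snd z)"] by (auto simp: K2_def K1_def B0_def)
    then have "l (snd z) = 0" using r by (simp add: l_def)
    then show ?thesis using \<psi>\<phi> \<open>f (snd z) \<in> U\<close> by (simp add: k_def)
  qed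
  have "continuous_map (top_of_set ({0..1} \<times> K)) N h"
  proof (rule continuous_map_paste_closed[where A = "{0..1} \<times> K2" and B = "{0..1} \<times> K1" and f = k and g = "\<lambda>z. f (snd z)"])
    show "closedin (top_of_set ({0..1} \<times> K)) ({0..1} \<times> K2)" "closedin (top_of_set ({0..1} \<times> K)) ({0..1} \<times> K1)"
      using clK1 clK2 by (auto intro!: closedin_Times)
    have sub: "K2 \<subseteq> K" "K1 \<subseteq> K" by (auto simp: K1_def K2_def)
    then show "continuous_map (subtopology (top_of_set ({0..1} \<times> K)) ({0..1} \<times> K2)) N k"
      using ck by (simp add: subtopology_subtopology Times_Int_Times inf_absorb2)
    have "continuous_map (top_of_set ({0..1::real} \<times> K1)) N (\<lambda>z. f (snd z))"
      using continuous_map_snd_comp[OF continuous_map_from_subtopology_mono[OF f sub(2)]] .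
    then show "continuous_map (subtopology (top_of_set ({0..1::real} \<times> K)) ({0..1} \<times> K1)) N (\<lambda>z. f (snd z))"
      using sub by (simp add: subtopology_subtopology Times_Int_Times inf_absorb2)
    show "topspace (top_of_set ({0..1} \<times> K)) \<subseteq> {0..1} \<times> K2 \<union> {0..1} \<times> K1"
      by (auto simp: K1_def K2_def B0_def inB)
  qed (auto simp: edge h_def)
  moreover have "h (0,x) = f x" if "x \<in> K" for x
    using \<psi>\<phi> inB by (auto simp: h_def k_def K2_def)
  moreover have "h (1,x) \<noteq> q" if x: "x \<in> K" for x
  proof (cases "x \<in> K2")
    case False
    then have "f x \<notin> B" using x by (simp add: K2_def)
    then show ?thesis using inB[of q] U r False by (auto simp: h_def c_def)
  next
    case True
    show ?thesis
    proof
      let ?y = "\<phi> (f x) + l x *\<^sub>R D x"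
      assume "h (1,x) = q"
      then have "\<psi> ?y = q" using True by (simp add: h_def k_def)
      moreover have "?y \<in> \<phi> ` U" using stay[OF True, of 1] cb by auto
      ultimately have y: "?y = c" using \<psi>\<phi> by (auto simp: c_def)
      \<comment> \<open>A point that ends at the centre was displaced by its whole distance from
        \<open>c\<close>. That distance is therefore below \<open>r/2\<close>, where
        \<open>l = 1\<close>, and this contradicts the choice of \<open>w\<close>.\<close>
      then have n: "dist c (\<phi> (f x)) = l x * norm (D x)"
        using l01[of x] by (metis abs_of_nonneg add_diff_cancel_left' dist_norm norm_scaleR)
      also have "\<dots> \<le> 1 * norm (D x)" using l01[of x] by (intro mult_right_mono) auto
      finally have "dist c (\<phi> (f x)) < r/2" using nD[OF True] by simp
      then have "2 * dist c (\<phi> (f x)) / r < 1" using r by (simp add: field_simps)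
      then have "l x = 1" by (simp add: l_def)
      then have "P x - c = w" using y by (simp add: D_def algebra_simps)
      then show False using w(2)[OF True] by simp
    qed
  qed
  moreover have "h (t,x) = f x" if "x \<in> A" for t x
    using that BU by (auto simp: h_def K2_def)
  ultimately show ?thesis by (intro exI[of _ h]) auto
qed


text \<open>General position needs a negligible domain in the model space. Here \<open>e\<close>
  places \<open>T\<close> in the hyperplane where coordinate \<open>l\<close> vanishes, and its
  inverse \<open>b\<close> carries \<open>f\<close> over to the image.\<close>

lemma homotopy_avoiding_point_embedded:
  fixes e :: "'b::t2_space \<Rightarrow> real^'n"
  assumes N: "smooth_manifold N TYPE('n::finite)" and q: "q \<in> topspace N"
    and T: "compact T" "A \<subseteq> T" "closed A" and e: "continuous_on T e" and b: "continuous_on (e ` T) b"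
      "\<And>x. x \<in> T \<Longrightarrow> b (e x) = x" and flat: "\<And>x. x \<in> T \<Longrightarrow> e x $ l = 0"
    and f: "continuous_map (top_of_set T) N f" and Aq: "\<And>x. x \<in> A \<Longrightarrow> f x \<noteq> q"
  shows "\<exists>h. continuous_map (top_of_set ({0..1::real} \<times> T)) N h \<and> (\<forall>x\<in>T. h (0,x) = f x) \<and>
      (\<forall>x\<in>T. h (1,x) \<noteq> q) \<and> (\<forall>t\<in>{0..1}. \<forall>x\<in>A. h (t,x) = f x)"
proof -
  obtain U and \<phi> :: "'a \<Rightarrow> real^'n" where U: "openin N U" "q \<in> U" "open (\<phi> ` U)"
    "homeomorphic_map (subtopology N U) (top_of_set (\<phi> ` U)) \<phi>"
    using manifold_chart[OF N q] by metis
  have haus: "Hausdorff_space N" using N by (simp add: smooth_manifold_def)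
  have "negligible {x::real^'n. x \<bullet> axis l 1 = 0}"
    by (rule negligible_standard_hyperplane) (simp add: axis_in_Basis_iff)
  then have neg: "negligible (e ` T)"
    by (rule negligible_subset) (auto simp: inner_axis flat)
  have fb: "continuous_map (top_of_set (e ` T)) N (\<lambda>x. f (b x))"
    by (rule continuous_map_compose_set[OF f b(1)]) (auto simp: b(2))
  have "compact A" using compact_Int_closed[OF T(1,3)] T(2) by (simp add: inf_absorb2)
  then have cA: "compact (e ` A)" using compact_continuous_image[OF continuous_on_subset[OF e T(2)]] by simp
  have ne: "f (b x) \<noteq> q" if "x \<in> e ` A" for x
    using that Aq b(2)[OF subsetD[OF T(2)]] by force
  obtain h where h: "continuous_map (top_of_set ({0..1::real} \<times> e ` T)) N h" "\<forall>x\<in>e ` T. h (0,x) = f (b x)"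
      "\<forall>x\<in>e ` T. h (1,x) \<noteq> q" "\<forall>t\<in>{0..1}. \<forall>x\<in>e ` A. h (t,x) = f (b x)"
    using homotopy_avoiding_point[OF haus U compact_continuous_image[OF e T(1)] neg fb image_mono[OF T(2)] cA ne]
    by blast
  have "continuous_map (top_of_set ({0..1::real} \<times> T)) N (\<lambda>z. h (fst z, e (snd z)))"
  proof (rule continuous_map_compose_set[OF h(1)])
    show "continuous_on ({0..1::real} \<times> T) (\<lambda>z. (fst z, e (snd z)))"
      by (intro continuous_on_Pair continuous_on_fst continuous_on_id
          continuous_on_compose2[OF e continuous_on_snd[OF continuous_on_id]]) auto
  qed auto
  then show ?thesis
    using h(2-4) b(2) T(2) by (intro exI[of _ "\<lambda>z. h (fst z, e (snd z))"]) (auto simp: subset_iff)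
qed

text \<open>With two coordinates available the interval fits on axis \<open>i\<close>, where
  coordinate \<open>l\<close> vanishes. Keeping the map fixed on \<open>{0,1}\<close> fixes the ends
  of the path.\<close>

lemma path_avoiding_point:
  assumes N: "smooth_manifold N TYPE('n::finite)" and n: "CARD('n) \<ge> 2" and q: "q \<in> topspace N"
    and g: "pathin N \<gamma>" "\<gamma> 0 \<noteq> q" "\<gamma> 1 \<noteq> q"
  obtains K where "continuous_map (top_of_set ({0..1::real} \<times> {0..1::real})) N K"
    "\<And>t. t \<in> {0..1} \<Longrightarrow> K (0,t) = \<gamma> t" "\<And>t. t \<in> {0..1} \<Longrightarrow> K (1,t) \<noteq> q"
    "\<And>t. t \<in> {0..1} \<Longrightarrow> K (t,0) = \<gamma> 0" "\<And>t. t \<in> {0..1} \<Longrightarrow> K (t,1) = \<gamma> 1"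
proof -
  obtain i l :: 'n where il: "i \<noteq> l"
    using n card_le_Suc0_iff_eq[of "UNIV :: 'n set"] by fastforce
  have "\<exists>h. continuous_map (top_of_set ({0..1::real} \<times> {0..1::real})) N h \<and> (\<forall>x\<in>{0..1}. h (0,x) = \<gamma> x) \<and>
      (\<forall>x\<in>{0..1}. h (1,x) \<noteq> q) \<and> (\<forall>t\<in>{0..1}. \<forall>x\<in>{0,1}. h (t,x) = \<gamma> x)"
  proof (rule homotopy_avoiding_point_embedded[OF N q, where e = "\<lambda>t. t *\<^sub>R axis i 1" and b = "\<lambda>v. v $ i" and l = l])
    show "continuous_map (top_of_set {0..1}) N \<gamma>" using g by (simp add: pathin_def)
    show "(t *\<^sub>R axis i 1 :: real^'n) $ l = 0" for t using il by (simp add: axis_def)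
    show "(t *\<^sub>R axis i 1 :: real^'n) $ i = t" for t by simp
    show "closed {0, 1::real}" by (simp add: finite_imp_closed)
  qed (use g in \<open>auto intro!: continuous_intros\<close>)
  then show ?thesis using that by auto
qed

lemma based_htpc_avoiding_point:
  assumes N: "smooth_manifold N TYPE('n::finite)" and n: "m < CARD('n)" and q: "q \<in> topspace N"
    and f: "f \<in> based_maps m N b" and b: "b \<noteq> q"
  obtains g where "g \<in> based_maps m N b" "based_htpc m N b f g" "\<And>x. x \<in> cube m \<Longrightarrow> g x \<noteq> q"
proof -
  \<comment> \<open>The coordinates in \<open>J\<close> hold the cube, and a further coordinate
    \<open>l\<close> is left over to vanish; \<open>\<tau>\<close> and \<open>\<rho>\<close>
    translate between cube indices and \<open>J\<close>.\<close>
  obtain J :: "'n set" where J: "card J = m" using n by (metis obtain_subset_with_card_n less_imp_le)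
  obtain \<tau> where \<tau>: "bij_betw \<tau> {..<m} J"
    using J by (metis bij_betw_iff_card card_lessThan finite finite_lessThan)
  define \<rho> where "\<rho> = inv_into {..<m} \<tau>"
  have \<rho>: "\<rho> (\<tau> i) = i" if "i < m" for i
    using \<tau> that by (simp add: \<rho>_def bij_betw_inv_into_left)
  have "J \<noteq> UNIV" using J n by auto
  then obtain l where l: "l \<notin> J" by auto
  let ?e = "\<lambda>x. \<chi> j. if j \<in> J then x (\<rho> j) else 0" and ?b = "\<lambda>v. \<lambda>i. if i < m then v $ \<tau> i else 0"
  have "\<exists>h. continuous_map (top_of_set ({0..1::real} \<times> cube m)) N h \<and> (\<forall>x\<in>cube m. h (0,x) = f x) \<and>
      (\<forall>x\<in>cube m. h (1,x) \<noteq> q) \<and> (\<forall>t\<in>{0..1}. \<forall>x\<in>cube_bd m. h (t,x) = f x)"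
  proof (rule homotopy_avoiding_point_embedded[OF N q, where e = ?e and b = ?b and l = l])
    have "continuous_on (cube m) (\<lambda>x. if j \<in> J then x (\<rho> j) else 0)" for j
      by (cases "j \<in> J") (auto intro: continuous_on_coord)
    then show "continuous_on (cube m) ?e" by (rule continuous_on_vec_lambda)
    show "continuous_on (?e ` cube m) ?b"
    proof (rule continuous_on_coordinatewise_then_product)
      fix i show "continuous_on (?e ` cube m) (\<lambda>v. if i < m then v $ \<tau> i else 0)"
        by (cases "i < m") (auto intro!: continuous_intros)
    qed
    show "?b (?e x) = x" if "x \<in> cube m" for x
    proof
      fix i
      have "i < m \<Longrightarrow> \<tau> i \<in> J" using \<tau> by (auto simp: bij_betw_def)
      then show "?b (?e x) i = x i" using that \<rho> by (auto simp: cube_def)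
    qed
    show "f x \<noteq> q" if "x \<in> cube_bd m" for x using based_maps_bd[OF f that] b by simp
  qed (use f l in \<open>auto simp: compact_cube closed_cube_bd cube_bd_subset based_maps_def\<close>)
  then obtain h where h: "continuous_map (top_of_set ({0..1::real} \<times> cube m)) N h" "\<forall>x\<in>cube m. h (0,x) = f x"
      "\<forall>x\<in>cube m. h (1,x) \<noteq> q" "\<forall>t\<in>{0..1}. \<forall>x\<in>cube_bd m. h (t,x) = f x" by blast
  have "continuous_map (top_of_set (cube m)) N (\<lambda>x. h (1, x))"
    by (rule continuous_map_compose_set[OF h(1)]) (auto intro!: continuous_on_Pair continuous_on_const continuous_on_id)
  from based_mapsI[OF this, of b] h(4) based_maps_bd[OF f]
  have "restrict (\<lambda>x. h (1, x)) (cube m) \<in> based_maps m N b" by auto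
  moreover have "based_htpc m N b f (restrict (\<lambda>x. h (1, x)) (cube m))"
    unfolding based_htpc_iff using h based_maps_bd[OF f] by (intro exI[of _ h]) auto
  ultimately show ?thesis by (rule that) (use h(3) in auto)
qed

section \<open>Path connectedness of connected manifolds\<close>

lemma locally_path_connected_space_euclidean:
  "locally_path_connected_space (euclidean :: 'e::real_normed_vector topology)"
  unfolding locally_path_connected_space_def neighbourhood_base_of
proof (intro allI impI)
  fix W and x :: 'e assume "openin euclidean W \<and> x \<in> W"
  then obtain e where "e > 0" "ball x e \<subseteq> W" by (metis open_contains_ball open_openin)
  then show "\<exists>U V. openin euclidean U \<and> path_connectedin euclidean V \<and> x \<in> U \<and> U \<subseteq> V \<and> V \<subseteq> W"
    by (intro exI[of _ "ball x e"]) (auto simp: convex_imp_path_connected)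
qed

lemma manifold_path_connected:
  assumes N: "smooth_manifold N TYPE('n::finite)" and "connected_space N"
  shows "path_connected_space N"
proof -
  have "neighbourhood_base_of (path_connectedin N) N"
    unfolding neighbourhood_base_of
  proof (intro allI impI)
    fix W x assume Wx: "openin N W \<and> x \<in> W"
    then have xN: "x \<in> topspace N" using openin_subset by blast
    obtain U and \<phi> :: "'a \<Rightarrow> real^'n" where U: "openin N U" "x \<in> U" "open (\<phi> ` U)"
      "homeomorphic_map (subtopology N U) (top_of_set (\<phi> ` U)) \<phi>"
      using manifold_chart[OF N xN] by metis
    have "locally_path_connected_space (top_of_set (\<phi> ` U))"
      by (rule locally_path_connected_space_open_subset[OF locally_path_connected_space_euclidean])
        (use U(3) in simp)
    then have "locally_path_connected_space (subtopology N U)"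
      using homeomorphic_locally_path_connected_space[OF homeomorphic_map_imp_homeomorphic_space[OF U(4)]] by simp
    then have nb: "neighbourhood_base_of (path_connectedin (subtopology N U)) (subtopology N U)"
      by (simp add: locally_path_connected_space_def)
    have "openin (subtopology N U) (W \<inter> U) \<and> x \<in> W \<inter> U" using Wx U(2) by (simp add: openin_subtopology_Int)
    then obtain V V' where V: "openin (subtopology N U) V" "path_connectedin (subtopology N U) V'" "x \<in> V" "V \<subseteq> V'" "V' \<subseteq> W \<inter> U"
      using nb[unfolded neighbourhood_base_of, rule_format, of "W \<inter> U" x] by metis
    have "openin N V" using V(1) U(1) by (simp add: openin_open_subtopology)
    moreover have "path_connectedin N V'" using V(2) by (simp add: path_connectedin_subtopology)
    ultimately show "\<exists>V V'. openin N V \<and> path_connectedin N V' \<and> x \<in> V \<and> V \<subseteq> V' \<and> V' \<subseteq> W"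
      using V(3-5) by (intro exI[of _ V] exI[of _ V']) auto
  qed
  then have "locally_path_connected_space N" by (simp add: locally_path_connected_space_def)
  then show ?thesis using assms(2) by (simp add: path_connected_eq_connected_space)
qed

section \<open>One-dimensional manifolds\<close>

text \<open>A chart onto the whole real line. The inverse \<open>u'\<close> is carried along because
  the arguments below follow the curve \<open>u'\<close> and describe subsets of \<open>N\<close> as
  its images of intervals.\<close>

definition line_chart :: "'a topology \<Rightarrow> 'a set \<Rightarrow> ('a \<Rightarrow> real) \<Rightarrow> (real \<Rightarrow> 'a) \<Rightarrow> bool" where
  "line_chart N U u u' \<longleftrightarrow> openin N U \<and> continuous_map (subtopology N U) euclideanreal u \<and>
     continuous_map euclideanreal N u' \<and> (\<forall>s. u' s \<in> U \<and> u (u' s) = s) \<and> (\<forall>x\<in>U. u' (u x) = x)"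

lemma line_chartD:
  assumes "line_chart N U u u'"
  shows "openin N U" "continuous_map (subtopology N U) euclideanreal u" "continuous_map euclideanreal N u'"
    "u' s \<in> U" "u (u' s) = s" "x \<in> U \<Longrightarrow> u' (u x) = x"
  using assms by (auto simp: line_chart_def)

text \<open>Reflection exchanges left and right, and so reduces the case distinctions below to one
  orientation.\<close>

lemma line_chart_uminus:
  assumes "line_chart N U u u'"
  shows "line_chart N U (\<lambda>x. - u x) (\<lambda>s. u' (- s))"
proof -
  have "continuous_map euclideanreal N (u' \<circ> uminus)"
    by (rule continuous_map_compose[OF _ line_chartD(3)[OF assms]]) (auto intro!: continuous_intros)
  then show ?thesis using assms
    by (auto simp: line_chart_def o_def intro: continuous_map_minus)
qed

lemma line_chart_inj:
  assumes "line_chart N U u u'" "u' s = u' t" shows "s = t"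
  using line_chartD(5)[OF assms(1)] assms(2) by metis

lemma line_chart_open:
  assumes "line_chart N U u u'" "open S"
  shows "openin N (u' ` S)"
proof -
  have "openin (subtopology N U) {x \<in> topspace (subtopology N U). u x \<in> S}"
    by (rule openin_continuous_map_preimage[OF line_chartD(2)[OF assms(1)]]) (use assms in simp)
  moreover have "{x \<in> topspace (subtopology N U). u x \<in> S} = u' ` S"
    using line_chartD[OF assms(1)] openin_subset[of N U] by (auto simp: image_iff) metis
  ultimately show ?thesis using line_chartD(1)[OF assms(1)] by (simp add: openin_open_subtopology)
qed

lemma line_chart_compact:
  assumes "line_chart N U u u'" "compact S"
  shows "compactin N (u' ` S)"
  by (rule image_compactin[OF _ line_chartD(3)[OF assms(1)]]) (use assms in simp)

lemma line_chart_connectedin: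
  assumes "line_chart N U u u'" "connected S"
  shows "connectedin N (u' ` S)"
  by (rule connectedin_continuous_map_image[OF line_chartD(3)[OF assms(1)]]) (use assms in simp)

lemma line_chart_range: "line_chart N U u u' \<Longrightarrow> U = range u'"
  using line_chartD(4,6) by (metis (no_types, lifting) image_subsetI rangeI subsetI subset_antisym)

lemma line_chart_preimage_open:
  assumes "line_chart N U u u'" "openin N V"
  shows "open {s. u' s \<in> V}"
  using openin_continuous_map_preimage[OF line_chartD(3)[OF assms(1)] assms(2)] by simp

lemma line_chart_preimage_closed:
  assumes "line_chart N U u u'" "closedin N K"
  shows "closed {s. u' s \<in> K}"
  using closedin_continuous_map_preimage[OF line_chartD(3)[OF assms(1)] assms(2)] by simp

text \<open>Since \<open>T - {r}\<close> is still connected, the interval \<open>T\<close> has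
  \<open>r\<close> as an end point; being closed but not compact, it must be unbounded on the other
  side.\<close>

lemma real_half_line:
  fixes T :: "real set"
  assumes con: "connected T" "connected (T - {r})" and cl: "closed T" and nc: "\<not> compact T" and r: "r \<in> T"
  shows "T = {r..} \<or> T = {..r}"
proof -
  have int: "x \<in> T" if "a \<in> T" "b \<in> T" "a \<le> x" "x \<le> b" for a b x
    using con(1) that by (meson connected_iff_interval)
  have int': "x \<in> T - {r}" if "a \<in> T - {r}" "b \<in> T - {r}" "a \<le> x" "x \<le> b" for a b x
    using con(2) that by (meson connected_iff_interval)
  consider "T \<subseteq> {r..}" | "T \<subseteq> {..r}"
  proof (cases "T \<subseteq> {r..}")
    case False
    then obtain a where a: "a \<in> T" "a < r" by (meson atLeast_iff not_le subsetI)
    have "T \<subseteq> {..r}"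
    proof (rule ccontr)
      assume "\<not> T \<subseteq> {..r}"
      then obtain b where "b \<in> T" "r < b" by (meson atMost_iff not_le subsetI)
      then have "r \<in> T - {r}" using int'[of a b r] a by auto
      then show False by simp
    qed
    then show ?thesis using that by blast
  qed (use that in blast)
  then show ?thesis
  proof cases
    case 1
    have "{r..} \<subseteq> T"
    proof
      fix x assume x: "x \<in> {r..}"
      show "x \<in> T"
      proof (rule ccontr)
        assume xT: "x \<notin> T"
        have "T \<subseteq> {r..x}"
        proof
          fix y assume y: "y \<in> T"
          then show "y \<in> {r..x}" using 1 int[OF r y, of x] x xT by (cases "y \<le> x") auto
        qed
        then show False using nc cl by (meson bounded_closed_interval bounded_subset compact_eq_bounded_closed)
      qed
    qed
    with 1 show ?thesis by blast
  next
    case 2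
    have "{..r} \<subseteq> T"
    proof
      fix x assume x: "x \<in> {..r}"
      show "x \<in> T"
      proof (rule ccontr)
        assume xT: "x \<notin> T"
        have "T \<subseteq> {x..r}"
        proof
          fix y assume y: "y \<in> T"
          then show "y \<in> {x..r}" using 2 int[OF y r, of x] x xT by (cases "x \<le> y") auto
        qed
        then show False using nc cl by (meson bounded_closed_interval bounded_subset compact_eq_bounded_closed)
      qed
    qed
    with 2 show ?thesis by blast
  qed
qed

text \<open>A chart line that leaves \<open>V\<close> must run to infinity in the coordinate of \<open>V\<close>,
  since otherwise the exit point would lie in the closed set \<open>V \<inter> u' ` {s..\<alpha>}\<close>.\<close>

lemma line_chart_exit:
  assumes haus: "Hausdorff_space N" and U: "line_chart N U u u'" and V: "line_chart N V v v'"
    and s: "s < \<alpha>" "\<And>t. t \<in> {s..<\<alpha>} \<Longrightarrow> u' t \<in> V" and \<alpha>: "u' \<alpha> \<notin> V"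
  shows "v' ` {v (u' s)..} = u' ` {s..<\<alpha>} \<or> v' ` {..v (u' s)} = u' ` {s..<\<alpha>}"
proof -
  let ?\<tau> = "\<lambda>t. v (u' t)" let ?T = "?\<tau> ` {s..<\<alpha>}" and ?r = "v (u' s)"
  have inv: "v' (?\<tau> t) = u' t" if "t \<in> {s..<\<alpha>}" for t using line_chartD(6)[OF V s(2)[OF that]] .
  have inj: "t = t'" if "t \<in> {s..<\<alpha>}" "t' \<in> {s..<\<alpha>}" "?\<tau> t = ?\<tau> t'" for t t'
    using inv[OF that(1)] inv[OF that(2)] that(3) line_chart_inj[OF U] by metis
  have cu: "continuous_map (top_of_set {s..<\<alpha>}) (subtopology N V) u'"
    using line_chartD(3)[OF U] s(2) by (auto simp: continuous_map_in_subtopology continuous_map_from_subtopology)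
  have c\<tau>: "continuous_on {s..<\<alpha>} ?\<tau>"
    using continuous_map_compose[OF cu line_chartD(2)[OF V]] by (simp add: o_def)
  have imT: "v' ` ?T = u' ` {s..<\<alpha>}" unfolding image_image using inv by (rule image_cong[OF refl])
  have "connected ?T" by (rule connected_continuous_image[OF c\<tau>]) auto
  moreover have "connected (?T - {?r})"
  proof -
    have "?T - {?r} = ?\<tau> ` {s<..<\<alpha>}"
    proof (intro equalityI subsetI)
      fix y assume "y \<in> ?T - {?r}"
      then obtain t where t: "t \<in> {s..<\<alpha>}" "y = ?\<tau> t" by auto
      moreover have "t \<noteq> s" using \<open>y \<in> ?T - {?r}\<close> t by auto
      ultimately show "y \<in> ?\<tau> ` {s<..<\<alpha>}" by auto
    next
      fix y assume "y \<in> ?\<tau> ` {s<..<\<alpha>}"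
      then obtain t where t: "t \<in> {s<..<\<alpha>}" "y = ?\<tau> t" by auto
      then have "?\<tau> t \<noteq> ?r" using inj[of t s] by auto
      then show "y \<in> ?T - {?r}" using t by auto
    qed
    moreover have "connected (?\<tau> ` {s<..<\<alpha>})"
      by (rule connected_continuous_image[OF continuous_on_subset[OF c\<tau>]]) auto
    ultimately show ?thesis by simp
  qed
  moreover have "closed ?T"
  proof -
    have "closedin N (u' ` {s..\<alpha>})"
      using compactin_imp_closedin[OF haus line_chart_compact[OF U]] by simp
    then have "closed {r. v' r \<in> u' ` {s..\<alpha>}}" by (rule line_chart_preimage_closed[OF V])
    \<comment> \<open>Adding the end point \<open>\<alpha>\<close> changes nothing, because
      \<open>u' \<alpha>\<close> is outside \<open>V\<close>; so \<open>?T\<close> is the preimage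
      of a closed set.\<close>
    moreover have "{r. v' r \<in> u' ` {s..\<alpha>}} = ?T"
    proof (intro equalityI subsetI)
      fix r assume "r \<in> {r. v' r \<in> u' ` {s..\<alpha>}}"
      then obtain t where t: "t \<in> {s..\<alpha>}" "v' r = u' t" by auto
      then have "t \<noteq> \<alpha>" using \<alpha> line_chartD(4)[OF V, of r] by auto
      then have "t \<in> {s..<\<alpha>}" using t by auto
      moreover have "r = ?\<tau> t" using line_chartD(5)[OF V, of r] t by simp
      ultimately show "r \<in> ?T" by blast
    next
      fix r assume "r \<in> ?T"
      then obtain t where "t \<in> {s..<\<alpha>}" "r = ?\<tau> t" by auto
      then show "r \<in> {r. v' r \<in> u' ` {s..\<alpha>}}" using inv by auto
    qed
    ultimately show ?thesis by simp
  qed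
  moreover have "\<not> compact ?T"
  proof
    assume "compact ?T"
    then have "closedin N (u' ` {s..<\<alpha>})"
      using compactin_imp_closedin[OF haus line_chart_compact[OF V]] imT by metis
    then have "closed {t. u' t \<in> u' ` {s..<\<alpha>}}" by (rule line_chart_preimage_closed[OF U])
    moreover have "{t. u' t \<in> u' ` {s..<\<alpha>}} = {s..<\<alpha>}" using line_chart_inj[OF U] by auto
    ultimately have "closure {s..<\<alpha>} = {s..<\<alpha>}" by (simp add: closure_closed)
    then show False using s(1) by (simp add: closure_atLeastLessThan) (metis atLeastAtMost_iff atLeastLessThan_iff less_irrefl order_refl less_imp_le)
  qed
  ultimately have "?T = {?r..} \<or> ?T = {..?r}" using s(1) by (intro real_half_line) auto
  then show ?thesis using imT by metis
qed

lemma first_exit: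
  fixes S :: "real set"
  assumes "open S" "s \<in> S" "\<beta> > s" "\<beta> \<notin> S"
  obtains \<alpha> where "s < \<alpha>" "\<alpha> \<le> \<beta>" "\<alpha> \<notin> S" "\<And>t. t \<in> {s..<\<alpha>} \<Longrightarrow> t \<in> S"
proof -
  let ?C = "{s..} - S"
  have C: "closed ?C" "?C \<noteq> {}" "bdd_below ?C" using assms by (auto intro: closed_Diff less_imp_le)
  have "Inf ?C \<in> ?C" by (rule closed_contains_Inf[OF C(2,3,1)])
  moreover have "Inf ?C \<le> \<beta>" using C(3) assms by (intro cInf_lower) auto
  moreover have "t \<in> S" if "t \<in> {s..<Inf ?C}" for t
  proof (rule ccontr)
    assume "t \<notin> S"
    then have "Inf ?C \<le> t" using C(3) that by (intro cInf_lower) auto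
    then show False using that by simp
  qed
  ultimately show ?thesis using assms(2) by (intro that[of "Inf ?C"]) (auto simp: less_le)
qed

lemma line_chart_exit_right:
  assumes haus: "Hausdorff_space N" and U: "line_chart N U u u'" and V: "line_chart N V v v'"
    and s: "u' s \<in> V" "s < \<beta>" "u' \<beta> \<notin> V"
  obtains \<alpha> where "s < \<alpha>" "\<alpha> \<le> \<beta>" "u' \<alpha> \<notin> V"
    "v' ` {v (u' s)..} = u' ` {s..<\<alpha>} \<or> v' ` {..v (u' s)} = u' ` {s..<\<alpha>}"
proof -
  obtain \<alpha> where "s < \<alpha>" "\<alpha> \<le> \<beta>" "\<alpha> \<notin> {s. u' s \<in> V}" "\<And>t. t \<in> {s..<\<alpha>} \<Longrightarrow> t \<in> {s. u' s \<in> V}"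
    using first_exit[OF line_chart_preimage_open[OF U line_chartD(1)[OF V]], of s \<beta>] s by auto
  then show ?thesis using line_chart_exit[OF haus U V, of s \<alpha>] that by simp
qed

lemma line_chart_exit_left:
  assumes haus: "Hausdorff_space N" and U: "line_chart N U u u'" and V: "line_chart N V v v'"
    and s: "u' s \<in> V" "\<beta> < s" "u' \<beta> \<notin> V"
  obtains \<alpha> where "\<alpha> < s" "\<beta> \<le> \<alpha>" "u' \<alpha> \<notin> V"
    "v' ` {v (u' s)..} = u' ` {\<alpha><..s} \<or> v' ` {..v (u' s)} = u' ` {\<alpha><..s}"
proof -
  obtain \<alpha> where a: "- s < \<alpha>" "\<alpha> \<le> - \<beta>" "u' (- \<alpha>) \<notin> V"
    "v' ` {v (u' s)..} = (\<lambda>t. u' (- t)) ` {- s..<\<alpha>} \<or> v' ` {..v (u' s)} = (\<lambda>t. u' (- t)) ` {- s..<\<alpha>}"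
    using line_chart_exit_right[OF haus line_chart_uminus[OF U] V, of "- s" "- \<beta>"] s by auto
  have "(\<lambda>t. u' (- t)) ` {- s..<\<alpha>} = u' ` uminus ` {- s..<\<alpha>}" by (simp only: image_image)
  also have "\<dots> = u' ` {- \<alpha><..s}" by simp
  finally show ?thesis using that[of "- \<alpha>"] a by auto
qed

text \<open>The pieces of \<open>U\<close> on the two sides of \<open>s\<close>, up to the exits
  from \<open>V\<close>, are both rays of \<open>V\<close> starting at the same point. They are
  different sets, hence opposite rays, and together they exhaust \<open>V\<close>.\<close>

lemma line_chart_exit_both:
  assumes haus: "Hausdorff_space N" and U: "line_chart N U u u'" and V: "line_chart N V v v'"
    and s: "u' s \<in> V" "\<beta> < s" "u' \<beta> \<notin> V" "s < \<beta>'" "u' \<beta>' \<notin> V"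
  shows "V \<subseteq> U"
proof -
  let ?r = "v (u' s)"
  obtain \<alpha> where a: "\<alpha> < s" "v' ` {?r..} = u' ` {\<alpha><..s} \<or> v' ` {..?r} = u' ` {\<alpha><..s}"
    using line_chart_exit_left[OF haus U V s(1-3)] by metis
  obtain \<alpha>' where a': "s < \<alpha>'" "v' ` {?r..} = u' ` {s..<\<alpha>'} \<or> v' ` {..?r} = u' ` {s..<\<alpha>'}"
    using line_chart_exit_right[OF haus U V s(1,4,5)] by metis
  have ne: "u' ` {\<alpha><..s} \<noteq> u' ` {s..<\<alpha>'}"
  proof
    assume "u' ` {\<alpha><..s} = u' ` {s..<\<alpha>'}"
    moreover have "u' ((\<alpha> + s) / 2) \<in> u' ` {\<alpha><..s}" using a by (intro imageI) auto
    ultimately obtain t where "t \<in> {s..<\<alpha>'}" "u' ((\<alpha> + s) / 2) = u' t" by auto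
    then show False using line_chart_inj[OF U] a by fastforce
  qed
  have "V = v' ` ({?r..} \<union> {..?r})" using line_chart_range[OF V] by (metis UNIV_I Un_iff atLeast_iff atMost_iff linear subsetI subset_antisym top_greatest)
  then have "V = u' ` {\<alpha><..s} \<union> u' ` {s..<\<alpha>'}" using a(2) a'(2) ne by (auto simp: image_Un)
  then show ?thesis using line_chartD(4)[OF U] by auto
qed


text \<open>To the right of \<open>s\<close> the curve \<open>u'\<close> cannot leave
  \<open>V\<close>, or \<open>V\<close> would lie in \<open>U\<close>; to the left of the exit it
  cannot return, as the overlap is connected. So the union consists of the left half
  \<open>u \<le> s\<close> of \<open>U\<close> and the right half of \<open>V\<close>, joined at
  \<open>u' s\<close>, and shifted copies of \<open>u\<close> and \<open>v\<close> form its
  coordinate.\<close>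

lemma line_chart_union_aux:
  assumes haus: "Hausdorff_space N" and U: "line_chart N U u u'" and V: "line_chart N V v v'"
    and con: "connectedin N (U \<inter> V)" and nsub: "\<not> V \<subseteq> U"
    and s: "u' s \<in> V" "\<alpha> < s" "u' \<alpha> \<notin> V" and ray: "v' ` {..v (u' s)} = u' ` {\<alpha><..s}"
  shows "\<exists>w w'. line_chart N (U \<union> V) w w'"
proof -
  let ?r = "v (u' s)" and ?X = "subtopology N (U \<union> V)"
  note UD = line_chartD[OF U] and VD = line_chartD[OF V]
  have NU: "U \<subseteq> topspace N" "V \<subseteq> topspace N" using UD(1) VD(1) openin_subset by blast+
  have right: "u' t \<in> V" if "s \<le> t" for t
    using line_chart_exit_both[OF haus U V s(1-3), of t] nsub that s(1) by (cases "t = s") auto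
  have "continuous_map (subtopology N (U \<inter> V)) euclideanreal u"
    using continuous_map_from_subtopology_mono[OF UD(2)] by simp
  then have "connected (u ` (U \<inter> V))"
    using connectedin_continuous_map_image[of "subtopology N (U \<inter> V)" euclideanreal u "U \<inter> V"] con
    by (simp add: connectedin_subtopology)
  then have above: "\<alpha> < t" if "u' t \<in> V" for t
  proof (rule_tac ccontr)
    assume c: "connected (u ` (U \<inter> V))" and "\<not> \<alpha> < t"
    moreover have "t \<in> u ` (U \<inter> V)" "s \<in> u ` (U \<inter> V)"
      using UD(4,5) that s(1) by (metis Int_iff image_eqI)+
    ultimately have "\<alpha> \<in> u ` (U \<inter> V)" using s(2) by (meson connected_iff_interval less_imp_le not_less)
    then show False using UD(6) s(3) by auto
  qed
  have low: "v x \<le> ?r" if "x \<in> U" "x \<in> V" "u x \<le> s" for x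
  proof -
    have "x = u' (u x)" "\<alpha> < u x" using UD(6) above[of "u x"] that by auto
    then have "x \<in> v' ` {..?r}" using ray that by auto
    then show ?thesis using VD(5) by auto
  qed
  have low': "x \<in> U \<and> u x \<le> s \<and> (u x = s \<longrightarrow> v x = ?r)" if "x \<in> V" "v x \<le> ?r" for x
  proof -
    have "x \<in> v' ` {..?r}" using VD(6)[OF that(1)] that(2) by (metis atMost_iff image_eqI)
    then obtain t where "t \<in> {\<alpha><..s}" "x = u' t" using ray by auto
    then show ?thesis using UD(4,5) by auto
  qed
  have high: "x \<in> V \<and> ?r < v x" if "x \<in> U" "s < u x" for x
    using right[of "u x"] UD(6)[OF that(1)] low'[of x] that by force
  have z: "v' ?r = u' s" using VD(6) s(1) by simp
  have only_z: "x = u' s" if "x \<in> V" "v x = ?r" for x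
    using VD(6)[OF that(1)] z unfolding that(2) by (rule trans[OF sym])
  define w where "w x = (if x \<in> U \<and> u x \<le> s then u x - s else v x - ?r)" for x
  define w' where "w' t = (if t \<le> 0 then u' (t + s) else v' (t + ?r))" for t
  let ?A = "{x \<in> U. u x \<le> s}" and ?B = "{x \<in> V. ?r \<le> v x}"
  have O1: "openin N (u' ` {..<s})" and O2: "openin N (v' ` {?r<..})"
    by (auto intro: line_chart_open[OF U] line_chart_open[OF V])
  have mO1: "x \<in> u' ` {..<s} \<longleftrightarrow> x \<in> U \<and> u x < s" for x
    using UD(4-6) by (metis (no_types, lifting) image_iff lessThan_iff)
  have mO2: "x \<in> v' ` {?r<..} \<longleftrightarrow> x \<in> V \<and> ?r < v x" for x
    using VD(4-6) by (metis (no_types, lifting) image_iff greaterThan_iff)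
  \<comment> \<open>The two halves are written as complements of open rays in order to see that they
    are closed in the union.\<close>
  have eqA: "(U \<union> V) - v' ` {?r<..} = ?A"
  proof (intro equalityI subsetI)
    fix x assume x: "x \<in> (U \<union> V) - v' ` {?r<..}"
    then have 1: "x \<in> V \<Longrightarrow> v x \<le> ?r" by (auto simp: mO2)
    show "x \<in> ?A" using high[of x] low'[of x] x 1 by force
  next
    fix x assume "x \<in> ?A"
    then have "x \<in> U" "x \<in> V \<Longrightarrow> \<not> ?r < v x" using low[of x] by auto
    then show "x \<in> (U \<union> V) - v' ` {?r<..}" unfolding Diff_iff mO2 by blast
  qed
  have eqB: "(U \<union> V) - u' ` {..<s} = ?B"
  proof (intro equalityI subsetI)
    fix x assume x: "x \<in> (U \<union> V) - u' ` {..<s}"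
    then have 1: "x \<in> U \<Longrightarrow> s \<le> u x" by (auto simp: mO1)
    show "x \<in> ?B"
    proof (cases "x \<in> U \<and> u x = s")
      case True
      then have "x = u' s" using UD(6) by metis
      then show ?thesis using s by simp
    next
      case False
      then show ?thesis using high[of x] low'[of x] x 1 by force
    qed
  next
    fix x assume x: "x \<in> ?B"
    have False if "x \<in> U" "u x < s"
    proof -
      have "v x = ?r" using low[of x] that x by auto
      then have "x = u' s" using only_z x by blast
      then show False using UD(5) that by simp
    qed
    then show "x \<in> (U \<union> V) - u' ` {..<s}" using x by (auto simp: mO1)
  qed
  have cw: "continuous_map ?X euclideanreal w"
  proof (rule continuous_map_paste_closed[where A = ?A and B = ?B and f = "\<lambda>x. u x - s" and g = "\<lambda>x. v x - ?r"])
    have topX: "topspace ?X = U \<union> V" using NU by auto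
    have "openin ?X ((U \<union> V) \<inter> v' ` {?r<..})" "openin ?X ((U \<union> V) \<inter> u' ` {..<s})"
      using O1 O2 by (auto simp: openin_subtopology_Int2)
    then have "closedin ?X (topspace ?X - (U \<union> V) \<inter> v' ` {?r<..})" "closedin ?X (topspace ?X - (U \<union> V) \<inter> u' ` {..<s})"
      by blast+
    moreover have "X - X \<inter> Y = X - Y" for X Y :: "'a set" by blast
    ultimately show "closedin ?X ?A" "closedin ?X ?B" by (simp_all only: topX eqA eqB)
    have "v' ` {?r<..} \<subseteq> ?B"
    proof
      fix x assume "x \<in> v' ` {?r<..}"
      then have "x \<in> V \<and> ?r < v x" by (simp only: mO2)
      then show "x \<in> ?B" by simp
    qed
    then show "topspace ?X \<subseteq> ?A \<union> ?B" unfolding topX eqA[symmetric] by blast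
    have "continuous_map (subtopology N ?A) euclideanreal u" "continuous_map (subtopology N ?B) euclideanreal v"
      using continuous_map_from_subtopology_mono[OF UD(2)] continuous_map_from_subtopology_mono[OF VD(2)] by auto
    moreover have "(U \<union> V) \<inter> ?A = ?A" "(U \<union> V) \<inter> ?B = ?B" by blast+
    ultimately show "continuous_map (subtopology ?X ?A) euclideanreal (\<lambda>x. u x - s)"
        "continuous_map (subtopology ?X ?B) euclideanreal (\<lambda>x. v x - ?r)"
      unfolding subtopology_subtopology by (auto intro!: continuous_map_diff)
    show ab: "u x - s = v x - ?r" if "x \<in> ?A" "x \<in> ?B" for x
    proof -
      have "v x = ?r" using low[of x] that by auto
      moreover then have "x = u' s" using only_z that by blast
      ultimately show ?thesis using UD(5) by simp
    qed
    show "w x = u x - s" if "x \<in> ?A" for x using that by (simp add: w_def)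
    then show "w x = v x - ?r" if "x \<in> ?B" for x using that ab[of x] by (auto simp: w_def)
  qed
  have cw': "continuous_map euclideanreal N w'"
  proof (rule continuous_map_paste_closed[where A = "{..0}" and B = "{0..}" and f = "\<lambda>t. u' (t + s)" and g = "\<lambda>t. v' (t + ?r)"])
    have "continuous_map (top_of_set A) N (\<lambda>t. u' (t + s))" "continuous_map (top_of_set A) N (\<lambda>t. v' (t + ?r))" for A
      by (rule continuous_map_compose_set[of UNIV]; use UD(3) VD(3) in \<open>auto intro!: continuous_intros\<close>)+
    then show "continuous_map (top_of_set {..0}) N (\<lambda>t. u' (t + s))" "continuous_map (top_of_set {0..}) N (\<lambda>t. v' (t + ?r))"
      by auto
  qed (auto simp: w'_def z dest: antisym)
  have "line_chart N (U \<union> V) w w'" unfolding line_chart_def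
  proof (intro conjI allI ballI cw cw')
    show "openin N (U \<union> V)" using UD(1) VD(1) by blast
    fix t
    show "w' t \<in> U \<union> V" using UD(4) VD(4) by (simp add: w'_def)
    show "w (w' t) = t"
    proof (cases "t \<le> 0")
      case True then show ?thesis using UD(4,5) by (simp add: w_def w'_def)
    next
      case False
      then have "\<not> (v' (t + ?r) \<in> U \<and> u (v' (t + ?r)) \<le> s)"
        using low[of "v' (t + ?r)"] VD(4,5) by auto
      then show ?thesis using False VD(5) by (simp add: w_def w'_def)
    qed
  next
    fix x assume x: "x \<in> U \<union> V"
    show "w' (w x) = x"
    proof (cases "x \<in> U \<and> u x \<le> s")
      case True then show ?thesis using UD(6) by (simp add: w_def w'_def)
    next
      case False
      then have "x \<in> V" "?r < v x" using x high[of x] low'[of x] by force+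
      then show ?thesis using False VD(6)[of x] by (auto simp: w_def w'_def)
    qed
  qed
  then show ?thesis by blast
qed

text \<open>If neither chart contains the other, \<open>U\<close> has a point outside
  \<open>V\<close>. Reflecting \<open>u\<close> puts the exit to the left, and reflecting
  \<open>v\<close> makes the ray that is cut off the lower one.\<close>

lemma line_chart_union:
  assumes haus: "Hausdorff_space N" and U: "line_chart N U u u'" and V: "line_chart N V v v'"
    and con: "connectedin N (U \<inter> V)" and ne: "U \<inter> V \<noteq> {}"
  shows "\<exists>w w'. line_chart N (U \<union> V) w w'"
proof (cases "U \<subseteq> V \<or> V \<subseteq> U")
  case True
  then have "U \<union> V = U \<or> U \<union> V = V" by blast
  then show ?thesis using U V by metis
next
  case False
  obtain z where z: "z \<in> U" "z \<in> V" using ne by blast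
  obtain y where y: "y \<in> U" "y \<notin> V" using False by blast
  have main: ?thesis if U: "line_chart N U u u'" and lt: "u y < u z" for u u'
  proof -
    note UD = line_chartD[OF U]
    obtain \<alpha> where a: "\<alpha> < u z" "u' \<alpha> \<notin> V" "v' ` {v (u' (u z))..} = u' ` {\<alpha><..u z} \<or> v' ` {..v (u' (u z))} = u' ` {\<alpha><..u z}"
      using line_chart_exit_left[OF haus U V, of "u z" "u y"] lt z y UD(6) by metis
    show ?thesis
    proof (cases "v' ` {..v (u' (u z))} = u' ` {\<alpha><..u z}")
      case True
      then show ?thesis using line_chart_union_aux[OF haus U V con, of "u z" \<alpha>] False a z UD(6) by simp
    next
      case False
      then have "v' ` uminus ` {..- v (u' (u z))} = u' ` {\<alpha><..u z}" using a(3) by simp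
      then have "(\<lambda>r. v' (- r)) ` {..- v (u' (u z))} = u' ` {\<alpha><..u z}" by (simp only: image_image)
      then show ?thesis
        using line_chart_union_aux[OF haus U line_chart_uminus[OF V] con, of "u z" \<alpha>] \<open>\<not> (U \<subseteq> V \<or> V \<subseteq> U)\<close> a z UD(6) by simp
    qed
  qed
  have "u y \<noteq> u z" using line_chartD(6)[OF U] y z by metis
  then consider "u y < u z" | "- u y < - u z" by linarith
  then show ?thesis using main[OF U] main[OF line_chart_uminus[OF U]] by cases auto
qed

text \<open>The line charts around \<open>b\<close> have an open union. A chart around a point
  outside meets none of them, since it could be merged otherwise; hence the union is also closed and
  is all of \<open>N\<close>. As all of them contain \<open>b\<close>, finitely many merge into one,
  and compactness of \<open>K\<close> finishes.\<close>

lemma compact_in_line_chart: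
  assumes haus: "Hausdorff_space N" and con: "connected_space N"
    and charts: "\<And>x. x \<in> topspace N \<Longrightarrow> \<exists>U u u'. line_chart N U u u' \<and> x \<in> U"
    and all: "\<And>U u u' V v v'. line_chart N U u u' \<Longrightarrow> line_chart N V v v' \<Longrightarrow> U \<inter> V \<noteq> {} \<Longrightarrow> connectedin N (U \<inter> V)"
    and K: "compactin N K" and b: "b \<in> topspace N"
  shows "\<exists>U u u'. line_chart N U u u' \<and> K \<subseteq> U"
proof -
  define C where "C = {U. b \<in> U \<and> (\<exists>u u'. line_chart N U u u')}"
  have un: "U \<union> V \<in> C" if UV: "U \<in> C" "\<exists>v v'. line_chart N V v v'" "U \<inter> V \<noteq> {}" for U V
  proof -
    obtain u u' v v' where "line_chart N U u u'" "line_chart N V v v'" using UV(1,2) by (auto simp: C_def)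
    then show ?thesis using line_chart_union[OF haus _ _ all UV(3)] UV(1,3) by (auto simp: C_def)
  qed
  have opC: "openin N U" if U: "U \<in> C" for U using U by (auto simp: C_def dest: line_chartD(1))
  have bC: "\<exists>U. U \<in> C" using charts[OF b] by (auto simp: C_def)
  have "\<Union>C = topspace N"
  proof -
    have o: "openin N (\<Union>C)" using opC by (rule openin_Union)
    moreover have "\<exists>T. openin N T \<and> x \<in> T \<and> T \<subseteq> topspace N - \<Union>C" if x: "x \<in> topspace N - \<Union>C" for x
    proof -
      obtain V v v' where V: "line_chart N V v v'" "x \<in> V" using charts[of x] x by auto
      have "V \<inter> U = {}" if U: "U \<in> C" for U
      proof (rule ccontr)
        assume "V \<inter> U \<noteq> {}"
        then have "U \<inter> V \<noteq> {}" by (simp add: Int_commute)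
        moreover have "\<exists>v v'. line_chart N V v v'" using V(1) by (intro exI)
        ultimately have "U \<union> V \<in> C" by (intro un[OF U])
        then have "x \<in> \<Union>C" using V(2) by (intro UnionI[of "U \<union> V"]) auto
        then show False using x by simp
      qed
      then have "V \<inter> \<Union>C = {}" by blast
      then have "V \<subseteq> topspace N - \<Union>C" using openin_subset[OF line_chartD(1)[OF V(1)]] by blast
      then show ?thesis using V(2) line_chartD(1)[OF V(1)] by (intro exI[of _ V]) simp
    qed
    then have "openin N (topspace N - \<Union>C)" by (subst openin_subopen) simp
    ultimately have "closedin N (\<Union>C)" using openin_subset[OF o] by (simp add: closedin_def)
    moreover have "\<Union>C \<noteq> {}" using bC by (auto simp: C_def)
    ultimately show ?thesis using con o unfolding connected_space_clopen_in by metis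
  qed
  moreover have "K \<subseteq> topspace N" by (rule compactin_subset_topspace[OF K])
  ultimately obtain F where F: "finite F" "F \<subseteq> C" "K \<subseteq> \<Union>F"
    using K opC unfolding compactin_def by metis
  from F(1,2) have "\<exists>U\<in>C. \<Union>F \<subseteq> U"
  proof (induction F)
    case empty
    then show ?case using bC by auto
  next
    case (insert W F)
    then obtain U where U: "U \<in> C" "\<Union>F \<subseteq> U" by auto
    have "W \<in> C" using insert.prems by simp
    then have "U \<union> W \<in> C" using U(1) by (intro un) (auto simp: C_def)
    then show ?case using U(2) by (intro bexI[of _ "U \<union> W"]) auto
  qed
  then obtain U where "U \<in> C" "K \<subseteq> U" using F(3) by auto
  then show ?thesis by (auto simp: C_def)
qed

lemma manifold_line_chart:
  assumes N: "smooth_manifold N TYPE('n::finite)" and n: "CARD('n) = 1" and x: "q \<in> topspace N"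
  shows "\<exists>U u u'. line_chart N U u u' \<and> q \<in> U"
proof -
  obtain U and \<phi> :: "'a \<Rightarrow> real^'n" where U: "openin N U" "q \<in> U" "open (\<phi> ` U)"
    "homeomorphic_map (subtopology N U) (top_of_set (\<phi> ` U)) \<phi>"
    using manifold_chart[OF N x] by metis
  obtain \<psi> where maps: "homeomorphic_maps (subtopology N U) (top_of_set (\<phi> ` U)) \<phi> \<psi>"
    using U(4) by (auto simp: homeomorphic_map_maps)
  have UN: "U \<subseteq> topspace N" using U openin_subset by blast
  have \<psi>\<phi>: "\<psi> (\<phi> x) = x" if "x \<in> U" for x
    using maps that UN by (auto simp: homeomorphic_maps_def)
  have c\<phi>: "continuous_map (subtopology N U) euclidean \<phi>"
    using maps by (auto simp: homeomorphic_maps_def continuous_map_in_subtopology)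
  have c\<psi>: "continuous_map (top_of_set (\<phi> ` U)) N \<psi>"
    using maps by (auto simp: homeomorphic_maps_def continuous_map_in_subtopology)
  obtain k :: 'n where k: "UNIV = {k}" using n by (metis card_1_singletonE)
  have dist1: "dist y y' = \<bar>y $ k - y' $ k\<bar>" for y y' :: "real^'n"
    by (simp add: dist_vec_def L2_set_def k dist_real_def)
  have ext: "y = y'" if "y $ k = y' $ k" for y y' :: "real^'n"
    using k that by (metis UNIV_I singletonD vec_eq_iff)
  obtain r where r: "r > 0" "ball (\<phi> q) r \<subseteq> \<phi> ` U"
    using U(2,3) open_contains_ball by blast
  define c where "c = \<phi> q $ k"
  define W where "W = {x \<in> U. \<phi> x \<in> ball (\<phi> q) r}"
  define a where "a x = (\<phi> x $ k - c) / r" for x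
  \<comment> \<open>The chart ball is one-dimensional, hence an interval, with coordinate
    \<open>a\<close> running through (-1,1); \<open>a / (1 - |a|)\<close> stretches it onto the
    whole line and \<open>s / (1 + |s|)\<close> is the inverse.\<close>
  define u where "u x = a x / (1 - \<bar>a x\<bar>)" for x
  define p where "p s = (\<chi> i::'n. c + r * (s / (1 + \<bar>s\<bar>)))" for s :: real
  have aW: "\<bar>a x\<bar> < 1" if "x \<in> W" for x
    using that r by (simp add: W_def a_def dist1 c_def field_simps abs_minus_commute)
  have pk: "p s $ k = c + r * (s / (1 + \<bar>s\<bar>))" for s by (simp add: p_def)
  have pb: "p s \<in> ball (\<phi> q) r" for s
  proof -
    have "\<bar>s / (1 + \<bar>s\<bar>)\<bar> < 1" by (simp add: abs_divide)
    then have "r * \<bar>s / (1 + \<bar>s\<bar>)\<bar> < r * 1" using r(1) by (intro mult_strict_left_mono)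
    then have "\<bar>r * (s / (1 + \<bar>s\<bar>))\<bar> < r" using r(1) by (simp only: abs_mult mult_1_right)
    then show ?thesis by (simp add: dist1 pk c_def)
  qed
  have \<phi>\<psi>p: "\<phi> (\<psi> (p s)) = p s" "\<psi> (p s) \<in> U" for s
    using pb[of s] r(2) \<psi>\<phi> by auto
  have ap: "a (\<psi> (p s)) = s / (1 + \<bar>s\<bar>)" for s using r by (simp add: a_def \<phi>\<psi>p pk)
  have "line_chart N W u (\<lambda>s. \<psi> (p s))" unfolding line_chart_def
  proof (intro conjI allI ballI)
    have "openin (subtopology N U) {x \<in> topspace (subtopology N U). \<phi> x \<in> ball (\<phi> q) r}"
      by (rule openin_continuous_map_preimage[OF c\<phi>]) auto
    moreover have "{x \<in> topspace (subtopology N U). \<phi> x \<in> ball (\<phi> q) r} = W" using UN by (auto simp: W_def)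
    ultimately show "openin N W" using U by (simp add: openin_open_subtopology)
    have cW: "continuous_map (subtopology N W) euclidean \<phi>"
      by (rule continuous_map_from_subtopology_mono[OF c\<phi>]) (auto simp: W_def)
    moreover have "continuous_map euclidean euclideanreal (\<lambda>y::real^'n. (y $ k - c) / r)"
      using r by (auto intro!: continuous_intros)
    ultimately have ca: "continuous_map (subtopology N W) euclideanreal a"
      using continuous_map_compose[of "subtopology N W" euclidean \<phi> euclideanreal "\<lambda>y::real^'n. (y $ k - c) / r"]
      by (simp add: o_def a_def[abs_def])
    then have "continuous_map (subtopology N W) (top_of_set {-1<..<1}) a"
      using aW by (fastforce simp: continuous_map_in_subtopology abs_less_iff)
    moreover have "continuous_map (top_of_set {-1<..<1}) euclideanreal (\<lambda>y::real. y / (1 - \<bar>y\<bar>))"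
      by (auto intro!: continuous_intros)
    ultimately show "continuous_map (subtopology N W) euclideanreal u"
      using continuous_map_compose[of "subtopology N W" "top_of_set {-1<..<1}" a euclideanreal "\<lambda>y::real. y / (1 - \<bar>y\<bar>)"]
      by (simp add: o_def u_def[abs_def])
    have "continuous_on UNIV p" unfolding p_def
      by (intro continuous_on_vec_lambda continuous_intros) auto
    then show "continuous_map euclideanreal N (\<lambda>s. \<psi> (p s))"
      using continuous_map_compose_set[OF c\<psi>, of UNIV p] subsetD[OF r(2) pb] by simp
  next
    fix s show "\<psi> (p s) \<in> W" using \<phi>\<psi>p pb by (simp add: W_def)
    have "1 - \<bar>s / (1 + \<bar>s\<bar>)\<bar> = 1 / (1 + \<bar>s\<bar>)" by (simp add: abs_divide field_simps)
    then show "u (\<psi> (p s)) = s" by (simp add: u_def ap)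
  next
    fix x assume x: "x \<in> W"
    have "1 + \<bar>u x\<bar> = 1 / (1 - \<bar>a x\<bar>)" using aW[OF x] by (simp add: u_def abs_divide field_simps)
    then have "u x / (1 + \<bar>u x\<bar>) = a x" using aW[OF x] by (simp add: u_def)
    then have "p (u x) = \<phi> x" using r by (intro ext) (simp add: pk a_def)
    then show "\<psi> (p (u x)) = x" using \<psi>\<phi> x by (simp add: W_def)
  qed
  then show ?thesis using U(2) r by (intro exI[of _ W]) (auto simp: W_def)
qed

section \<open>Two line charts with disconnected overlap form a circle\<close>

definition semicircle :: "real \<Rightarrow> real \<Rightarrow> complex" where
  "semicircle \<sigma> t = Complex (1 - 2 * t) (\<sigma> * sqrt (1 - (1 - 2 * t)\<^sup>2))"

lemma semicircle_continuous: "continuous_on S (semicircle \<sigma>)"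
  unfolding semicircle_def Complex_eq
  by (intro continuous_intros)

lemma semicircle_sphere:
  assumes "t \<in> {0..1}" "\<sigma> \<in> {1,-1}"
  shows "semicircle \<sigma> t \<in> sphere 0 1"
proof -
  have "(1 - 2 * t)\<^sup>2 \<le> 1" using assms by (simp add: abs_square_le_1 abs_le_iff)
  then show ?thesis using assms by (auto simp: semicircle_def cmod_def power_mult_distrib)
qed

lemma semicircle_surj:
  assumes "w \<in> sphere 0 1"
  obtains t where "t \<in> {0..1}" "w = semicircle 1 t \<or> w = semicircle (-1) t"
proof -
  have w: "(Re w)\<^sup>2 + (Im w)\<^sup>2 = 1" using assms by (simp add: cmod_def)
  have re: "\<bar>Re w\<bar> \<le> 1" using w by (metis abs_le_square_iff abs_one le_add_same_cancel1 one_power2 zero_le_power2)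
  have im: "sqrt (1 - (Re w)\<^sup>2) = \<bar>Im w\<bar>" using w by (metis add_diff_cancel_left' real_sqrt_abs)
  define t where "t = (1 - Re w) / 2"
  have t: "t \<in> {0..1}" "1 - 2 * t = Re w" using re by (auto simp: t_def field_simps)
  have "w = semicircle 1 t \<or> w = semicircle (-1) t"
    unfolding semicircle_def t(2) im by (cases "Im w \<ge> 0") (auto simp: complex_eq_iff)
  then show ?thesis using that t by blast
qed

text \<open>The curve \<open>u'\<close> leaves \<open>V\<close> at \<open>\<alpha>1\<close> and has
  come back after \<open>\<alpha>2\<close>; the two adjacent pieces of it are the two ends of
  \<open>V\<close>. Hence the compact arcs \<open>u'\<close> {s1..s2}\<open>and\<close>v'
  \<open>{?r1..?r2}\<close> cover \<open>U \<union> V\<close> and meet only in their end points.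
  They are mapped to the upper and the lower semicircle.\<close>

lemma line_charts_circle_aux:
  assumes haus: "Hausdorff_space N" and con: "connected_space N"
    and U: "line_chart N U u u'" and V: "line_chart N V v v'" and nsub: "\<not> V \<subseteq> U"
    and s: "u' s1 \<in> V" "s1 < \<alpha>1" "\<alpha>1 \<le> \<alpha>2" "\<alpha>2 < s2" "u' s2 \<in> V" "u' \<alpha>1 \<notin> V" "u' \<alpha>2 \<notin> V"
    and ray1: "v' ` {..v (u' s1)} = u' ` {s1..<\<alpha>1}"
    and ray2: "v' ` {v (u' s2)..} = u' ` {\<alpha>2<..s2} \<or> v' ` {..v (u' s2)} = u' ` {\<alpha>2<..s2}"
  shows "\<exists>h. homeomorphic_map N (top_of_set (sphere (0::complex) 1)) h"
proof -
  note UD = line_chartD[OF U] and VD = line_chartD[OF V]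
  let ?r1 = "v (u' s1)" and ?r2 = "v (u' s2)"
  have z1: "v' ?r1 = u' s1" and z2: "v' ?r2 = u' s2" using VD(6) s by auto
  have left: "u' t \<in> V" if "t \<le> s1" for t
    using line_chart_exit_both[OF haus U V s(1) _ _ s(2,6), of t] nsub that s(1) by (cases "t = s1") auto
  have right: "u' t \<in> V" if "s2 \<le> t" for t
    using line_chart_exit_both[OF haus U V s(5,4,7), of t] nsub that s(5) by (cases "t = s2") auto
  have mid: "u' t \<notin> V" if "\<alpha>1 \<le> t" "t \<le> \<alpha>2" for t
  proof
    assume "u' t \<in> V"
    then show False using line_chart_exit_both[OF haus U V, of t \<alpha>1 \<alpha>2] that s(6,7) nsub
      by (cases "t = \<alpha>1 \<or> t = \<alpha>2") auto
  qed
  \<comment> \<open>Two lower rays of \<open>V\<close> would intersect, but the pieces of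
    \<open>u'\<close> before \<open>\<alpha>1\<close> and after \<open>\<alpha>2\<close> are
    disjoint.\<close>
  have ray2': "v' ` {?r2..} = u' ` {\<alpha>2<..s2}"
  proof (rule ccontr)
    assume "\<not> ?thesis"
    then have *: "v' ` {..?r2} = u' ` {\<alpha>2<..s2}" using ray2 by blast
    have "v' (min ?r1 ?r2) \<in> u' ` {s1..<\<alpha>1}" unfolding ray1[symmetric] by (intro imageI) simp
    moreover have "v' (min ?r1 ?r2) \<in> u' ` {\<alpha>2<..s2}" unfolding *[symmetric] by (intro imageI) simp
    ultimately obtain t t' where "t \<in> {s1..<\<alpha>1}" "t' \<in> {\<alpha>2<..s2}" "u' t = u' t'" by (metis imageE)
    then show False using line_chart_inj[OF U, of t t'] s(3) by auto
  qed
  have low: "\<exists>t\<in>{s1..<\<alpha>1}. v' r = u' t" if "r \<le> ?r1" for r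
  proof -
    have "v' r \<in> u' ` {s1..<\<alpha>1}" unfolding ray1[symmetric] using that by (intro imageI) simp
    then show ?thesis by blast
  qed
  have low': "v (u' t) \<le> ?r1" if "t \<in> {s1..<\<alpha>1}" for t
  proof -
    have "u' t \<in> v' ` {..?r1}" unfolding ray1 using that by (intro imageI)
    then show ?thesis using VD(5) by auto
  qed
  have high: "\<exists>t\<in>{\<alpha>2<..s2}. v' r = u' t" if "?r2 \<le> r" for r
  proof -
    have "v' r \<in> u' ` {\<alpha>2<..s2}" unfolding ray2'[symmetric] using that by (intro imageI) simp
    then show ?thesis by blast
  qed
  have high': "?r2 \<le> v (u' t)" if "t \<in> {\<alpha>2<..s2}" for t
  proof -
    have "u' t \<in> v' ` {?r2..}" unfolding ray2' using that by (intro imageI)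
    then show ?thesis using VD(5) by auto
  qed
  have r12: "?r1 < ?r2"
  proof (rule ccontr)
    assume "\<not> ?thesis"
    then obtain t t' where "t \<in> {s1..<\<alpha>1}" "t' \<in> {\<alpha>2<..s2}" "u' t = u' t'" using low[of ?r2] high[of ?r2] by force
    then show False using line_chart_inj[OF U, of t t'] s(3) by auto
  qed
  let ?KU = "u' ` {s1..s2}" and ?KV = "v' ` {?r1..?r2}"
  have mU: "x \<in> ?KU \<longleftrightarrow> x \<in> U \<and> s1 \<le> u x \<and> u x \<le> s2" for x
    using UD(4-6) by (metis (no_types, lifting) atLeastAtMost_iff image_iff)
  have mV: "x \<in> ?KV \<longleftrightarrow> x \<in> V \<and> ?r1 \<le> v x \<and> v x \<le> ?r2" for x
    using VD(4-6) by (metis (no_types, lifting) atLeastAtMost_iff image_iff)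
  \<comment> \<open>The two end rays of \<open>V\<close> are already used up by pieces of
    \<open>u'\<close> between \<open>s1\<close> and \<open>s2\<close>, so a common point with
    parameter outside that interval lies on the middle arc of \<open>V\<close>.\<close>
  have midV: "x \<in> ?KV" if x: "x \<in> U" "x \<in> V" "u x < s1 \<or> s2 < u x" for x
  proof -
    have ux: "u' (u x) = x" "v' (v x) = x" using UD(6) VD(6) x by auto
    have "u x \<notin> {s1..<\<alpha>1}" "u x \<notin> {\<alpha>2<..s2}" using x(3) s by auto
    then have "\<not> v x \<le> ?r1" "\<not> ?r2 \<le> v x"
      using low[of "v x"] high[of "v x"] ux UD(5) by metis+
    then show ?thesis using x by (simp add: mV)
  qed
  have cover: "U \<union> V = ?KU \<union> ?KV"
  proof (intro equalityI subsetI)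
    fix x assume "x \<in> U \<union> V"
    then consider "x \<in> U" "s1 \<le> u x" "u x \<le> s2" | "x \<in> U" "u x < s1 \<or> s2 < u x" | "x \<in> V" by force
    then show "x \<in> ?KU \<union> ?KV"
    proof cases
      case 1 then show ?thesis by (simp add: mU)
    next
      case 2
      then have "u' (u x) \<in> V" using left[of "u x"] right[of "u x"] by auto
      then show ?thesis using midV[of x] 2 UD(6) by simp
    next
      case 3
      consider "v x \<le> ?r1" | "?r2 \<le> v x" | "?r1 \<le> v x" "v x \<le> ?r2" by linarith
      then show ?thesis
      proof cases
        case 1
        from low[OF 1] obtain t where "t \<in> {s1..<\<alpha>1}" "x = u' t" using VD(6)[OF 3] by auto
        then show ?thesis using s by auto
      next
        case 2
        from high[OF 2] obtain t where "t \<in> {\<alpha>2<..s2}" "x = u' t" using VD(6)[OF 3] by auto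
        then show ?thesis using s by auto
      qed (use 3 mV in simp)
    qed
  next
    fix x assume "x \<in> ?KU \<union> ?KV"
    then show "x \<in> U \<union> V" using mU mV by blast
  qed
  have compU: "compactin N ?KU" and compV: "compactin N ?KV"
    by (auto intro: line_chart_compact[OF U] line_chart_compact[OF V])
  have clU: "closedin N ?KU" and clV: "closedin N ?KV"
    using compactin_imp_closedin[OF haus] compU compV by auto
  \<comment> \<open>As a union of two compact arcs \<open>U \<union> V\<close> is closed; it is also
    open, so by connectedness it is all of \<open>N\<close>.\<close>
  have "closedin N (U \<union> V)" unfolding cover using clU clV by (rule closedin_Un)
  moreover have "openin N (U \<union> V)" using UD(1) VD(1) by (rule openin_Un)
  moreover have "U \<union> V \<noteq> {}" using UD(4) by blast
  ultimately have top: "topspace N = ?KU \<union> ?KV"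
    using con cover unfolding connected_space_clopen_in by metis
  have comp: "compact_space N" unfolding compact_space_def top using compU compV by (rule compactin_Un)
  have both: "x = u' s1 \<or> x = u' s2" if x: "x \<in> ?KU" "x \<in> ?KV" for x
  proof -
    have xx: "x \<in> U" "x \<in> V" "s1 \<le> u x" "u x \<le> s2" "?r1 \<le> v x" "v x \<le> ?r2" "u' (u x) = x" "v' (v x) = x"
      using x mU mV UD(6) VD(6) by auto
    then have "u x < \<alpha>1 \<or> \<alpha>2 < u x" using mid[of "u x"] by force
    then show ?thesis
    proof
      assume "u x < \<alpha>1"
      then have "v x = ?r1" using low'[of "u x"] xx by auto
      then show ?thesis using xx(8) z1 by metis
    next
      assume "\<alpha>2 < u x"
      then have "v x = ?r2" using high'[of "u x"] xx by auto
      then show ?thesis using xx(8) z2 by metis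
    qed
  qed
  define p where "p x = (u x - s1) / (s2 - s1)" for x
  define q where "q x = (v x - ?r1) / (?r2 - ?r1)" for x
  have s12: "s1 < s2" using s by linarith
  have p01: "p x \<in> {0..1}" if "x \<in> ?KU" for x
    using that mU[of x] s12 by (simp add: p_def)
  have q01: "q x \<in> {0..1}" if "x \<in> ?KV" for x
    using that mV[of x] r12 by (simp add: q_def)
  have pq: "p (u' s1) = 0" "p (u' s2) = 1" "q (u' s1) = 0" "q (u' s2) = 1"
    using UD(5) s12 r12 by (auto simp: p_def q_def)
  \<comment> \<open>Both semicircles run from 1 to -1 with real part \<open>1 - 2 * t\<close>. Hence
    the real part determines the position on an arc, and the sign of the imaginary part separates
    the arcs.\<close>
  define h where "h x = (if x \<in> ?KU then semicircle 1 (p x) else semicircle (-1) (q x))" for x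
  have hV: "h x = semicircle (-1) (q x)" if "x \<in> ?KV" for x
    using both[of x] that pq by (auto simp: h_def semicircle_def)
  have hU: "h x = semicircle 1 (p x)" if "x \<in> ?KU" for x using that by (simp add: h_def)
  have KUU: "?KU \<subseteq> U" "?KV \<subseteq> V" using UD(4) VD(4) by auto
  have "continuous_map N euclidean h"
  proof (rule continuous_map_paste_closed[OF clU clV, where f = "\<lambda>x. semicircle 1 (p x)" and g = "\<lambda>x. semicircle (-1) (q x)"])
    have sc: "continuous_map euclideanreal euclidean (semicircle \<sigma>)" for \<sigma>
      using semicircle_continuous by simp
    have "continuous_map (subtopology N ?KU) euclideanreal u" "continuous_map (subtopology N ?KV) euclideanreal v"
      using continuous_map_from_subtopology_mono[OF UD(2) KUU(1)] continuous_map_from_subtopology_mono[OF VD(2) KUU(2)] by auto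
    then have cp: "continuous_map (subtopology N ?KU) euclideanreal p" and cq: "continuous_map (subtopology N ?KV) euclideanreal q"
      unfolding p_def q_def using s12 r12 by (auto intro!: continuous_map_real_divide continuous_map_diff)
    show "continuous_map (subtopology N ?KU) euclidean (\<lambda>x. semicircle 1 (p x))"
      using continuous_map_compose[OF cp sc[of 1]] by (simp add: o_def)
    show "continuous_map (subtopology N ?KV) euclidean (\<lambda>x. semicircle (-1) (q x))"
      using continuous_map_compose[OF cq sc[of "-1"]] by (simp add: o_def)
    show "topspace N \<subseteq> ?KU \<union> ?KV" using top by simp
    show "semicircle 1 (p x) = semicircle (-1) (q x)" if "x \<in> ?KU" "x \<in> ?KV" for x
      using hU[OF that(1)] hV[OF that(2)] by simp
  qed (use hU hV in auto)
  moreover have hs: "h x \<in> sphere 0 1" if "x \<in> topspace N" for x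
    using that hU hV semicircle_sphere p01 q01 unfolding top by (metis Un_iff insertCI)
  ultimately have ch: "continuous_map N (top_of_set (sphere 0 1)) h"
    by (auto simp: continuous_map_in_subtopology)
  have surj: "h ` topspace N = topspace (top_of_set (sphere 0 1))"
  proof (intro equalityI subsetI)
    fix w assume "w \<in> topspace (top_of_set (sphere (0::complex) 1))"
    then have "w \<in> sphere 0 1" by simp
    then obtain t where t: "t \<in> {0..1}" "w = semicircle 1 t \<or> w = semicircle (-1) t" by (rule semicircle_surj)
    let ?s = "s1 + t * (s2 - s1)" and ?r = "?r1 + t * (?r2 - ?r1)"
    have "t * (s2 - s1) \<le> 1 * (s2 - s1)" "t * (?r2 - ?r1) \<le> 1 * (?r2 - ?r1)"
      "0 \<le> t * (s2 - s1)" "0 \<le> t * (?r2 - ?r1)"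
      using t(1) s12 r12 by (auto intro!: mult_right_mono)
    then have K: "u' ?s \<in> ?KU" "v' ?r \<in> ?KV" by (auto intro!: imageI)
    moreover have "p (u' ?s) = t" "q (v' ?r) = t" using UD(5) VD(5) s12 r12 by (auto simp: p_def q_def)
    ultimately have "h (u' ?s) = semicircle 1 t" "h (v' ?r) = semicircle (-1) t" using hU hV by auto
    then show "w \<in> h ` topspace N" using t(2) K unfolding top by (metis UnI1 UnI2 imageI)
  qed (use hs in auto)
  have Re_h: "Re (h x) = 1 - 2 * p x" "Im (h x) \<ge> 0" if "x \<in> ?KU" for x
  proof -
    have "0 \<le> 1 - (1 - 2 * p x)\<^sup>2" using p01[OF that] by (simp add: abs_square_le_1 abs_le_iff)
    then show "Re (h x) = 1 - 2 * p x" "Im (h x) \<ge> 0" using hU[OF that] by (simp_all add: semicircle_def)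
  qed
  have Re_h': "Re (h x) = 1 - 2 * q x" "Im (h x) \<le> 0" if "x \<in> ?KV" for x
  proof -
    have "0 \<le> 1 - (1 - 2 * q x)\<^sup>2" using q01[OF that] by (simp add: abs_square_le_1 abs_le_iff)
    then show "Re (h x) = 1 - 2 * q x" "Im (h x) \<le> 0" using hV[OF that] by (simp_all add: semicircle_def)
  qed
  have p_inj: "x = y" if "x \<in> ?KU" "y \<in> ?KU" "p x = p y" for x y
  proof -
    have "u x = u y" using that(3) s12 by (simp add: p_def)
    then show ?thesis using that(1,2) mU UD(6) by metis
  qed
  have q_inj: "x = y" if "x \<in> ?KV" "y \<in> ?KV" "q x = q y" for x y
  proof -
    have "v x = v y" using that(3) r12 by (simp add: q_def)
    then show ?thesis using that(1,2) mV VD(6) by metis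
  qed
  have z1K: "u' s1 \<in> ?KU" "u' s2 \<in> ?KU" "u' s1 \<in> ?KV" "u' s2 \<in> ?KV"
    using s12 r12 z1 z2 by (auto simp: image_iff) (metis atLeastAtMost_iff less_imp_le order_refl)+
  \<comment> \<open>A common value of the two semicircles is real, hence 1 or -1, and these values
    are taken exactly where the arcs meet.\<close>
  have mixed: "x = y" if x: "x \<in> ?KU" and y: "y \<in> ?KV" and xy: "h x = h y" for x y
  proof -
    have "Im (h x) = 0" using Re_h(2)[OF x] Re_h'(2)[OF y] xy by simp
    moreover have "(Re (h x))\<^sup>2 + (Im (h x))\<^sup>2 = 1"
      using hs[of x] x unfolding top by (simp add: cmod_def)
    ultimately have "Re (h x) = 1 \<or> Re (h x) = -1" by (simp add: power2_eq_1_iff)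
    then have "(p x = 0 \<and> q y = 0) \<or> (p x = 1 \<and> q y = 1)" using Re_h(1)[OF x] Re_h'(1)[OF y] xy by auto
    then show "x = y" using p_inj[OF x z1K(1)] p_inj[OF x z1K(2)] q_inj[OF y z1K(3)] q_inj[OF y z1K(4)] pq by auto
  qed
  have "inj_on h (topspace N)"
  proof (rule inj_onI)
    fix x y assume x: "x \<in> topspace N" and y: "y \<in> topspace N" and xy: "h x = h y"
    consider "x \<in> ?KU" "y \<in> ?KU" | "x \<in> ?KU" "y \<in> ?KV" | "x \<in> ?KV" "y \<in> ?KU" | "x \<in> ?KV" "y \<in> ?KV"
      using x y unfolding top by blast
    then show "x = y"
    proof cases
      case 1
      then have "p x = p y" using Re_h(1)[of x] Re_h(1)[of y] xy by simp
      then show ?thesis using p_inj 1 by blast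
    next
      case 2 then show ?thesis using mixed xy by blast
    next
      case 3 then show ?thesis using mixed[of y x] xy by simp
    next
      case 4
      then have "q x = q y" using Re_h'(1)[of x] Re_h'(1)[of y] xy by simp
      then show ?thesis using q_inj 4 by blast
    qed
  qed
  then show ?thesis
    using continuous_imp_homeomorphic_map[OF ch comp _ surj] by (auto simp: Hausdorff_space_subtopology)
qed

text \<open>A disconnected overlap means that \<open>u'\<close> is in \<open>V\<close> at
  \<open>s1\<close> and \<open>s2\<close> but not at some \<open>\<alpha>\<close> between them.
  Following \<open>u'\<close> from both sides to its exits gives the arcs, after reflecting
  \<open>v\<close> if the first ray is an upper one.\<close>

lemma line_charts_circle:
  assumes haus: "Hausdorff_space N" and con: "connected_space N"
    and U: "line_chart N U u u'" and V: "line_chart N V v v'"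
    and nc: "\<not> connectedin N (U \<inter> V)"
  shows "\<exists>h. homeomorphic_map N (top_of_set (sphere (0::complex) 1)) h"
proof -
  note UD = line_chartD[OF U]
  have nsub: "\<not> V \<subseteq> U"
  proof
    assume "V \<subseteq> U"
    then have "U \<inter> V = v' ` UNIV" using line_chart_range[OF V] by auto
    then show False using line_chart_connectedin[OF V, of UNIV] nc by simp
  qed
  have "U \<inter> V = u' ` {s. u' s \<in> V}"
    using line_chart_range[OF U] by auto
  then have "\<not> connected {s. u' s \<in> V}" using line_chart_connectedin[OF U] nc by metis
  then obtain s1 s2 \<alpha> where s: "u' s1 \<in> V" "u' s2 \<in> V" "u' \<alpha> \<notin> V" "s1 \<le> \<alpha>" "\<alpha> \<le> s2"
    unfolding connected_iff_interval by auto
  then have lt: "s1 < \<alpha>" "\<alpha> < s2" by (auto simp: less_le)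
  obtain \<alpha>1 where a1: "s1 < \<alpha>1" "\<alpha>1 \<le> \<alpha>" "u' \<alpha>1 \<notin> V"
    "v' ` {v (u' s1)..} = u' ` {s1..<\<alpha>1} \<or> v' ` {..v (u' s1)} = u' ` {s1..<\<alpha>1}"
    using line_chart_exit_right[OF haus U V s(1) lt(1) s(3)] by metis
  obtain \<alpha>2 where a2: "\<alpha>2 < s2" "\<alpha> \<le> \<alpha>2" "u' \<alpha>2 \<notin> V"
    "v' ` {v (u' s2)..} = u' ` {\<alpha>2<..s2} \<or> v' ` {..v (u' s2)} = u' ` {\<alpha>2<..s2}"
    using line_chart_exit_left[OF haus U V s(2) lt(2) s(3)] by metis
  show ?thesis
  proof (cases "v' ` {..v (u' s1)} = u' ` {s1..<\<alpha>1}")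
    case True
    have "\<alpha>1 \<le> \<alpha>2" using a1(2) a2(2) by linarith
    then show ?thesis
      using line_charts_circle_aux[OF haus con U V nsub s(1) a1(1) _ a2(1) s(2) a1(3) a2(3) True a2(4)] by simp
  next
    case False
    have neg: "(\<lambda>r. v' (- r)) ` {..- r} = v' ` {r..}" "(\<lambda>r. v' (- r)) ` {- r..} = v' ` {..r}" for r
    proof -
      have "(\<lambda>r. v' (- r)) ` X = v' ` uminus ` X" for X by (simp only: image_image)
      then show "(\<lambda>r. v' (- r)) ` {..- r} = v' ` {r..}" "(\<lambda>r. v' (- r)) ` {- r..} = v' ` {..r}" by simp_all
    qed
    have "\<alpha>1 \<le> \<alpha>2" using a1(2) a2(2) by linarith
    then show ?thesis
      using line_charts_circle_aux[OF haus con U line_chart_uminus[OF V] nsub s(1) a1(1) _ a2(1) s(2) a1(3) a2(3)]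
        False a1(4) a2(4) unfolding neg by metis
  qed
qed

section \<open>Goursat's lemma\<close>

text \<open>\<open>L\<close> plays the role of a subgroup of the direct product of \<open>G1\<close>
  and \<open>G2\<close>. Then \<open>P1\<close> is its projection to \<open>G1\<close>, and
  \<open>C1\<close> is its intersection with the factor \<open>G1\<close>.\<close>

locale fiber_pair = G1: group G1 + G2: group G2
  for G1 :: "('a, 'm) monoid_scheme" (structure) and G2 :: "('b, 'n) monoid_scheme" (structure) +
  fixes L :: "'a \<Rightarrow> 'b \<Rightarrow> bool"
  assumes L_one: "L \<one>\<^bsub>G1\<^esub> \<one>\<^bsub>G2\<^esub>"
    and L_mult: "\<lbrakk>a \<in> carrier G1; b \<in> carrier G2; a' \<in> carrier G1; b' \<in> carrier G2; L a b; L a' b'\<rbrakk>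
        \<Longrightarrow> L (a \<otimes>\<^bsub>G1\<^esub> a') (b \<otimes>\<^bsub>G2\<^esub> b')"
    and L_inv: "\<lbrakk>a \<in> carrier G1; b \<in> carrier G2; L a b\<rbrakk> \<Longrightarrow> L (inv\<^bsub>G1\<^esub> a) (inv\<^bsub>G2\<^esub> b)"
begin

definition "C1 = {a \<in> carrier G1. L a \<one>\<^bsub>G2\<^esub>}"
definition "P1 = {a \<in> carrier G1. \<exists>b\<in>carrier G2. L a b}"

lemma C1_subset_P1: "C1 \<subseteq> P1" by (auto simp: C1_def P1_def)

lemma subgroup_C1: "subgroup C1 G1"
proof (rule G1.subgroupI)
  show "inv\<^bsub>G1\<^esub> a \<in> C1" if "a \<in> C1" for a
    using that L_inv[of a "\<one>\<^bsub>G2\<^esub>"] by (simp add: C1_def)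
  show "a \<otimes>\<^bsub>G1\<^esub> b \<in> C1" if "a \<in> C1" "b \<in> C1" for a b
    using that L_mult[of a "\<one>\<^bsub>G2\<^esub>" b "\<one>\<^bsub>G2\<^esub>"] by (simp add: C1_def)
qed (use L_one in \<open>auto simp: C1_def\<close>)

lemma subgroup_P1: "subgroup P1 G1"
proof (rule G1.subgroupI)
  show "inv\<^bsub>G1\<^esub> a \<in> P1" if "a \<in> P1" for a
    using that L_inv[of a] by (auto simp: P1_def)
  show "a \<otimes>\<^bsub>G1\<^esub> b \<in> P1" if "a \<in> P1" "b \<in> P1" for a b
    using that L_mult[of a _ b] G2.m_closed unfolding P1_def by blast
qed (use L_one in \<open>auto simp: P1_def\<close>)

lemma carrier_P1: "carrier (subgroup_generated G1 P1) = P1"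
  using subgroup.carrier_subgroup_generated_subgroup[OF subgroup_P1] .

text \<open>Conjugating the pair \<open>(h, 1)\<close> by \<open>(x, b)\<close> leaves the second
  component 1. The partner \<open>b\<close> is available for \<open>x\<close> in \<open>P1\<close>,
  which is why normality is claimed there.\<close>

lemma C1_normal: "C1 \<lhd> subgroup_generated G1 P1"
proof (rule group.normal_invI)
  let ?H = "subgroup_generated G1 P1"
  show H: "group ?H" by (rule G1.group_subgroup_generated)
  show "subgroup C1 ?H"
    using subgroup_C1 C1_subset_P1 by (simp add: G1.subgroup_subgroup_generated_iff carrier_P1)
  fix x h assume x: "x \<in> carrier ?H" and h: "h \<in> C1"
  from x have x1: "x \<in> P1" "x \<in> carrier G1" using subgroup.subset[OF subgroup_P1] by (auto simp: carrier_P1)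
  then obtain b where b: "b \<in> carrier G2" "L x b" by (auto simp: P1_def)
  have "L (x \<otimes>\<^bsub>G1\<^esub> h \<otimes>\<^bsub>G1\<^esub> inv\<^bsub>G1\<^esub> x) (b \<otimes>\<^bsub>G2\<^esub> \<one>\<^bsub>G2\<^esub> \<otimes>\<^bsub>G2\<^esub> inv\<^bsub>G2\<^esub> b)"
    using b x1 h by (intro L_mult L_inv) (auto simp: C1_def)
  then show "x \<otimes>\<^bsub>?H\<^esub> h \<otimes>\<^bsub>?H\<^esub> inv\<^bsub>?H\<^esub> x \<in> C1"
    using b x1 h x by (simp add: C1_def G1.inv_subgroup_generated)
qed

end

text \<open>Both orientations of the relation in one locale, so that every fact about the first
  factor is also available for the second.\<close>

locale fiber_pair_sym = fiber_pair + flip: fiber_pair G2 G1 "\<lambda>b a. L a b"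
begin

abbreviation "C2 \<equiv> flip.C1"
abbreviation "P2 \<equiv> flip.P1"

text \<open>Multiplication by a pair \<open>(c, 1)\<close> with \<open>c\<close> in
  \<open>C1\<close> makes \<open>b\<close> a partner of \<open>a'\<close> too. Two partners of the
  same element differ by an element of \<open>C2\<close>, and any such change is allowed.\<close>

lemma L_coset:
  assumes "a \<in> carrier G1" "b \<in> carrier G2" "a' \<in> carrier G1" "b' \<in> carrier G2"
    and L: "L a b" and a: "C1 #>\<^bsub>G1\<^esub> a = C1 #>\<^bsub>G1\<^esub> a'"
  shows "L a' b' \<longleftrightarrow> C2 #>\<^bsub>G2\<^esub> b = C2 #>\<^bsub>G2\<^esub> b'"
proof -
  have "a \<in> C1 #>\<^bsub>G1\<^esub> a'"
    using G1.rcos_self[OF assms(1) subgroup_C1] a by simp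
  then obtain c where c: "c \<in> C1" "a = c \<otimes>\<^bsub>G1\<^esub> a'" by (auto simp: r_coset_def)
  then have cc: "c \<in> carrier G1" "L c \<one>\<^bsub>G2\<^esub>" by (auto simp: C1_def)
  have "L (inv\<^bsub>G1\<^esub> c \<otimes>\<^bsub>G1\<^esub> a) (inv\<^bsub>G2\<^esub> \<one>\<^bsub>G2\<^esub> \<otimes>\<^bsub>G2\<^esub> b)"
    by (rule L_mult[OF _ _ _ _ L_inv]) (use cc assms in auto)
  then have L': "L a' b" using cc assms c(2) by (simp add: G1.m_assoc[symmetric])
  show ?thesis
  proof
    assume "L a' b'"
    then have "L (a' \<otimes>\<^bsub>G1\<^esub> inv\<^bsub>G1\<^esub> a') (b \<otimes>\<^bsub>G2\<^esub> inv\<^bsub>G2\<^esub> b')"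
      using L' assms by (intro L_mult L_inv) auto
    then have "b \<otimes>\<^bsub>G2\<^esub> inv\<^bsub>G2\<^esub> b' \<in> C2" using assms by (simp add: flip.C1_def)
    then have "b \<in> C2 #>\<^bsub>G2\<^esub> b'"
      using assms by (force simp: r_coset_def G2.m_assoc)
    then show "C2 #>\<^bsub>G2\<^esub> b = C2 #>\<^bsub>G2\<^esub> b'"
      using G2.repr_independence[OF _ _ flip.subgroup_C1] assms by simp
  next
    assume "C2 #>\<^bsub>G2\<^esub> b = C2 #>\<^bsub>G2\<^esub> b'"
    then have "b' \<in> C2 #>\<^bsub>G2\<^esub> b"
      using G2.rcos_self[OF assms(4) flip.subgroup_C1] by simp
    then obtain d where d: "d \<in> C2" "b' = d \<otimes>\<^bsub>G2\<^esub> b" by (auto simp: r_coset_def)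
    then have "L (\<one>\<^bsub>G1\<^esub> \<otimes>\<^bsub>G1\<^esub> a') (d \<otimes>\<^bsub>G2\<^esub> b)"
      using assms L' by (intro L_mult) (auto simp: flip.C1_def)
    then show "L a' b'" using d assms by simp
  qed
qed

lemma L_coset':
  assumes "a \<in> carrier G1" "b \<in> carrier G2" "a' \<in> carrier G1" "b' \<in> carrier G2"
    and "L a b" "L a' b'"
  shows "C1 #>\<^bsub>G1\<^esub> a = C1 #>\<^bsub>G1\<^esub> a' \<longleftrightarrow> C2 #>\<^bsub>G2\<^esub> b = C2 #>\<^bsub>G2\<^esub> b'"
proof
  show "C1 #>\<^bsub>G1\<^esub> a = C1 #>\<^bsub>G1\<^esub> a' \<Longrightarrow> C2 #>\<^bsub>G2\<^esub> b = C2 #>\<^bsub>G2\<^esub> b'"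
    using L_coset[OF assms(1-5)] assms(6) by blast
  interpret f: fiber_pair_sym G2 G1 "\<lambda>b a. L a b" ..
  show "C2 #>\<^bsub>G2\<^esub> b = C2 #>\<^bsub>G2\<^esub> b' \<Longrightarrow> C1 #>\<^bsub>G1\<^esub> a = C1 #>\<^bsub>G1\<^esub> a'"
    using f.L_coset[OF assms(2,1,4,3)] assms(5,6) by blast
qed

text \<open>An arbitrary partner of an arbitrary element of the coset is taken; independence of both
  choices is \<open>L_coset'\<close>.\<close>

definition cmap :: "'a set \<Rightarrow> 'c set" where
  "cmap X = C2 #>\<^bsub>G2\<^esub> (SOME b. b \<in> carrier G2 \<and> (\<exists>a\<in>X. a \<in> carrier G1 \<and> L a b))"

lemma cmap_eq:
  assumes "a \<in> carrier G1" "b \<in> carrier G2" "L a b"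
  shows "cmap (C1 #>\<^bsub>G1\<^esub> a) = C2 #>\<^bsub>G2\<^esub> b"
proof -
  let ?Q = "\<lambda>b. b \<in> carrier G2 \<and> (\<exists>a'\<in>C1 #>\<^bsub>G1\<^esub> a. a' \<in> carrier G1 \<and> L a' b)"
  have "?Q b" using assms G1.rcos_self[OF assms(1) subgroup_C1] by blast
  then have "?Q (SOME b. ?Q b)" by (rule someI)
  then obtain a' where a': "(SOME b. ?Q b) \<in> carrier G2" "a'\<in>C1 #>\<^bsub>G1\<^esub> a" "a' \<in> carrier G1" "L a' (SOME b. ?Q b)"
    by blast
  then have "C1 #>\<^bsub>G1\<^esub> a = C1 #>\<^bsub>G1\<^esub> a'"
    using G1.repr_independence[OF _ assms(1) subgroup_C1] by simp
  then show ?thesis unfolding cmap_def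
    using L_coset'[OF assms(1,2) a'(3,1) assms(3) a'(4)] by simp
qed

lemma cmap_iff:
  assumes "a \<in> carrier G1" "b \<in> carrier G2"
  shows "L a b \<longleftrightarrow> a \<in> P1 \<and> b \<in> P2 \<and> cmap (C1 #>\<^bsub>G1\<^esub> a) = C2 #>\<^bsub>G2\<^esub> b"
proof
  show "L a b \<Longrightarrow> a \<in> P1 \<and> b \<in> P2 \<and> cmap (C1 #>\<^bsub>G1\<^esub> a) = C2 #>\<^bsub>G2\<^esub> b"
    using assms cmap_eq by (auto simp: P1_def flip.P1_def)
  assume *: "a \<in> P1 \<and> b \<in> P2 \<and> cmap (C1 #>\<^bsub>G1\<^esub> a) = C2 #>\<^bsub>G2\<^esub> b"
  then obtain b' where b': "b' \<in> carrier G2" "L a b'" by (auto simp: P1_def)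
  then have "C2 #>\<^bsub>G2\<^esub> b' = C2 #>\<^bsub>G2\<^esub> b" using cmap_eq assms * by simp
  then show "L a b" using L_coset[OF assms(1) b'(1) assms b'(2) refl] by simp
qed

lemma cmap_iso:
  "cmap \<in> iso (subgroup_generated G1 P1 Mod C1) (subgroup_generated G2 P2 Mod C2)"
proof -
  let ?H1 = "subgroup_generated G1 P1" and ?H2 = "subgroup_generated G2 P2"
  interpret n1: normal C1 ?H1 by (rule C1_normal)
  interpret n2: normal C2 ?H2 by (rule flip.C1_normal)
  \<comment> \<open>The generated subgroup inherits its multiplication, so cosets formed in it are
    literally the cosets formed in the big group.\<close>
  have co1: "C1 #>\<^bsub>?H1\<^esub> a = C1 #>\<^bsub>G1\<^esub> a" for a by (simp add: r_coset_def)
  have co2: "C2 #>\<^bsub>?H2\<^esub> a = C2 #>\<^bsub>G2\<^esub> a" for a by (simp add: r_coset_def)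
  have car1: "carrier (?H1 Mod C1) = (\<lambda>a. C1 #>\<^bsub>G1\<^esub> a) ` P1"
    by (auto simp: FactGroup_def RCOSETS_def co1 carrier_P1)
  have car2: "carrier (?H2 Mod C2) = (\<lambda>a. C2 #>\<^bsub>G2\<^esub> a) ` P2"
    by (auto simp: FactGroup_def RCOSETS_def co2 flip.carrier_P1)
  have mem1: "\<exists>a\<in>carrier G1. \<exists>b\<in>carrier G2. L a b \<and> a \<in> P1 \<and> b \<in> P2 \<and> X = C1 #>\<^bsub>G1\<^esub> a \<and> cmap X = C2 #>\<^bsub>G2\<^esub> b"
    if "X \<in> carrier (?H1 Mod C1)" for X
    using that cmap_eq unfolding car1 by (auto simp: P1_def flip.P1_def) blast
  have mult1: "(C1 #>\<^bsub>G1\<^esub> a) \<otimes>\<^bsub>?H1 Mod C1\<^esub> (C1 #>\<^bsub>G1\<^esub> a') = C1 #>\<^bsub>G1\<^esub> (a \<otimes>\<^bsub>G1\<^esub> a')"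
    if "a \<in> P1" "a' \<in> P1" for a a'
    using n1.rcos_sum[of a a'] that by (simp add: carrier_P1 co1 FactGroup_def)
  have mult2: "(C2 #>\<^bsub>G2\<^esub> a) \<otimes>\<^bsub>?H2 Mod C2\<^esub> (C2 #>\<^bsub>G2\<^esub> a') = C2 #>\<^bsub>G2\<^esub> (a \<otimes>\<^bsub>G2\<^esub> a')"
    if "a \<in> P2" "a' \<in> P2" for a a'
    using n2.rcos_sum[of a a'] that by (simp add: flip.carrier_P1 co2 FactGroup_def)
  have "cmap \<in> hom (?H1 Mod C1) (?H2 Mod C2)"
  proof (rule homI)
    fix X Y assume X: "X \<in> carrier (?H1 Mod C1)" and Y: "Y \<in> carrier (?H1 Mod C1)"
    obtain a b where a: "a \<in> carrier G1" "b \<in> carrier G2" "L a b" "a \<in> P1" "b \<in> P2" "X = C1 #>\<^bsub>G1\<^esub> a" "cmap X = C2 #>\<^bsub>G2\<^esub> b"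
      using mem1[OF X] by blast
    show "cmap X \<in> carrier (?H2 Mod C2)" using a car2 by auto
    obtain a' b' where a': "a' \<in> carrier G1" "b' \<in> carrier G2" "L a' b'" "a' \<in> P1" "b' \<in> P2" "Y = C1 #>\<^bsub>G1\<^esub> a'" "cmap Y = C2 #>\<^bsub>G2\<^esub> b'"
      using mem1[OF Y] by blast
    show "cmap (X \<otimes>\<^bsub>?H1 Mod C1\<^esub> Y) = cmap X \<otimes>\<^bsub>?H2 Mod C2\<^esub> cmap Y"
      using a a' mult1 mult2 cmap_eq[of "a \<otimes>\<^bsub>G1\<^esub> a'" "b \<otimes>\<^bsub>G2\<^esub> b'"] L_mult by simp
  qed
  moreover have "inj_on cmap (carrier (?H1 Mod C1))"
  proof (rule inj_onI)
    fix X Y assume X: "X \<in> carrier (?H1 Mod C1)" and Y: "Y \<in> carrier (?H1 Mod C1)" and eq: "cmap X = cmap Y"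
    show "X = Y" using mem1[OF X] mem1[OF Y] eq L_coset' by metis
  qed
  moreover have "carrier (?H2 Mod C2) \<subseteq> cmap ` carrier (?H1 Mod C1)"
  proof
    fix Y assume "Y \<in> carrier (?H2 Mod C2)"
    then obtain b where b: "b \<in> P2" "Y = C2 #>\<^bsub>G2\<^esub> b" by (auto simp: car2)
    then obtain a where a: "b \<in> carrier G2" "a \<in> carrier G1" "L a b" by (auto simp: flip.P1_def)
    then have "a \<in> P1" by (auto simp: P1_def)
    then have "C1 #>\<^bsub>G1\<^esub> a \<in> carrier (?H1 Mod C1)" by (simp add: car1)
    then show "Y \<in> cmap ` carrier (?H1 Mod C1)"
      using cmap_eq[OF a(2,1,3)] b(2) by (metis imageI)
  qed
  moreover have "cmap ` carrier (?H1 Mod C1) \<subseteq> carrier (?H2 Mod C2)"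
    using mem1 car2 by fastforce
  ultimately show ?thesis by (auto simp: iso_def bij_betw_def)
qed

end

section \<open>Based looseness\<close>

lemma sphere_maps_based:
  assumes "f \<in> sphere_maps m N" "m \<ge> 1"
  obtains p where "p \<in> topspace N" "f \<in> based_maps m N p"
proof -
  obtain p where p: "\<forall>x\<in>cube_bd m. f x = p" and f: "continuous_map (top_of_set (cube m)) N f" "f \<in> extensional (cube m)"
    using assms(1) by (auto simp: sphere_maps_def)
  note z = zero_in_cube_bd[OF assms(2)]
  have "f (\<lambda>_. 0) \<in> topspace N"
    using f(1) cube_bd_subset[OF z] by (auto simp: continuous_map_def)
  then show ?thesis using that[of p] p f z by (simp add: based_maps_def)
qed

lemma based_maps_base_in:
  assumes "f \<in> based_maps m N p" "m \<ge> 1"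
  shows "p \<in> topspace N"
  using based_maps_bd[OF assms(1) zero_in_cube_bd[OF assms(2)]] based_maps_continuous[OF assms(1)]
    cube_bd_subset[OF zero_in_cube_bd[OF assms(2)]] by (auto simp: continuous_map_def)

lemma transport_cong:
  assumes "\<And>y. y \<in> cube m \<Longrightarrow> f y = g y" "\<And>s. s \<in> {0..1} \<Longrightarrow> \<delta> s = \<epsilon> s"
  shows "transport m f \<delta> = transport m g \<epsilon>"
  unfolding transport_def
  using assms stretch_cube excess_bounds(1)[of 1 m] excess_bounds(2)[of m 1]
  by (intro restrict_ext) simp

lemma pathin_slice:
  assumes "continuous_map (top_of_set ({0..1::real} \<times> {0..1::real})) N K" "t \<in> {0..1}"
  shows "pathin N (\<lambda>s. K (t, s))"
  unfolding pathin_def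
  by (rule continuous_map_compose_set[OF assms(1)])
     (use assms(2) in \<open>auto intro!: continuous_on_Pair continuous_on_const continuous_on_id\<close>)

lemma pathin_rev:
  assumes "pathin N \<gamma>" shows "pathin N (\<lambda>s. \<gamma> (1 - s))"
  unfolding pathin_def
  by (rule continuous_map_compose_set[OF assms[unfolded pathin_def]]) (auto intro!: continuous_intros)

section \<open>Disjoint based representatives in dimension at least two\<close>

lemma disjoint_base_points:
  assumes "g1 \<in> based_maps m N p1" "g2 \<in> based_maps m N p2" "m \<ge> 1" "\<And>x. x \<in> cube m \<Longrightarrow> g1 x \<noteq> g2 x"
  shows "p1 \<noteq> p2"
  using assms zero_in_cube_bd[OF assms(3)] based_maps_bd[OF assms(1)] based_maps_bd[OF assms(2)] cube_bd_subset
  by metis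

text \<open>The reversed track from \<open>p1\<close> to \<open>b1\<close> is pushed off
  \<open>p2\<close> with fixed ends. Then \<open>g1\<close> is transported along it and
  \<open>g2\<close> along the constant path, which keeps the maps disjoint and returns
  \<open>g1\<close> to the class of \<open>f1\<close>.\<close>

lemma rebase_first:
  assumes N: "smooth_manifold N TYPE('n::finite)" and n: "CARD('n) \<ge> 2" and m: "m \<ge> 1"
    and g1: "g1 \<in> based_maps m N p1" and g2: "g2 \<in> based_maps m N p2"
    and disj: "\<And>x. x \<in> cube m \<Longrightarrow> g1 x \<noteq> g2 x"
    and f1: "f1 \<in> based_maps m N b1" "free_htpc m N f1 g1" and b1: "b1 \<noteq> p2"
  obtains g1' g2' where "g1' \<in> based_maps m N b1" "based_htpc m N b1 f1 g1'"
    "g2' \<in> based_maps m N p2" "based_htpc m N p2 g2 g2'" "\<And>x. x \<in> cube m \<Longrightarrow> g1' x \<noteq> g2' x"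
proof -
  note z = zero_in_cube_bd[OF m]
  have p2: "p2 \<in> topspace N" by (rule based_maps_base_in[OF g2 m])
  have p12: "p1 \<noteq> p2" by (rule disjoint_base_points[OF g1 g2 m disj])
  obtain H \<gamma> where H: "continuous_map (top_of_set ({0..1::real} \<times> cube m)) N H"
    "\<And>x. x \<in> cube m \<Longrightarrow> H (0,x) = f1 x" "\<And>x. x \<in> cube m \<Longrightarrow> H (1,x) = g1 x"
    "\<And>t x. t \<in> {0..1} \<Longrightarrow> x \<in> cube_bd m \<Longrightarrow> H (t,x) = \<gamma> t" "pathin N \<gamma>"
    using free_htpc_track[OF f1(2) m] by metis
  have \<gamma>0: "\<gamma> 0 = b1" using H(2)[OF cube_bd_subset[OF z]] H(4)[OF _ z, of 0] based_maps_bd[OF f1(1) z] by simp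
  have \<gamma>1: "\<gamma> 1 = p1" using H(3)[OF cube_bd_subset[OF z]] H(4)[OF _ z, of 1] based_maps_bd[OF g1 z] by simp
  let ?\<delta> = "\<lambda>s. \<gamma> (1 - s)"
  have \<delta>: "pathin N ?\<delta>" "?\<delta> 0 = p1" "?\<delta> 1 = b1" using pathin_rev[OF H(5)] \<gamma>0 \<gamma>1 by auto
  obtain K where K: "continuous_map (top_of_set ({0..1::real} \<times> {0..1::real})) N K"
    "\<And>t. t \<in> {0..1} \<Longrightarrow> K (0,t) = ?\<delta> t" "\<And>t. t \<in> {0..1} \<Longrightarrow> K (1,t) \<noteq> p2"
    "\<And>t. t \<in> {0..1} \<Longrightarrow> K (t,0) = ?\<delta> 0" "\<And>t. t \<in> {0..1} \<Longrightarrow> K (t,1) = ?\<delta> 1"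
    using path_avoiding_point[OF N n p2 \<delta>(1)] \<delta>(2,3) p12 b1 by metis
  have K0: "K (1,0) = p1" "K (1,1) = b1" using K(4)[of 1] K(5)[of 1] \<delta> by auto
  have "based_htpc m N b1 f1 (transport m (\<lambda>x. H (1,x)) ?\<delta>)"
    by (rule transport_back[OF H(1) f1(1) H(2) H(4) H(5) \<gamma>0 m])
  also have "transport m (\<lambda>x. H (1,x)) ?\<delta> = transport m g1 (\<lambda>s. K (0,s))"
    by (rule transport_cong) (simp_all add: H(3) K(2))
  also have "based_htpc m N b1 (transport m g1 (\<lambda>s. K (0,s))) (transport m g1 (\<lambda>s. K (1,s)))"
    by (rule transport_path_homotopy[OF g1 K(1)]) (use K(4,5) \<delta> in auto)
  finally have 1: "based_htpc m N b1 f1 (transport m g1 (\<lambda>s. K (1,s)))" .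
  show ?thesis
  proof (rule that[OF _ 1])
    show "transport m g1 (\<lambda>s. K (1,s)) \<in> based_maps m N b1"
      using transport_based[OF g1 pathin_slice[OF K(1), of 1] K0(1)] K0(2) by simp
    have "pathin N (\<lambda>_. p2)" using p2 by (simp add: pathin_def)
    then show "transport m g2 (\<lambda>_. p2) \<in> based_maps m N p2"
      using transport_based[OF g2, of "\<lambda>_. p2"] by simp
    show "based_htpc m N p2 g2 (transport m g2 (\<lambda>_. p2))" by (rule transport_const[OF g2 p2])
    show "transport m g1 (\<lambda>s. K (1,s)) x \<noteq> transport m g2 (\<lambda>_. p2) x" if "x \<in> cube m" for x
      by (rule transport_disjoint[OF disj K(3) that])
  qed
qed

text \<open>Nonempty open sets of the model space are infinite. This supplies a third point for
  parking a base point.\<close>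

lemma manifold_infinite:
  assumes N: "smooth_manifold N TYPE('n::finite)" and p: "p \<in> topspace N"
  shows "infinite (topspace N)"
proof
  assume fin: "finite (topspace N)"
  obtain U and \<phi> :: "'a \<Rightarrow> real^'n" where U: "openin N U" "p \<in> U" "open (\<phi> ` U)"
    using manifold_chart[OF N p] by metis
  have "finite (\<phi> ` U)" using fin openin_subset[OF U(1)] finite_subset by blast
  then have "\<phi> ` U = {}" using U(3) finite_imp_not_open by blast
  then show False using U(2) by simp
qed

lemma path_between:
  assumes "smooth_manifold N TYPE('n::finite)" "connected_space N" "p \<in> topspace N" "q \<in> topspace N"
  obtains \<gamma> where "pathin N \<gamma>" "\<gamma> 0 = p" "\<gamma> 1 = q"
  using manifold_path_connected[OF assms(1,2)] assms(3,4) unfolding path_connected_space_def by blast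

text \<open>\<open>rebase_first\<close> is applied twice: \<open>f\<close> is brought to
  \<open>b1\<close> while the other map rests at \<open>q\<close>, then \<open>g\<close> is brought
  to \<open>b2\<close> while the first rests at \<open>b1\<close>. The first application needs
  \<open>q \<noteq> b1\<close>, the second \<open>b2 \<noteq> b1\<close>.\<close>

lemma based_disjoint_dim_ge_2:
  assumes N: "smooth_manifold N TYPE('n::finite)" "connected_space N" and n: "CARD('n) \<ge> 2" and m: "m \<ge> 1"
    and b: "b1 \<noteq> b2" and f: "f \<in> based_maps m N b1" "free_htpc m N f f'" and g: "g \<in> based_maps m N b2" "free_htpc m N g g'"
    and f': "f' \<in> based_maps m N p1" and g': "g' \<in> based_maps m N p2"
    and disj: "\<And>x. x \<in> cube m \<Longrightarrow> f' x \<noteq> g' x"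
  shows "\<exists>f'' g''. f'' \<in> based_maps m N b1 \<and> based_htpc m N b1 f f'' \<and> g'' \<in> based_maps m N b2 \<and>
     based_htpc m N b2 g g'' \<and> (\<forall>x\<in>cube m. f'' x \<noteq> g'' x)"
proof -
  have p1: "p1 \<in> topspace N" and p2: "p2 \<in> topspace N" using based_maps_base_in f' g' m by auto
  have p12: "p1 \<noteq> p2" by (rule disjoint_base_points[OF f' g' m disj])
  have "\<exists>k1 k2 q. k1 \<in> based_maps m N p1 \<and> k2 \<in> based_maps m N q \<and> free_htpc m N f k1 \<and> free_htpc m N g k2 \<and>
     (\<forall>x\<in>cube m. k1 x \<noteq> k2 x) \<and> q \<noteq> b1"
  proof (cases "p2 = b1")
    case False
    then show ?thesis using f g f' g' disj by metis
  next
    \<comment> \<open>The resting point occupies the target, so it is moved aside to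
      \<open>q\<close> along a path that avoids \<open>p1\<close>. Only the free class of
      \<open>g\<close> has to survive this, so any such path will do.\<close>
    case True
    have "infinite (topspace N - {p1,p2})" using manifold_infinite[OF N(1) p1] by simp
    then obtain q where q: "q \<in> topspace N" "q \<noteq> p1" "q \<noteq> p2" by (metis DiffE ex_in_conv finite.emptyI insertCI)
    obtain \<eta> where \<eta>: "pathin N \<eta>" "\<eta> 0 = p2" "\<eta> 1 = q" by (rule path_between[OF N p2 q(1)])
    obtain K where K: "continuous_map (top_of_set ({0..1::real} \<times> {0..1::real})) N K"
      "\<And>t. t \<in> {0..1} \<Longrightarrow> K (1,t) \<noteq> p1"
      "\<And>t. t \<in> {0..1} \<Longrightarrow> K (t,0) = \<eta> 0" "\<And>t. t \<in> {0..1} \<Longrightarrow> K (t,1) = \<eta> 1"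
      using path_avoiding_point[OF N(1) n p1 \<eta>(1)] \<eta>(2,3) p12 q by metis
    have K0: "K (1,0) = p2" "K (1,1) = q" using K(3)[of 1] K(4)[of 1] \<eta> by auto
    have c: "pathin N (\<lambda>_. p1)" using p1 by (simp add: pathin_def)
    have d: "pathin N (\<lambda>s. K (1,s))" using pathin_slice[OF K(1), of 1] by simp
    let ?k1 = "transport m f' (\<lambda>_. p1)" and ?k2 = "transport m g' (\<lambda>s. K (1,s))"
    have "?k1 \<in> based_maps m N p1" using transport_based[OF f' c] by simp
    moreover have "?k2 \<in> based_maps m N q" using transport_based[OF g' d K0(1)] K0(2) by simp
    moreover have "free_htpc m N f ?k1" using free_htpc_trans[OF f(2) transport_free_htpc[OF f' c]] by simp
    moreover have "free_htpc m N g ?k2" using free_htpc_trans[OF g(2) transport_free_htpc[OF g' d K0(1)]] .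
    moreover have "\<forall>x\<in>cube m. ?k1 x \<noteq> ?k2 x"
    proof
      fix x assume x: "x \<in> cube m"
      show "?k1 x \<noteq> ?k2 x" by (rule transport_disjoint[OF disj _ x]) (use K(2) in auto)
    qed
    moreover have "q \<noteq> b1" using q True by simp
    ultimately show ?thesis by blast
  qed
  then obtain k1 k2 q where k: "k1 \<in> based_maps m N p1" "k2 \<in> based_maps m N q" "free_htpc m N f k1" "free_htpc m N g k2"
     "\<And>x. x\<in>cube m \<Longrightarrow> k1 x \<noteq> k2 x" "b1 \<noteq> q" by metis
  obtain f1 g1 where 1: "f1 \<in> based_maps m N b1" "based_htpc m N b1 f f1"
    "g1 \<in> based_maps m N q" "based_htpc m N q k2 g1" "\<And>x. x \<in> cube m \<Longrightarrow> f1 x \<noteq> g1 x"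
    using rebase_first[OF N(1) n m k(1,2,5) f(1) k(3,6)] by metis
  have gg: "free_htpc m N g g1" using free_htpc_trans[OF k(4) based_imp_free_htpc[OF 1(4)]] .
  obtain g2 f2 where 2: "g2 \<in> based_maps m N b2" "based_htpc m N b2 g g2"
    "f2 \<in> based_maps m N b1" "based_htpc m N b1 f1 f2" "\<And>x. x \<in> cube m \<Longrightarrow> g2 x \<noteq> f2 x"
    using rebase_first[OF N(1) n m 1(3,1) 1(5)[symmetric] g(1) gg b[symmetric]] by metis
  have "based_htpc m N b1 f f2" using based_htpc_trans[OF 1(2) 2(4)] .
  then show ?thesis using 2(1,2,3,5) by metis
qed

section \<open>Disjoint based representatives in dimension one\<close>

lemma circle_free_imp_based_htpc:
  assumes h: "homeomorphic_map N (top_of_set (sphere (0::complex) 1)) h" and m: "m \<ge> 1"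
    and f: "f \<in> based_maps m N b" and g: "g \<in> based_maps m N b" and fg: "free_htpc m N f g"
  shows "based_htpc m N b f g"
proof -
  obtain k where maps: "homeomorphic_maps N (top_of_set (sphere (0::complex) 1)) h k"
    using h by (auto simp: homeomorphic_map_maps)
  have ch: "continuous_map N euclidean h" and hs: "\<And>x. x \<in> topspace N \<Longrightarrow> norm (h x) = 1"
    and ck: "continuous_map (top_of_set (sphere 0 1)) N k" and kh: "\<And>x. x \<in> topspace N \<Longrightarrow> k (h x) = x"
    using maps by (auto simp: homeomorphic_maps_def continuous_map_in_subtopology image_subset_iff Pi_iff)
  note z = zero_in_cube_bd[OF m]
  obtain H \<gamma> where H: "continuous_map (top_of_set ({0..1::real} \<times> cube m)) N H"
    "\<And>x. x \<in> cube m \<Longrightarrow> H (0,x) = f x" "\<And>x. x \<in> cube m \<Longrightarrow> H (1,x) = g x"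
    "\<And>t x. t \<in> {0..1} \<Longrightarrow> x \<in> cube_bd m \<Longrightarrow> H (t,x) = \<gamma> t" "pathin N \<gamma>"
    using free_htpc_track[OF fg m] by metis
  have \<gamma>0: "\<gamma> 0 = b" using H(2)[OF cube_bd_subset[OF z]] H(4)[OF _ z, of 0] based_maps_bd[OF f z] by simp
  have \<gamma>1: "\<gamma> 1 = b" using H(3)[OF cube_bd_subset[OF z]] H(4)[OF _ z, of 1] based_maps_bd[OF g z] by simp
  have HN: "H y \<in> topspace N" if "y \<in> {0..1} \<times> cube m" for y using H(1) that by (auto simp: continuous_map_def)
  have \<gamma>N: "\<gamma> t \<in> topspace N" if "t \<in> {0..1}" for t using H(5) that by (auto simp: pathin_def continuous_map_def)
  have bN: "b \<in> topspace N" using \<gamma>N[of 0] \<gamma>0 by simp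
  have h0: "h x \<noteq> 0" if "x \<in> topspace N" for x using hs[OF that] by auto
  have cH: "continuous_on ({0..1} \<times> cube m) (\<lambda>y. h (H y))"
    using continuous_map_compose[OF H(1) ch] by (simp add: o_def)
  have c\<gamma>: "continuous_on {0..1} (\<lambda>t. h (\<gamma> t))"
    using continuous_map_compose[OF H(5)[unfolded pathin_def] ch] by (simp add: o_def)
  \<comment> \<open>Each stage of the homotopy is rotated so that its base point returns to
    \<open>h b\<close>; at both ends the track is already at \<open>b\<close> and the rotation is
    trivial.\<close>
  let ?w = "\<lambda>y. h (H y) / h (\<gamma> (fst y)) * h b"
  show ?thesis unfolding based_htpc_iff
  proof (intro exI[of _ "\<lambda>y. k (?w y)"] conjI ballI)
    show "continuous_map (top_of_set ({0..1::real} \<times> cube m)) N (\<lambda>y. k (?w y))"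
    proof (rule continuous_map_compose_set[OF ck])
      have "continuous_on ({0..1} \<times> cube m) (\<lambda>y. h (\<gamma> (fst y)))"
        by (rule continuous_on_compose2[OF c\<gamma> continuous_on_fst[OF continuous_on_id]]) auto
      then show "continuous_on ({0..1} \<times> cube m) ?w"
        using cH h0 \<gamma>N by (intro continuous_on_mult continuous_on_divide continuous_on_const) auto
      show "?w y \<in> sphere 0 1" if "y \<in> {0..1} \<times> cube m" for y
      proof -
        have "fst y \<in> {0..1}" using that by auto
        then show ?thesis using hs[OF HN[OF that]] hs[OF \<gamma>N] hs[OF bN] by (simp add: norm_mult norm_divide)
      qed
    qed
  next
    fix x assume x: "x \<in> cube m"
    then have "f x \<in> topspace N" "g x \<in> topspace N" using HN[of "(0,x)"] HN[of "(1,x)"] H(2,3) by auto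
    then show "k (?w (0,x)) = f x" "k (?w (1,x)) = g x" using H(2,3)[OF x] \<gamma>0 \<gamma>1 h0[OF bN] kh by auto
  next
    fix t :: real and x assume "t \<in> {0..1}" "x \<in> cube_bd m"
    then show "k (?w (t,x)) = b" using H(4) h0[OF \<gamma>N] kh[OF bN] by simp
  qed
qed

text \<open>Two distinct points of the circle are an angle and a gap strictly between 0 and
  \<open>2 * pi\<close>. Interpolating angles and gaps linearly keeps the gap in that range, so the
  moving points never meet.\<close>

lemma circle_disjoint_paths:
  assumes h: "homeomorphic_map N (top_of_set (sphere (0::complex) 1)) h"
    and N: "p1 \<in> topspace N" "p2 \<in> topspace N" "b1 \<in> topspace N" "b2 \<in> topspace N" "p1 \<noteq> p2" "b1 \<noteq> b2"
  obtains \<delta> \<epsilon> where "pathin N \<delta>" "\<delta> 0 = p1" "\<delta> 1 = b1" "pathin N \<epsilon>" "\<epsilon> 0 = p2" "\<epsilon> 1 = b2"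
    "\<And>t. t \<in> {0..1} \<Longrightarrow> \<delta> t \<noteq> \<epsilon> t"
proof -
  obtain k where maps: "homeomorphic_maps N (top_of_set (sphere (0::complex) 1)) h k"
    using h by (auto simp: homeomorphic_map_maps)
  have hs: "\<And>x. x \<in> topspace N \<Longrightarrow> norm (h x) = 1"
    and ck: "continuous_map (top_of_set (sphere 0 1)) N k" and kh: "\<And>x. x \<in> topspace N \<Longrightarrow> k (h x) = x"
    and hk: "\<And>w. norm w = 1 \<Longrightarrow> h (k w) = w"
    using maps by (auto simp: homeomorphic_maps_def continuous_map_in_subtopology image_subset_iff Pi_iff)
  have angles: "\<exists>\<alpha> \<theta>. h p = cis \<alpha> \<and> h q = cis (\<alpha> + \<theta>) \<and> 0 < \<theta> \<and> \<theta> < 2 * pi"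
    if "p \<in> topspace N" "q \<in> topspace N" "p \<noteq> q" for p q
  proof -
    have n: "norm (h p) = 1" "norm (h q) = 1" using hs that by auto
    have ne: "h p \<noteq> h q" using kh that by metis
    define \<alpha> where "\<alpha> = Arg2pi (h p)"
    define \<theta> where "\<theta> = Arg2pi (h q / h p)"
    have p: "h p = cis \<alpha>" using complex_norm_eq_1_exp[of "h p"] n by (simp add: \<alpha>_def cis_conv_exp mult.commute)
    have q: "h q / h p = cis \<theta>" using complex_norm_eq_1_exp[of "h q / h p"] n by (simp add: \<theta>_def cis_conv_exp norm_divide mult.commute)
    have "h q = cis (\<alpha> + \<theta>)" using p q n by (metis cis_mult nonzero_mult_div_cancel_left times_divide_eq_right cis_neq_zero mult.commute)
    moreover have "0 \<le> \<theta>" "\<theta> < 2 * pi" unfolding \<theta>_def by (rule Arg2pi_ge_0, rule Arg2pi_lt_2pi)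
    moreover have "\<theta> \<noteq> 0" using calculation(1) p ne by auto
    ultimately show ?thesis using p by (intro exI[of _ \<alpha>] exI[of _ \<theta>]) auto
  qed
  obtain \<alpha>0 \<theta>0 where 0: "h p1 = cis \<alpha>0" "h p2 = cis (\<alpha>0 + \<theta>0)" "0 < \<theta>0" "\<theta>0 < 2 * pi"
    using angles[OF N(1,2,5)] by blast
  obtain \<alpha>1 \<theta>1 where 1: "h b1 = cis \<alpha>1" "h b2 = cis (\<alpha>1 + \<theta>1)" "0 < \<theta>1" "\<theta>1 < 2 * pi"
    using angles[OF N(3,4,6)] by blast
  let ?a = "\<lambda>t. (1 - t) * \<alpha>0 + t * \<alpha>1" and ?th = "\<lambda>t. (1 - t) * \<theta>0 + t * \<theta>1"
  have path: "pathin N (\<lambda>t. k (cis (a t)))" if "continuous_on {0..1} a" for a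
    unfolding pathin_def
    by (rule continuous_map_compose_set[OF ck]) (auto intro!: continuous_on_cis that)
  show ?thesis
  proof (rule that[of "\<lambda>t. k (cis (?a t))" "\<lambda>t. k (cis (?a t + ?th t))"])
    show "pathin N (\<lambda>t. k (cis (?a t)))" "pathin N (\<lambda>t. k (cis (?a t + ?th t)))"
      by (auto intro!: path continuous_intros)
    show "k (cis (?a 0)) = p1" "k (cis (?a 1)) = b1" "k (cis (?a 0 + ?th 0)) = p2" "k (cis (?a 1 + ?th 1)) = b2"
      using 0(1,2)[symmetric] 1(1,2)[symmetric] kh N by auto
    fix t :: real assume t: "t \<in> {0..1}"
    have th: "0 < ?th t" "?th t < 2 * pi"
    proof -
      show "0 < ?th t" using t 0 1 by (cases "t = 0") (auto intro!: add_nonneg_pos)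
      have "?th t \<le> (1 - t) * max \<theta>0 \<theta>1 + t * max \<theta>0 \<theta>1" using t by (intro add_mono mult_left_mono) auto
      also have "\<dots> = max \<theta>0 \<theta>1" by (simp add: algebra_simps)
      finally show "?th t < 2 * pi" using 0 1 by simp
    qed
    show "k (cis (?a t)) \<noteq> k (cis (?a t + ?th t))"
    proof
      assume "k (cis (?a t)) = k (cis (?a t + ?th t))"
      then have "cis (?a t) = cis (?a t + ?th t)" using hk by (metis norm_cis)
      then have "cis (?a t) * 1 = cis (?a t) * cis (?th t)" unfolding mult_1_right cis_mult .
      then have "cis (?th t) = 1" using cis_neq_zero by (metis mult_cancel_left)
      then have "cos (?th t) = 1" by (metis cis.sel(1) one_complex.sel(1))
      then obtain i :: int where i: "?th t = of_int i * 2 * pi" using cos_one_2pi_int by (metis mult.assoc mult.commute)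
      then have "0 < i" "i < 1" using th pi_gt_zero by (auto simp: zero_less_mult_iff)
      then show False by simp
    qed
  qed
qed

lemma based_disjoint_dim_1:
  assumes N: "smooth_manifold N TYPE('n::finite)" "connected_space N" and n: "CARD('n) = 1" and m: "m \<ge> 1"
    and b: "b1 \<noteq> b2" and f: "f \<in> based_maps m N b1" "free_htpc m N f f'" and g: "g \<in> based_maps m N b2" "free_htpc m N g g'"
    and f': "f' \<in> based_maps m N p1" and g': "g' \<in> based_maps m N p2"
    and disj: "\<And>x. x \<in> cube m \<Longrightarrow> f' x \<noteq> g' x"
  shows "\<exists>f'' g''. f'' \<in> based_maps m N b1 \<and> based_htpc m N b1 f f'' \<and> g'' \<in> based_maps m N b2 \<and>
     based_htpc m N b2 g g'' \<and> (\<forall>x\<in>cube m. f'' x \<noteq> g'' x)"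
proof -
  have p1: "p1 \<in> topspace N" and p2: "p2 \<in> topspace N" and b1: "b1 \<in> topspace N" and b2: "b2 \<in> topspace N"
    using based_maps_base_in f' g' f g m by auto
  have p12: "p1 \<noteq> p2" by (rule disjoint_base_points[OF f' g' m disj])
  have haus: "Hausdorff_space N" using N(1) by (simp add: smooth_manifold_def)
  show ?thesis
  proof (cases "\<exists>U u u' V v v'. line_chart N U u u' \<and> line_chart N V v v' \<and> \<not> connectedin N (U \<inter> V)")
    case True
    then obtain U u u' V v v' where "line_chart N U u u'" "line_chart N V v v'" "\<not> connectedin N (U \<inter> V)" by metis
    then obtain h where h: "homeomorphic_map N (top_of_set (sphere (0::complex) 1)) h"
      using line_charts_circle[OF haus N(2)] by metis
    obtain \<delta> \<epsilon> where d: "pathin N \<delta>" "\<delta> 0 = p1" "\<delta> 1 = b1" and e: "pathin N \<epsilon>" "\<epsilon> 0 = p2" "\<epsilon> 1 = b2"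
      and de: "\<And>t. t \<in> {0..1} \<Longrightarrow> \<delta> t \<noteq> \<epsilon> t"
      using circle_disjoint_paths[OF h p1 p2 b1 b2 p12 b] by metis
    let ?f = "transport m f' \<delta>" and ?g = "transport m g' \<epsilon>"
    have fb: "?f \<in> based_maps m N b1" using transport_based[OF f' d(1,2)] d(3) by simp
    have gb: "?g \<in> based_maps m N b2" using transport_based[OF g' e(1,2)] e(3) by simp
    have "based_htpc m N b1 f ?f"
      by (rule circle_free_imp_based_htpc[OF h m f(1) fb free_htpc_trans[OF f(2) transport_free_htpc[OF f' d(1,2)]]])
    moreover have "based_htpc m N b2 g ?g"
      by (rule circle_free_imp_based_htpc[OF h m g(1) gb free_htpc_trans[OF g(2) transport_free_htpc[OF g' e(1,2)]]])
    moreover have "?f x \<noteq> ?g x" if "x \<in> cube m" for x by (rule transport_disjoint[OF disj de that])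
    ultimately show ?thesis using fb gb by metis
  next
    case False
    \<comment> \<open>The compact image lies in a single line chart and is contracted along straight
      lines in its coordinate, which leaves \<open>u b\<close> fixed. Afterwards the two distinct
      constant maps are disjoint representatives.\<close>
    have null: "based_htpc m N b f (\<lambda>x\<in>cube m. b)" if f: "f \<in> based_maps m N b" for f b
    proof -
      have bN: "b \<in> topspace N" by (rule based_maps_base_in[OF f m])
      have "compactin N (f ` cube m)"
        by (rule image_compactin[OF _ based_maps_continuous[OF f]]) (simp add: compactin_subtopology compact_cube)
      then obtain U u u' where U: "line_chart N U u u'" "f ` cube m \<subseteq> U"
        using compact_in_line_chart[OF haus N(2) manifold_line_chart[OF N(1) n] _ _ bN] False by metis
      have bU: "b \<in> U" using U(2) zero_in_cube_bd[OF m] based_maps_bd[OF f] cube_bd_subset by blast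
      note UD = line_chartD[OF U(1)]
      have "continuous_map (top_of_set (cube m)) (subtopology N U) f"
        using based_maps_continuous[OF f] U(2) by (auto simp: continuous_map_in_subtopology)
      from continuous_map_compose[OF this UD(2)] have uf: "continuous_on (cube m) (\<lambda>x. u (f x))" by (simp add: o_def)
      have "continuous_map (top_of_set ({0..1::real} \<times> cube m)) N (\<lambda>z. u' ((1 - fst z) * u (f (snd z)) + fst z * u b))"
      proof (rule continuous_map_compose_set[of UNIV])
        show "continuous_on ({0..1} \<times> cube m) (\<lambda>z. (1 - fst z) * u (f (snd z)) + fst z * u b)"
          by (intro continuous_on_add continuous_on_mult continuous_on_diff continuous_on_const continuous_on_fst
              continuous_on_id continuous_on_compose2[OF uf continuous_on_snd[OF continuous_on_id]]) auto
      qed (use UD(3) in auto)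
      then show ?thesis unfolding based_htpc_iff
      proof (intro exI[of _ "\<lambda>z. u' ((1 - fst z) * u (f (snd z)) + fst z * u b)"] conjI ballI)
        fix x assume "x \<in> cube m"
        then show "u' ((1 - fst (0,x)) * u (f (snd (0,x))) + fst (0,x) * u b) = f x"
          "u' ((1 - fst (1,x)) * u (f (snd (1,x))) + fst (1,x) * u b) = (\<lambda>x\<in>cube m. b) x"
          using U(2) UD(6) bU by auto
      next
        fix t :: real and x assume "x \<in> cube_bd m"
        then show "u' ((1 - fst (t,x)) * u (f (snd (t,x))) + fst (t,x) * u b) = b"
          using based_maps_bd[OF f] UD(6)[OF bU] by (simp add: algebra_simps)
      qed
    qed
    show ?thesis
      using null[OF f(1)] null[OF g(1)] const_based[OF b1] const_based[OF b2] b
      by (intro exI[of _ "\<lambda>x\<in>cube m. b1"] exI[of _ "\<lambda>x\<in>cube m. b2"]) auto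
  qed
qed

text \<open>The bridge to algebra: concatenation is defined for maps with a common base point,
  whereas the definition of looseness lets the two base points wander off. With based disjoint
  representatives the group operations can be performed pointwise.\<close>

lemma loose_cls_iff_disjoint:
  assumes N: "smooth_manifold N TYPE('n::finite)" "connected_space N" and m: "m \<ge> 1" and b: "b1 \<noteq> b2"
    and A: "A \<in> carrier (homotopy_group m N b1)" and B: "B \<in> carrier (homotopy_group m N b2)"
  shows "loose_cls m N A B \<longleftrightarrow> (\<exists>f\<in>A. \<exists>g\<in>B. \<forall>x\<in>cube m. f x \<noteq> g x)"
proof
  assume "loose_cls m N A B"
  then obtain f g f' g' where fg: "f \<in> A" "g \<in> B" "f' \<in> sphere_maps m N" "g' \<in> sphere_maps m N"
    "free_htpc m N f f'" "free_htpc m N g g'" and disj: "\<And>x. x\<in>cube m \<Longrightarrow> f' x \<noteq> g' x"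
    unfolding loose_cls_def loose_def by metis
  have f: "f \<in> based_maps m N b1" "A = htp_class m N b1 f" by (rule carrier_memD[OF A fg(1)])+
  have g: "g \<in> based_maps m N b2" "B = htp_class m N b2 g" by (rule carrier_memD[OF B fg(2)])+
  obtain p1 where p1: "f' \<in> based_maps m N p1" by (rule sphere_maps_based[OF fg(3) m])
  obtain p2 where p2: "g' \<in> based_maps m N p2" by (rule sphere_maps_based[OF fg(4) m])
  have "CARD('n) = 1 \<or> CARD('n) \<ge> 2" using zero_less_card_finite[where 'a='n] by linarith
  then have "\<exists>f'' g''. f'' \<in> based_maps m N b1 \<and> based_htpc m N b1 f f'' \<and> g'' \<in> based_maps m N b2 \<and>
     based_htpc m N b2 g g'' \<and> (\<forall>x\<in>cube m. f'' x \<noteq> g'' x)"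
    using based_disjoint_dim_1[OF N _ m b f(1) fg(5) g(1) fg(6) p1 p2 disj]
      based_disjoint_dim_ge_2[OF N _ m b f(1) fg(5) g(1) fg(6) p1 p2 disj] by auto
  then obtain f'' g'' where "f'' \<in> based_maps m N b1" "based_htpc m N b1 f f''" "g'' \<in> based_maps m N b2"
     "based_htpc m N b2 g g''" "\<forall>x\<in>cube m. f'' x \<noteq> g'' x" by metis
  moreover then have "f'' \<in> A" "g'' \<in> B" using f(2) g(2) by (simp_all add: htp_class_eq)
  ultimately show "\<exists>f\<in>A. \<exists>g\<in>B. \<forall>x\<in>cube m. f x \<noteq> g x" by metis
next
  assume "\<exists>f\<in>A. \<exists>g\<in>B. \<forall>x\<in>cube m. f x \<noteq> g x"
  then obtain f g where fg: "f \<in> A" "g \<in> B" "\<forall>x\<in>cube m. f x \<noteq> g x" by metis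
  have f: "f \<in> based_maps m N b1" and g: "g \<in> based_maps m N b2"
    by (rule carrier_memD[OF A fg(1)], rule carrier_memD[OF B fg(2)])
  have "loose m N f g" unfolding loose_def
    using fg(3) based_imp_sphere_maps f g based_imp_free_htpc based_htpc_refl by metis
  then show "loose_cls m N A B" unfolding loose_cls_def using fg(1,2) by metis
qed

lemma loose_sym: "loose m N f g \<longleftrightarrow> loose m N g f"
  unfolding loose_def by (metis (no_types, lifting))

lemma loose_cls_sym: "loose_cls m N A B \<longleftrightarrow> loose_cls m N B A"
  unfolding loose_cls_def by (metis loose_sym)

lemma loose_free_htpc:
  assumes "loose m N f g" "free_htpc m N f0 f" "free_htpc m N g0 g"
  shows "loose m N f0 g0"
  using assms free_htpc_trans unfolding loose_def by metis

text \<open>At each point of the cube, concatenation and reversal evaluate the maps into both base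
  points at the same rescaled point, so disjointness passes on.\<close>

lemma fiber_pair_loose_cls:
  assumes N: "smooth_manifold N TYPE('n::finite)" "connected_space N" and m: "m \<ge> 1" and b: "b1 \<noteq> b2"
    and b1: "b1 \<in> topspace N" and b2: "b2 \<in> topspace N"
  shows "fiber_pair (homotopy_group m N b1) (homotopy_group m N b2) (loose_cls m N)"
proof -
  let ?G1 = "homotopy_group m N b1" and ?G2 = "homotopy_group m N b2"
  interpret G1: group ?G1 by (rule homotopy_group_group[OF m b1])
  interpret G2: group ?G2 by (rule homotopy_group_group[OF m b2])
  note key = loose_cls_iff_disjoint[OF N m b]
  have disjI: "loose_cls m N (htp_class m N b1 f) (htp_class m N b2 g)"
    if "f \<in> based_maps m N b1" "g \<in> based_maps m N b2" "\<And>x. x \<in> cube m \<Longrightarrow> f x \<noteq> g x" for f g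
    using key[OF htp_class_in_carrier[OF that(1)] htp_class_in_carrier[OF that(2)]]
      htp_class_self[OF that(1)] htp_class_self[OF that(2)] that(3) by metis
  have disjE: "\<exists>f g. f \<in> based_maps m N b1 \<and> g \<in> based_maps m N b2 \<and> A = htp_class m N b1 f \<and> B = htp_class m N b2 g
      \<and> (\<forall>x\<in>cube m. f x \<noteq> g x)"
    if A: "A \<in> carrier ?G1" and B: "B \<in> carrier ?G2" and L: "loose_cls m N A B" for A B
  proof -
    obtain f g where fg: "f \<in> A" "g \<in> B" "\<forall>x\<in>cube m. f x \<noteq> g x" using key[OF A B] L by metis
    then show ?thesis using carrier_memD[OF A fg(1)] carrier_memD[OF B fg(2)] by metis
  qed
  show ?thesis
  proof unfold_locales
    show "loose_cls m N \<one>\<^bsub>?G1\<^esub> \<one>\<^bsub>?G2\<^esub>"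
      unfolding homotopy_group_one by (rule disjI) (use const_based b1 b2 b in auto)
  next
    fix A B A' B' assume A: "A \<in> carrier ?G1" and B: "B \<in> carrier ?G2" and A': "A' \<in> carrier ?G1" and B': "B' \<in> carrier ?G2"
      and L: "loose_cls m N A B" and L': "loose_cls m N A' B'"
    obtain f g where fg: "f \<in> based_maps m N b1" "g \<in> based_maps m N b2" "A = htp_class m N b1 f" "B = htp_class m N b2 g"
      "\<forall>x\<in>cube m. f x \<noteq> g x" using disjE[OF A B L] by metis
    obtain f' g' where fg': "f' \<in> based_maps m N b1" "g' \<in> based_maps m N b2" "A' = htp_class m N b1 f'" "B' = htp_class m N b2 g'"
      "\<forall>x\<in>cube m. f' x \<noteq> g' x" using disjE[OF A' B' L'] by metis
    have "concat_cube m f f' x \<noteq> concat_cube m g g' x" if x: "x \<in> cube m" for x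
      using fg(5) fg'(5) cube_coord[OF m x] cube_upd[OF m x] by (simp add: concat_cube_eq[OF x])
    then show "loose_cls m N (A \<otimes>\<^bsub>?G1\<^esub> A') (B \<otimes>\<^bsub>?G2\<^esub> B')"
      unfolding fg(3,4) fg'(3,4) htp_class_mult[OF m fg(1) fg'(1)] htp_class_mult[OF m fg(2) fg'(2)]
      by (intro disjI concat_based[OF m] fg(1,2) fg'(1,2))
  next
    fix A B assume A: "A \<in> carrier ?G1" and B: "B \<in> carrier ?G2" and L: "loose_cls m N A B"
    obtain f g where fg: "f \<in> based_maps m N b1" "g \<in> based_maps m N b2" "A = htp_class m N b1 f" "B = htp_class m N b2 g"
      "\<forall>x\<in>cube m. f x \<noteq> g x" using disjE[OF A B L] by metis
    have "rev_cube m f x \<noteq> rev_cube m g x" if x: "x \<in> cube m" for x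
      using fg(5) cube_coord[OF m x] cube_upd[OF m x] x by (simp add: rev_cube_def)
    then show "loose_cls m N (inv\<^bsub>?G1\<^esub> A) (inv\<^bsub>?G2\<^esub> B)"
      unfolding fg(3,4) htp_class_inv[OF m b1 fg(1)] htp_class_inv[OF m b2 fg(2)]
      by (intro disjI rev_cube_based[OF m] fg(1,2))
  qed
qed

text \<open>\<open>pi_c\<close> speaks of the single constant map, the group argument of the
  identity class. Looseness is invariant under homotopy, so the two conditions agree.\<close>

lemma loose_cls_const:
  assumes b: "b' \<in> topspace N"
  shows "loose_cls m N A {\<lambda>x\<in>cube m. b'} \<longleftrightarrow> loose_cls m N A \<one>\<^bsub>homotopy_group m N b'\<^esub>"
proof
  assume "loose_cls m N A {\<lambda>x\<in>cube m. b'}"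
  then show "loose_cls m N A \<one>\<^bsub>homotopy_group m N b'\<^esub>"
    using htp_class_self[OF const_based[OF b]] unfolding loose_cls_def homotopy_group_one by blast
next
  assume "loose_cls m N A \<one>\<^bsub>homotopy_group m N b'\<^esub>"
  then obtain f g where fg: "f \<in> A" "loose m N f g" "based_htpc m N b' (\<lambda>x\<in>cube m. b') g"
    unfolding loose_cls_def homotopy_group_one htp_class_eq by blast
  then have "loose m N f (\<lambda>x\<in>cube m. b')"
    using based_imp_free_htpc[OF fg(3)] free_htpc_trans unfolding loose_def by metis
  then show "loose_cls m N A {\<lambda>x\<in>cube m. b'}" using fg(1) unfolding loose_cls_def by blast
qed

section \<open>Maps that miss a point\<close>

lemma const_free_htpc:
  assumes "pathin N \<eta>"
  shows "free_htpc m N (\<lambda>x\<in>cube m. \<eta> 0) (\<lambda>x\<in>cube m. \<eta> 1)"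
proof -
  have "continuous_map (top_of_set ({0..1::real} \<times> cube m)) N (\<lambda>z. \<eta> (fst z))"
  proof (rule continuous_map_compose_set[OF assms[unfolded pathin_def]])
    show "continuous_on ({0..1::real} \<times> cube m) fst" by (intro continuous_on_fst continuous_on_id)
  qed auto
  then show ?thesis unfolding free_htpc_iff by (intro exI[of _ "\<lambda>z. \<eta> (fst z)"]) auto
qed

text \<open>It does not matter which point is missed: the constant map at \<open>b'\<close> is
  freely homotopic to the constant map at any \<open>q\<close>, by path connectedness.\<close>

lemma pi_c_eq_carrier:
  assumes N: "smooth_manifold N TYPE('n::finite)" "connected_space N" and m: "m \<ge> 1"
    and b: "b \<in> topspace N" "b' \<in> topspace N" "b \<noteq> b'"
    and hyp: "\<not> compact_space N \<or> m < CARD('n)"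
  shows "pi_c m N b b' = carrier (homotopy_group m N b)"
proof -
  have "loose_cls m N A {\<lambda>x\<in>cube m. b'}" if A: "A \<in> carrier (homotopy_group m N b)" for A
  proof -
    obtain f where fA: "f \<in> A" using carrier_ex_mem[OF A] by blast
    have f: "f \<in> based_maps m N b" by (rule carrier_memD[OF A fA])
    have "\<exists>g q. g \<in> based_maps m N b \<and> based_htpc m N b f g \<and> q \<in> topspace N \<and> (\<forall>x\<in>cube m. g x \<noteq> q)"
    proof (cases "compact_space N")
      case True
      then have "m < CARD('n)" using hyp by simp
      from based_htpc_avoiding_point[OF N(1) this b(2) f b(3)] show ?thesis using b(2) by metis
    next
      case False
      have "compactin N (f ` cube m)"
        by (rule image_compactin[OF _ based_maps_continuous[OF f]]) (simp add: compactin_subtopology compact_cube)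
      then have "f ` cube m \<noteq> topspace N" using False by (auto simp: compact_space_def)
      moreover have "f ` cube m \<subseteq> topspace N"
        using based_maps_continuous[OF f] by (auto simp: continuous_map_def)
      ultimately obtain q where "q \<in> topspace N" "q \<notin> f ` cube m" by blast
      then show ?thesis using f based_htpc_refl[OF f] by blast
    qed
    then obtain g q where g: "g \<in> based_maps m N b" "based_htpc m N b f g" "q \<in> topspace N" "\<forall>x\<in>cube m. g x \<noteq> q" by metis
    obtain \<eta> where "pathin N \<eta>" "\<eta> 0 = b'" "\<eta> 1 = q" by (rule path_between[OF N b(2) g(3)])
    then have "free_htpc m N (\<lambda>x\<in>cube m. b') (\<lambda>x\<in>cube m. q)" using const_free_htpc by metis
    moreover have "(\<lambda>x\<in>cube m. q) \<in> sphere_maps m N" by (rule based_imp_sphere_maps[OF const_based[OF g(3)]])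
    ultimately have "loose m N f (\<lambda>x\<in>cube m. b')" unfolding loose_def
      using g(4) based_imp_sphere_maps[OF g(1)] based_imp_free_htpc[OF g(2)]
      by (intro exI[of _ g] exI[of _ "\<lambda>x\<in>cube m. q"]) simp
    then show ?thesis using fA unfolding loose_cls_def by blast
  qed
  then show ?thesis unfolding pi_c_def by blast
qed

theorem theorem1p18:
  fixes N :: "'a topology" and m :: nat and b1 b2 :: 'a
  assumes "smooth_manifold N TYPE('n::finite)"
    and "connected_space N"
    and "m \<ge> 1"
    and "b1 \<in> topspace N" and "b2 \<in> topspace N" and "b1 \<noteq> b2"
  defines "G1 \<equiv> homotopy_group m N b1" and "G2 \<equiv> homotopy_group m N b2"
    and "C1 \<equiv> pi_c m N b1 b2" and "C2 \<equiv> pi_c m N b2 b1"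
    and "P1 \<equiv> pi_2 m N b1 b2" and "P2 \<equiv> pi_2 m N b2 b1"
  shows
    "group G1 \<and> group G2 \<and>
     C1 \<subseteq> P1 \<and> subgroup C1 G1 \<and> subgroup P1 G1 \<and>
     C2 \<subseteq> P2 \<and> subgroup C2 G2 \<and> subgroup P2 G2 \<and>
     C1 \<lhd> subgroup_generated G1 P1 \<and> C2 \<lhd> subgroup_generated G2 P2 \<and>
     (\<exists>c. c \<in> iso (subgroup_generated G1 P1 Mod C1) (subgroup_generated G2 P2 Mod C2) \<and>
          (\<forall>A\<in>P1. \<forall>B\<in>P2. loose_cls m N A B \<longrightarrow> c (C1 #>\<^bsub>G1\<^esub> A) = C2 #>\<^bsub>G2\<^esub> B) \<and>
          (\<forall>A\<in>carrier G1. \<forall>B\<in>carrier G2.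
              loose_cls m N A B \<longleftrightarrow>
              (A \<in> P1 \<and> B \<in> P2 \<and> c (C1 #>\<^bsub>G1\<^esub> A) = C2 #>\<^bsub>G2\<^esub> B))) \<and>
     ((C1 = carrier G1 \<and> C2 = carrier G2) \<longrightarrow>
        (\<forall>f1\<in>sphere_maps m N. \<forall>f2\<in>sphere_maps m N. loose m N f1 f2)) \<and>
     ((\<not> compact_space N \<or> m < CARD('n)) \<longrightarrow> C1 = carrier G1 \<and> C2 = carrier G2)"
proof -
  note N = assms(1,2) and m = assms(3) and b1 = assms(4) and b2 = assms(5) and b = assms(6)
  interpret A: fiber_pair G1 G2 "loose_cls m N"
    unfolding G1_def G2_def by (rule fiber_pair_loose_cls[OF N m b b1 b2])
  \<comment> \<open>Looseness is symmetric, so the same lemma with \<open>b1\<close> and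
    \<open>b2\<close> exchanged provides the instance for the swapped relation.\<close>
  have flip: "(\<lambda>B A. loose_cls m N A B) = loose_cls m N"
    by (intro ext) (rule loose_cls_sym)
  have "fiber_pair G2 G1 (loose_cls m N)"
    unfolding G1_def G2_def by (rule fiber_pair_loose_cls[OF N m b[symmetric] b2 b1])
  then interpret B: fiber_pair G2 G1 "\<lambda>B A. loose_cls m N A B"
    by (rule ssubst[where P = "fiber_pair G2 G1", OF flip])
  interpret S: fiber_pair_sym G1 G2 "loose_cls m N" ..
  have C1: "C1 = A.C1"
    unfolding A.C1_def unfolding C1_def pi_c_def loose_cls_const[OF b2] G1_def G2_def ..
  have C2: "C2 = B.C1"
    unfolding B.C1_def unfolding C2_def pi_c_def loose_cls_const[OF b1] G1_def G2_def
      loose_cls_sym[of m N "\<one>\<^bsub>homotopy_group m N b1\<^esub>"] ..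
  have P1: "P1 = A.P1" unfolding A.P1_def unfolding P1_def pi_2_def G1_def G2_def ..
  have P2: "P2 = B.P1"
    unfolding B.P1_def unfolding P2_def pi_2_def G1_def G2_def by (subst loose_cls_sym) (rule refl)
  have all: "loose m N f1 f2" if full: "C1 = carrier G1" "C2 = carrier G2"
    and f1: "f1 \<in> sphere_maps m N" and f2: "f2 \<in> sphere_maps m N" for f1 f2
  proof -
    obtain p1 where p1: "p1 \<in> topspace N" "f1 \<in> based_maps m N p1" by (rule sphere_maps_based[OF f1 m])
    obtain p2 where p2: "p2 \<in> topspace N" "f2 \<in> based_maps m N p2" by (rule sphere_maps_based[OF f2 m])
    obtain \<delta> where d: "pathin N \<delta>" "\<delta> 0 = p1" "\<delta> 1 = b1" by (rule path_between[OF N p1(1) b1])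
    obtain \<epsilon> where e: "pathin N \<epsilon>" "\<epsilon> 0 = p2" "\<epsilon> 1 = b2" by (rule path_between[OF N p2(1) b2])
    \<comment> \<open>Arbitrary maps are first transported to the base points \<open>b1\<close> and
      \<open>b2\<close>; this is a free homotopy and does not affect looseness.\<close>
    let ?f = "transport m f1 \<delta>" and ?g = "transport m f2 \<epsilon>"
    have f: "?f \<in> based_maps m N b1" using transport_based[OF p1(2) d(1,2)] d(3) by simp
    have g: "?g \<in> based_maps m N b2" using transport_based[OF p2(2) e(1,2)] e(3) by simp
    let ?A = "htp_class m N b1 ?f" and ?B = "htp_class m N b2 ?g"
    have A: "?A \<in> carrier G1" and B: "?B \<in> carrier G2"
      unfolding G1_def G2_def by (rule htp_class_in_carrier[OF f], rule htp_class_in_carrier[OF g])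
    \<comment> \<open>The hypotheses only give looseness against constants, that is for
      \<open>(A, 1)\<close> and \<open>(1, B)\<close>; their product is the pair
      \<open>(A, B)\<close>.\<close>
    have "loose_cls m N ?A \<one>\<^bsub>G2\<^esub>" "loose_cls m N \<one>\<^bsub>G1\<^esub> ?B"
      using A B full unfolding C1 C2 A.C1_def B.C1_def by blast+
    then have "loose_cls m N (?A \<otimes>\<^bsub>G1\<^esub> \<one>\<^bsub>G1\<^esub>) (\<one>\<^bsub>G2\<^esub> \<otimes>\<^bsub>G2\<^esub> ?B)"
      using A B by (intro A.L_mult) auto
    then have "loose_cls m N ?A ?B" using A B by simp
    then obtain f' g' where fg: "f' \<in> ?A" "g' \<in> ?B" "loose m N f' g'" unfolding loose_cls_def by blast
    have "based_htpc m N b1 ?f f'" "based_htpc m N b2 ?g g'" using fg(1,2) by (simp_all add: htp_class_eq)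
    then have "free_htpc m N f1 f'" "free_htpc m N f2 g'"
      by (auto intro: free_htpc_trans[OF transport_free_htpc[OF p1(2) d(1,2)]]
          free_htpc_trans[OF transport_free_htpc[OF p2(2) e(1,2)]] based_imp_free_htpc)
    then show ?thesis by (rule loose_free_htpc[OF fg(3)])
  qed
  have iso: "S.cmap \<in> iso (subgroup_generated G1 P1 Mod C1) (subgroup_generated G2 P2 Mod C2)"
    unfolding C1 C2 P1 P2 by (rule S.cmap_iso)
  have c_eq: "S.cmap (C1 #>\<^bsub>G1\<^esub> A) = C2 #>\<^bsub>G2\<^esub> B" if "A \<in> P1" "B \<in> P2" "loose_cls m N A B" for A B
    using that S.cmap_eq unfolding C1 C2 P1 P2 A.P1_def B.P1_def by blast
  have c_iff: "loose_cls m N A B \<longleftrightarrow> A \<in> P1 \<and> B \<in> P2 \<and> S.cmap (C1 #>\<^bsub>G1\<^esub> A) = C2 #>\<^bsub>G2\<^esub> B"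
    if "A \<in> carrier G1" "B \<in> carrier G2" for A B
    unfolding C1 C2 P1 P2 by (rule S.cmap_iff[OF that])
  have big: "C1 = carrier G1 \<and> C2 = carrier G2" if "\<not> compact_space N \<or> m < CARD('n)"
    unfolding C1_def C2_def G1_def G2_def
    using pi_c_eq_carrier[OF N m b1 b2 b that] pi_c_eq_carrier[OF N m b2 b1 b[symmetric] that] by blast
  show ?thesis
  proof (intro conjI)
    show "group G1" "group G2" by (rule A.G1.group_axioms, rule A.G2.group_axioms)
    show "C1 \<subseteq> P1" "subgroup C1 G1" "subgroup P1 G1" "C1 \<lhd> subgroup_generated G1 P1"
      unfolding C1 P1 by (rule A.C1_subset_P1 A.subgroup_C1 A.subgroup_P1 A.C1_normal)+
    show "C2 \<subseteq> P2" "subgroup C2 G2" "subgroup P2 G2" "C2 \<lhd> subgroup_generated G2 P2"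
      unfolding C2 P2 by (rule B.C1_subset_P1 B.subgroup_C1 B.subgroup_P1 B.C1_normal)+
    show "\<exists>c. c \<in> iso (subgroup_generated G1 P1 Mod C1) (subgroup_generated G2 P2 Mod C2) \<and>
          (\<forall>A\<in>P1. \<forall>B\<in>P2. loose_cls m N A B \<longrightarrow> c (C1 #>\<^bsub>G1\<^esub> A) = C2 #>\<^bsub>G2\<^esub> B) \<and>
          (\<forall>A\<in>carrier G1. \<forall>B\<in>carrier G2.
              loose_cls m N A B \<longleftrightarrow>
              (A \<in> P1 \<and> B \<in> P2 \<and> c (C1 #>\<^bsub>G1\<^esub> A) = C2 #>\<^bsub>G2\<^esub> B))"
      by (intro exI[of _ S.cmap] conjI ballI impI iso c_eq c_iff)
    show "C1 = carrier G1 \<and> C2 = carrier G2 \<longrightarrow> (\<forall>f1\<in>sphere_maps m N. \<forall>f2\<in>sphere_maps m N. loose m N f1 f2)"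
      using all by blast
    show "\<not> compact_space N \<or> m < CARD('n) \<longrightarrow> C1 = carrier G1 \<and> C2 = carrier G2"
      using big by blast
  qed
qed

end
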